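(* Let $\psi\in(0,\pi)$ be fixed and let $\mathcal A_\psi\colon L^2(\mathbb S^2)\to L^2(\mathrm{SO}(3))$, $\mathcal A_\psi f(Q)=\mathcal Af(Q,\psi)$. Then $\mathcal A_\psi$ has the singular value decomposition \[ \left\{\left(Y_n^k, Z_{n,\psi}^k, \mu_n(\psi)\right): n\in\mathbb N_0,\ k\in\{-n,\dots,n\}\right\} \] with singular values \[ \mu_n(\psi)=\sqrt{\sum_{j=-n}^n\frac{8\pi^2}{2n+1}\left|\widetilde P_n^j(0)\right|^2 s_j(\psi)^2} \] and singular functions \[ Z_{n,\psi}^k=\frac{\mathcal A_\psi Y_n^k}{\mu_n(\psi)}=\frac{1}{\mu_n(\psi)}\sum_{j=-n}^n\widetilde P_n^j(0)\,s_j(\psi)\,D_n^{j,k}. \] In particular, $\mathcal A_\psi$ is injective.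
   Context: $\mathbb S^2$ is the unit sphere in $\mathbb R^3$ with spherical coordinates $\xi(\varphi,\vartheta)=(\cos\varphi\sin\vartheta,\sin\varphi\sin\vartheta,\cos\vartheta)^\top$ and surface measure $\sin\vartheta\,d\varphi\,d\vartheta$. Associated Legendre functions $P_n^k(t)=\frac{(-1)^k}{2^n n!}(1-t^2)^{k/2}\frac{d^{n+k}}{dt^{n+k}}(t^2-1)^n$ ($k=0,\dots,n$), normalized $\widetilde P_n^k=\sqrt{\frac{2n+1}{4\pi}\frac{(n-k)!}{(n+k)!}}P_n^k$, $\widetilde P_n^{-k}=(-1)^k\widetilde P_n^k$. Spherical harmonics $Y_n^k(\xi(\varphi,\vartheta))=\widetilde P_n^k(\cos\vartheta)e^{ik\varphi}$. Rotations: $Q(\alpha,\beta,\gamma)=R_3(\alpha)R_2(\beta)R_3(\gamma)$ (zyz Euler angles; $R_3$, $R_2$ the rotations about the third and second coordinate axes) with measure $\int_{\mathrm{SO}(3)}g\,dQ=\int_0^{2\pi}\int_0^\pi\int_0^{2\pi}g(Q(\alpha,\beta,\gamma))\sin\beta\,d\alpha\,d\beta\,d\gamma$. Wigner D-functions $D_n^{k,j}(Q(\alpha,\beta,\gamma))=e^{-ik\alpha}d_n^{k,j}(\cos\beta)e^{-ij\gamma}$ with $d_n^{k,j}(t)=\frac{(-1)^{n-j}}{2^n}\sqrt{\frac{(n+k)!(1-t)^{j-k}}{(n-j)!(n+j)!(n-k)!(1+t)^{j+k}}}\left(\frac{d}{dt}\right)^{n-k}\left[(1+t)^{n+j}(1-t)^{n-j}\right]$.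 With $e_\varphi=(\cos\varphi,\sin\varphi,0)^\top$, the arc transform of $f\in C(\mathbb S^2)$ is $\mathcal Af(Q,\psi)=\int_{-\psi}^{\psi}f(Q^{-1}e_\varphi)\,d\varphi$ (extended to $L^2$). Let $s_0(\psi)=2\psi$ and $s_j(\psi)=\frac{2\sin(j\psi)}{j}$ for $j\neq0$. *)

theory Defs
  imports "HOL-Analysis.Analysis"
begin

definition xi :: "real \<Rightarrow> real \<Rightarrow> real^3" where
  "xi \<phi> \<theta> = vector [cos \<phi> * sin \<theta>, sin \<phi> * sin \<theta>, cos \<theta>]"

definition e_vec :: "real \<Rightarrow> real^3" where
  "e_vec \<phi> = vector [cos \<phi>, sin \<phi>, 0]"

definition R3 :: "real \<Rightarrow> real^3^3" where
  "R3 a = vector [vector [cos a, - sin a, 0], vector [sin a, cos a, 0], vector [0, 0, 1]]"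

definition R2 :: "real \<Rightarrow> real^3^3" where
  "R2 b = vector [vector [cos b, 0, sin b], vector [0, 1, 0], vector [- sin b, 0, cos b]]"

definition Qrot :: "real \<Rightarrow> real \<Rightarrow> real \<Rightarrow> real^3^3" where
  "Qrot a b g = R3 a ** R2 b ** R3 g"

definition sphere_measure :: "(real^3) measure" where
  "sphere_measure =
     distr (density lborel (\<lambda>p::real \<times> real.
               indicator ({0..2*pi} \<times> {0..pi}) p * ennreal (sin (snd p))))
           borel (\<lambda>p. xi (fst p) (snd p))"

definition so3_measure :: "(real^3^3) measure" where
  "so3_measure =
     distr (density lborel (\<lambda>p::real \<times> real \<times> real.
               indicator ({0..2*pi} \<times> {0..pi} \<times> {0..2*pi}) p * ennreal (sin (fst (snd p)))))
           borel (\<lambda>p. Qrot (fst p) (fst (snd p)) (snd (snd p)))"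

definition L2 :: "'a measure \<Rightarrow> ('a \<Rightarrow> complex) \<Rightarrow> bool" where
  "L2 M f \<longleftrightarrow> f \<in> borel_measurable M \<and> integrable M (\<lambda>x. (cmod (f x))\<^sup>2)"

definition l2_inner :: "'a measure \<Rightarrow> ('a \<Rightarrow> complex) \<Rightarrow> ('a \<Rightarrow> complex) \<Rightarrow> complex" where
  "l2_inner M f g = (LINT x|M. f x * cnj (g x))"

definition assoc_legendre :: "nat \<Rightarrow> nat \<Rightarrow> real \<Rightarrow> real" where
  "assoc_legendre n k t =
     (-1) ^ k / (2 ^ n * fact n) * sqrt (1 - t\<^sup>2) ^ k
       * (deriv ^^ (n + k)) (\<lambda>x. (x\<^sup>2 - 1) ^ n) t"

text \<open>Normalized associated Legendre function, for k in {-n..n}; negative order via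
  the symmetry relation of the paper.\<close>
definition norm_legendre :: "nat \<Rightarrow> int \<Rightarrow> real \<Rightarrow> real" where
  "norm_legendre n k t =
     (let m = nat \<bar>k\<bar> in
       (if k < 0 then (-1) ^ m else 1)
       * sqrt ((2 * real n + 1) / (4 * pi) * fact (n - m) / fact (n + m))
       * assoc_legendre n m t)"

text \<open>Y_n^k(xi(phi,theta)) = tilde P_n^k(cos theta) e^{i k phi}; written in Cartesian
  coordinates (cos theta = x_3, phi = arg(x_1 + i x_2)).\<close>
definition Ylm :: "nat \<Rightarrow> int \<Rightarrow> real^3 \<Rightarrow> complex" where
  "Ylm n k x = complex_of_real (norm_legendre n k (x$3)) * cis (of_int k * Arg (Complex (x$1) (x$2)))"

definition wigner_d :: "nat \<Rightarrow> int \<Rightarrow> int \<Rightarrow> real \<Rightarrow> real" where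
  "wigner_d n k j t =
     (-1) ^ nat (int n - j) / 2 ^ n
     * sqrt (fact (nat (int n + k)) * (1 - t) powi (j - k)
             / (fact (nat (int n - j)) * fact (nat (int n + j)) * fact (nat (int n - k))
                * (1 + t) powi (j + k)))
     * (deriv ^^ nat (int n - k)) (\<lambda>x. (1 + x) ^ nat (int n + j) * (1 - x) ^ nat (int n - j)) t"

text \<open>D_n^{k,j}(Q(alpha,beta,gamma)), as a function of the Euler angles.\<close>
definition wigner_D :: "nat \<Rightarrow> int \<Rightarrow> int \<Rightarrow> real \<Rightarrow> real \<Rightarrow> real \<Rightarrow> complex" where
  "wigner_D n k j a b g =
     cis (- of_int k * a) * complex_of_real (wigner_d n k j (cos b)) * cis (- of_int j * g)"

definition arc_transform :: "(real^3 \<Rightarrow> complex) \<Rightarrow> real^3^3 \<Rightarrow> real \<Rightarrow> complex" where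
  "arc_transform f Q \<psi> = (LBINT \<phi>=-\<psi>..\<psi>. f (transpose Q *v e_vec \<phi>))"

definition s_fun :: "int \<Rightarrow> real \<Rightarrow> real" where
  "s_fun j \<psi> = (if j = 0 then 2 * \<psi> else 2 * sin (of_int j * \<psi>) / of_int j)"

definition mu :: "nat \<Rightarrow> real \<Rightarrow> real" where
  "mu n \<psi> = sqrt (\<Sum>j\<in>{-int n..int n}.
                 8 * pi\<^sup>2 / (2 * real n + 1) * \<bar>norm_legendre n j 0\<bar>\<^sup>2 * (s_fun j \<psi>)\<^sup>2)"

definition Zsing :: "nat \<Rightarrow> int \<Rightarrow> real \<Rightarrow> real^3^3 \<Rightarrow> complex" where
  "Zsing n k \<psi> Q = arc_transform (Ylm n k) Q \<psi> / complex_of_real (mu n \<psi>)"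

end

(* Everything is reduced to the polynomial generating function of the Wigner matrix elements.
   With t = cos b, C = cos (b/2), S = sin (b/2), Taylor's formula turns the Rodrigues-type
   definition of d_n^{k,j} into a normalised coefficient of z^(n-k) in (C + S z)^(n+j) (C z - S)^(n-j),
   while the spherical harmonics Y_n^k(x) are the normalised coefficients of (x . q(z))^n, where
   q(z) = ((z^2 - 1)/2, -i (z^2 + 1)/2, z) is isotropic.  Rotations act on isotropic vectors by
   Moebius transformations, and comparing coefficients gives Y_n^k(Q^-1 x) = sum_j D_n^{j,k}(Q) Y_n^j(x).
   Orthogonality of the d_n^{k,j} is Jacobi orthogonality (integration by parts in Rodrigues' formula)
   for k >= |j|; the other cases follow from the symmetries of the bivariate generating function
   (C + S z - S w + C z w)^(2n).  Completeness of the Y_n^k is Stone-Weierstrass.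
   Boundedness of the arc transform needs that, for fixed phi, Q |-> Q^-1 e_phi maps the measure on
   SO(3) to 2 pi times the surface measure; both sides have the same integral of every Y_n^k,
   by the rotation formula and the orthogonality of the D_n^{j,k}, hence they agree.  The singular
   value expansion follows by applying the bounded operator to the expansion of f. *)
theory Submission
  imports Defs "HOL-Computational_Algebra.Polynomial"
begin

section \<open>Wigner matrix elements as polynomial coefficients\<close>

text \<open>The prefactor of d_n^{k,j} contains powers of 1 - t and 1 + t whose exponents may be
  negative, so its formula is used for 0 < b < pi only; the excluded angles form null sets, and the
  integral identities are obtained from identities that hold almost everywhere. Passing to
  coefficients removes the derivatives and the square roots together, and turns the index symmetries
  and the rotation formula into identities between polynomials in z. The push-forward is needed
  because a square integrable f has no definite integral over a given arc: Tonelli in Q and phi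
  requires the law of Q^-1 e_phi. Testing this law on harmonics derives it from orthogonality alone,
  without first proving that the measure on SO(3) is invariant. The factor 2 pi is the quotient of
  the total masses 8 pi^2 and 4 pi. The restriction on psi enters through the positivity of the
  singular values: P_n^j(0) vanishes for odd n - j, so for odd n the index j = 0 contributes
  nothing, and the index j = 1 contributes because sin psi is nonzero.\<close>

lemma deriv_poly_funpow: "(deriv ^^ m) (poly p) = poly ((pderiv ^^ m) p)" for p :: "real poly"
proof (induction m arbitrary: p)
  case (Suc m)
  have "deriv (poly p) = poly (pderiv p)"
    by (intro ext DERIV_imp_deriv poly_DERIV)
  then show ?case
    by (simp add: funpow_Suc_right Suc.IH del: funpow.simps)
qed simp

lemma pcompose_power: "pcompose (p ^ n) q = pcompose p q ^ n" for p :: "'a::comm_ring_1 poly"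
  by (induction n) (auto simp: pcompose_mult pcompose_1)

lemma pderiv_funpow_pcompose_linear:
  "(pderiv ^^ m) (pcompose p [:a, h:]) = smult (h ^ m) (pcompose ((pderiv ^^ m) p) [:a, h:])"
  for p :: "'a::{comm_ring_1,ring_no_zero_divisors,ring_char_0} poly"
proof (induction m arbitrary: p)
  case (Suc m)
  have "pderiv (pcompose p [:a, h:]) = smult h (pcompose (pderiv p) [:a, h:])"
    by (simp add: pderiv_pcompose pderiv_pCons)
  then show ?case
    by (simp add: funpow_Suc_right Suc.IH higher_pderiv_smult mult.commute del: funpow.simps)
qed simp

text \<open>Taylor's formula at \<open>a\<close> with increment h z. Multiplication by
  \<open>fact m\<close> keeps it free of division, so that it serves real and complex polynomials
  alike.\<close>

lemma coeff_pcompose_linear: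
  "fact m * coeff (pcompose p [:a, h:]) m = h ^ m * poly ((pderiv ^^ m) p) a"
  for p :: "'a::{comm_ring_1,ring_no_zero_divisors,ring_char_0} poly"
proof -
  have "coeff ((pderiv ^^ m) (pcompose p [:a, h:])) 0 = fact m * coeff (pcompose p [:a, h:]) m"
    by (simp add: coeff_higher_pderiv pochhammer_fact)
  moreover have "coeff (pcompose ((pderiv ^^ m) p) [:a, h:]) 0 = poly ((pderiv ^^ m) p) a"
    by (metis poly_0_coeff_0 poly_pcompose poly_pCons mult_zero_left add.right_neutral)
  ultimately show ?thesis
    by (simp add: pderiv_funpow_pcompose_linear)
qed

lemma coeff_pcompose_scale: "coeff (pcompose p [:0, h:]) m = h ^ m * coeff p m"
  for p :: "'a::{comm_ring_1,ring_no_zero_divisors,ring_char_0} poly"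
proof -
  have "fact m * coeff p m = poly ((pderiv ^^ m) p) 0"
    using coeff_pcompose_linear[of m p 0 1] by simp
  then have "fact m * coeff (pcompose p [:0, h:]) m = fact m * (h ^ m * coeff p m)"
    using coeff_pcompose_linear[of m p 0 h] by (metis mult.left_commute)
  then show ?thesis by simp
qed

lemma map_poly_of_real_mult:
  "map_poly complex_of_real (p * q) = map_poly of_real p * map_poly of_real q"
  by (intro poly_eqI) (simp add: coeff_map_poly coeff_mult)

lemma map_poly_of_real_power:
  "map_poly complex_of_real (p ^ n) = map_poly of_real p ^ n"
  by (induction n) (simp_all add: map_poly_of_real_mult)

text \<open>With N = 2n, m = n - k and l = n - j this is the unnormalised Wigner matrix element of order (k, j).\<close>
definition rot_coeff :: "nat \<Rightarrow> nat \<Rightarrow> nat \<Rightarrow> 'a::comm_ring_1 \<Rightarrow> 'a \<Rightarrow> 'a" where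
  "rot_coeff N m l c s = coeff ([:c, s:] ^ (N - l) * [:- s, c:] ^ l) m"

lemma rot_coeff_of_real:
  "rot_coeff N m l (of_real c) (of_real s) = complex_of_real (rot_coeff N m l c s)"
proof -
  have "complex_of_real (rot_coeff N m l c s)
      = coeff (map_poly of_real ([:c, s:] ^ (N - l) * [:- s, c:] ^ l)) m"
    by (simp add: rot_coeff_def coeff_map_poly)
  also have "\<dots> = rot_coeff N m l (of_real c) (of_real s)"
    by (simp add: rot_coeff_def map_poly_of_real_mult map_poly_of_real_power map_poly_pCons)
  finally show ?thesis by simp
qed

text \<open>For m, l <= N this is the square root of (N choose l) / (N choose m): the change from
  the monomials z^m to the basis sqrt (N choose m) z^m, in which rotations act on polynomials of
  degree at most N by orthogonal matrices.\<close>

definition wnorm :: "nat \<Rightarrow> nat \<Rightarrow> nat \<Rightarrow> real" where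
  "wnorm N m l = sqrt (fact m * fact (N - m) / (fact l * fact (N - l)))"

text \<open>With the Taylor increment h = sin b = 2 C S, the factors 1 + x and 1 - x at x = t + h z
  become 2C (C + S z) and -2S (C z - S). The leftover powers of 2, C and S cancel against the
  square-root prefactor.\<close>

lemma wigner_d_eq_rot_coeff:
  assumes b: "0 < b" "b < pi" and ml: "m \<le> 2 * n" "l \<le> 2 * n"
  shows "wigner_d n (int n - int m) (int n - int l) (cos b) =
    wnorm (2 * n) m l * rot_coeff (2 * n) m l (cos (b / 2)) (sin (b / 2))"
proof -
  define C S t where "C = cos (b / 2)" and "S = sin (b / 2)" and "t = cos b"
  have C: "C > 0" and S: "S > 0"
    unfolding C_def S_def using b by (auto intro!: cos_gt_zero sin_gt_zero)
  have t1: "1 + t = 2 * C\<^sup>2" and t2: "1 - t = 2 * S\<^sup>2"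
    using cos_double_cos[of "b / 2"] cos_double_sin[of "b / 2"] by (auto simp: C_def S_def t_def)
  define N where "N = 2 * n"
  define P where "P = poly ((pderiv ^^ m) ([:1, 1:] ^ (N - l) * [:1, -1:] ^ l)) t"
  define h where "h = 2 * C * S"
  have e1: "nat (int n + (int n - int l)) = N - l" "nat (int n - (int n - int l)) = l"
    "nat (int n - (int n - int m)) = m" "nat (int n + (int n - int m)) = N - m"
    using ml by (auto simp: N_def)
  have f: "(\<lambda>x::real. (1 + x) ^ (N - l) * (1 - x) ^ l) = poly ([:1, 1:] ^ (N - l) * [:1, -1:] ^ l)"
    by (auto simp: fun_eq_iff poly_power)
  have "pcompose ([:1, 1:] ^ (N - l) * [:1, -1:] ^ l) [:t, h:] = [:1 + t, h:] ^ (N - l) * [:1 - t, - h:] ^ l"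
    by (simp add: pcompose_mult pcompose_power pcompose_pCons)
  also have "[:1 + t, h:] = smult (2 * C) [:C, S:]"
    by (simp add: t1 h_def power2_eq_square)
  also have "[:1 - t, - h:] = smult (- (2 * S)) [:- S, C:]"
    by (simp add: t2 h_def power2_eq_square)
  finally have "coeff (pcompose ([:1, 1:] ^ (N - l) * [:1, -1:] ^ l) [:t, h:]) m
     = (2 * C) ^ (N - l) * (- (2 * S)) ^ l * rot_coeff N m l C S"
    unfolding smult_power mult_smult_left mult_smult_right coeff_smult
    by (simp add: rot_coeff_def mult_ac)
  with coeff_pcompose_linear[of m "[:1, 1:] ^ (N - l) * [:1, -1:] ^ l" t h]
  have 1: "h ^ m * P = fact m * ((2 * C) ^ (N - l) * (- (2 * S)) ^ l * rot_coeff N m l C S)"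
    by (simp add: P_def)
  have "sqrt (fact (N - m) * (1 - t) powi (int m - int l) / (fact l * fact (N - l) * fact m * (1 + t) powi (int (N - m) - int l)))
    = 2 powi (int m - int n) * S powi (int m - int l) / C powi (int (N - m) - int l)
        * sqrt (fact (N - m) / (fact l * fact (N - l) * fact m))"
  proof (rule real_sqrt_unique)
    \<comment> \<open>The factors 2 in 1 - t = 2 S^2 and 1 + t = 2 C^2 collect to the even exponent
      2m - 2n, so the root can be taken.\<close>
    have 2: "(2::real) powi (int m - int l) / 2 powi (int (N - m) - int l) = (2 powi (int m - int n))\<^sup>2"
    proof -
      have "int m - int l - (int (N - m) - int l) = (int m - int n) + (int m - int n)"
        using ml by (simp add: N_def of_nat_diff)
      then have "(2::real) powi (int m - int l) / 2 powi (int (N - m) - int l) = 2 powi ((int m - int n) + (int m - int n))"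
        by (metis power_int_diff zero_neq_numeral)
      then show ?thesis
        unfolding power2_eq_square by (metis power_int_add zero_neq_numeral)
    qed
    have sq: "(x\<^sup>2) powi i = (x powi i)\<^sup>2" for x :: real and i
      by (simp add: power2_eq_square power_int_mult_distrib)
    show "(2 powi (int m - int n) * S powi (int m - int l) / C powi (int (N - m) - int l)
        * sqrt (fact (N - m) / (fact l * fact (N - l) * fact m)))\<^sup>2 =
       fact (N - m) * (1 - t) powi (int m - int l) / (fact l * fact (N - l) * fact m * (1 + t) powi (int (N - m) - int l))"
      unfolding t1 t2 power_mult_distrib power_divide
      by (simp add: power_int_mult_distrib sq real_sqrt_pow2 mult_ac flip: 2)
  qed (use C S in auto)
  then have "wigner_d n (int n - int m) (int n - int l) t = (- 1) ^ l / 2 ^ n *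
     (2 powi (int m - int n) * S powi (int m - int l) / C powi (int (N - m) - int l)
        * sqrt (fact (N - m) / (fact l * fact (N - l) * fact m))) * P"
    unfolding wigner_d_def e1 f deriv_poly_funpow P_def[symmetric]
    using ml by (simp add: N_def of_nat_diff algebra_simps)
  also have "sqrt (fact (N - m) / (fact l * fact (N - l) * fact m)) = wnorm N m l / fact m"
    by (rule real_sqrt_unique) (auto simp: wnorm_def power_divide power2_eq_square)
  also have "(- 1) ^ l / 2 ^ n * (2 powi (int m - int n) * S powi (int m - int l) / C powi (int (N - m) - int l)
        * (wnorm N m l / fact m)) * P = wnorm N m l * rot_coeff N m l C S"
  proof -
    \<comment> \<open>\<open>B\<close> collects the powers produced by Taylor's formula,
      \<open>D\<close> those of the prefactor; they turn out to be inverse to each other.\<close>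
    define B where "B = (2 * C) ^ (N - l) * (- (2 * S)) ^ l / h ^ m"
    define D where "D = (- 1) ^ l / 2 ^ n * (2 powi (int m - int n) * S powi (int m - int l) / C powi (int (N - m) - int l))"
    have "P = fact m * B * rot_coeff N m l C S"
      using 1 C S by (simp add: h_def B_def field_simps)
    moreover have "D * B = 1"
    proof -
      have 2: "2 powi (int m - int n) * 2 ^ (N - l) * 2 ^ l = (2::real) ^ n * 2 ^ m"
      proof -
        have "(2::real) ^ (N - l) * 2 ^ l = 2 ^ n * 2 ^ n"
          using ml by (simp add: N_def flip: power_add)
        then show ?thesis
          by (simp add: power_int_diff mult.assoc)
      qed
      have C2: "C ^ (N - l) = C powi (int (N - m) - int l) * C ^ m"
      proof -
        have "C powi (int (N - m) - int l) * C ^ m = C powi (int (N - m) - int l + int m)"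
          using C by (subst power_int_add) auto
        also have "int (N - m) - int l + int m = int (N - l)" using ml by (auto simp: N_def)
        finally show ?thesis by simp
      qed
      have S2: "S powi (int m - int l) * S ^ l = S ^ m"
        using S by (simp add: power_int_diff)
      have m1: "(-1::real) ^ l * (-1) ^ l = 1" by (simp flip: power_mult_distrib)
      have ms: "(- (2 * S)) ^ l = (-1) ^ l * (2 ^ l * S ^ l)"
        by (simp add: power_minus[of "2 * S"] power_mult_distrib)
      have "(- 1) ^ l / 2 ^ n * (2 powi (int m - int n) * S powi (int m - int l) / C powi (int (N - m) - int l))
         * ((2 * C) ^ (N - l) * (- (2 * S)) ^ l / h ^ m)
       = ((- 1) ^ l * (-1) ^ l) * (2 powi (int m - int n) * 2 ^ (N - l) * 2 ^ l) * (S powi (int m - int l) * S ^ l)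
          * C ^ (N - l) / (2 ^ n * 2 ^ m * S ^ m * C powi (int (N - m) - int l) * C ^ m)"
        unfolding h_def ms by (simp add: power_mult_distrib mult_ac)
      also have "\<dots> = 1"
        unfolding m1 2 C2 S2 using C S by simp
      finally show ?thesis unfolding B_def D_def .
    qed
    moreover have "(- 1) ^ l / 2 ^ n * (2 powi (int m - int n) * S powi (int m - int l) / C powi (int (N - m) - int l)
        * (wnorm N m l / fact m)) * (fact m * B * rot_coeff N m l C S) = (D * B) * (wnorm N m l * rot_coeff N m l C S)"
      by (simp add: D_def)
    ultimately show ?thesis
      by simp
  qed
  finally show ?thesis
    by (simp add: N_def t_def C_def S_def)
qed

section \<open>Bivariate generating function and the index symmetries\<close>

lemma poly_eq_sum_le:
  fixes p :: "'a::comm_ring_1 poly"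
  assumes "degree p \<le> N"
  shows "poly p z = (\<Sum>i\<le>N. coeff p i * z ^ i)"
  unfolding poly_altdef
  using assms by (intro sum.mono_neutral_left) (auto simp: coeff_eq_0)

lemma bivariate_coeffs_unique:
  fixes a b :: "nat \<Rightarrow> nat \<Rightarrow> real"
  assumes "\<And>z w. (\<Sum>l\<le>N. \<Sum>m\<le>N. a m l * z ^ m * w ^ l) = (\<Sum>l\<le>N. \<Sum>m\<le>N. b m l * z ^ m * w ^ l)"
    and "m \<le> N" "l \<le> N"
  shows "a m l = b m l"
proof -
  have 1: "(\<Sum>m\<le>N. a m l * z ^ m) = (\<Sum>m\<le>N. b m l * z ^ m)" for z
  proof -
    have "\<forall>w. (\<Sum>l\<le>N. (\<Sum>m\<le>N. a m l * z ^ m) * w ^ l) = (\<Sum>l\<le>N. (\<Sum>m\<le>N. b m l * z ^ m) * w ^ l)"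
      using assms(1) by (simp add: sum_distrib_right)
    then show ?thesis
      using \<open>l \<le> N\<close> polyfun_eq_coeffs[of "\<lambda>l. \<Sum>m\<le>N. a m l * z ^ m" N "\<lambda>l. \<Sum>m\<le>N. b m l * z ^ m"]
      by blast
  qed
  then show ?thesis
    using \<open>m \<le> N\<close> polyfun_eq_coeffs[of "\<lambda>m. a m l" N "\<lambda>m. b m l"] by blast
qed

lemma degree_rot_poly: "l \<le> N \<Longrightarrow> degree ([:c, s:] ^ (N - l) * [:- s, c:] ^ l) \<le> N"
proof -
  assume "l \<le> N"
  have "degree ([:c, s:] ^ (N - l) * [:- s, c:] ^ l) \<le> degree ([:c, s:] ^ (N - l)) + degree ([:- s, c:] ^ l)"
    by (rule degree_mult_le)
  also have "\<dots> \<le> degree [:c, s:] * (N - l) + degree [:- s, c:] * l"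
    by (intro add_mono degree_power_le)
  also have "\<dots> \<le> 1 * (N - l) + 1 * l"
    by (intro add_mono mult_right_mono) auto
  finally show ?thesis using \<open>l \<le> N\<close> by simp
qed

text \<open>Binomial expansion in w of ((c + s z) + w (c z - s))^N. In the symmetric form on the
  right, exchanging z and w only changes the sign of s; this is the source of the transposition
  rule.\<close>

lemma rot_coeff_generating:
  fixes c s :: real
  shows "(\<Sum>l\<le>N. \<Sum>m\<le>N. (real (N choose l) * rot_coeff N m l c s) * z ^ m * w ^ l)
    = (c + s * z - s * w + c * z * w) ^ N"
proof -
  have "(c + s * z - s * w + c * z * w) ^ N = (w * (- s + c * z) + (c + s * z)) ^ N"
    by (simp add: algebra_simps)
  also have "\<dots> = (\<Sum>l\<le>N. real (N choose l) * poly ([:c, s:] ^ (N - l) * [:- s, c:] ^ l) z * w ^ l)"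
    by (subst binomial_ring) (simp add: poly_power power_mult_distrib mult_ac)
  also have "\<dots> = (\<Sum>l\<le>N. \<Sum>m\<le>N. (real (N choose l) * rot_coeff N m l c s) * z ^ m * w ^ l)"
    by (intro sum.cong refl, subst poly_eq_sum_le[OF degree_rot_poly])
      (auto simp: rot_coeff_def sum_distrib_left sum_distrib_right mult_ac)
  finally show ?thesis ..
qed

lemma rot_coeff_swap:
  fixes c s :: real
  assumes "m \<le> N" "l \<le> N"
  shows "real (N choose l) * rot_coeff N m l c s = real (N choose m) * rot_coeff N l m c (- s)"
proof (rule bivariate_coeffs_unique[where N = N and a = "\<lambda>m l. real (N choose l) * rot_coeff N m l c s"
      and b = "\<lambda>m l. real (N choose m) * rot_coeff N l m c (- s)", OF _ assms])
  fix z w :: real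
  have "(\<Sum>l\<le>N. \<Sum>m\<le>N. (real (N choose m) * rot_coeff N l m c (- s)) * z ^ m * w ^ l)
    = (\<Sum>m\<le>N. \<Sum>l\<le>N. (real (N choose m) * rot_coeff N l m c (- s)) * w ^ l * z ^ m)"
    by (subst sum.swap) (simp add: mult_ac)
  also have "\<dots> = (c + (- s) * w - (- s) * z + c * w * z) ^ N"
    by (rule rot_coeff_generating)
  also have "\<dots> = (c + s * z - s * w + c * z * w) ^ N"
    by (simp add: algebra_simps)
  finally show "(\<Sum>l\<le>N. \<Sum>m\<le>N. real (N choose l) * rot_coeff N m l c s * z ^ m * w ^ l) =
    (\<Sum>l\<le>N. \<Sum>m\<le>N. real (N choose m) * rot_coeff N l m c (- s) * z ^ m * w ^ l)"
    by (simp add: rot_coeff_generating)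
qed

text \<open>Reversing the coefficients turns c + s z into s + c z and -s + c z into c - s z, which
  are again the two factors, exchanged and with -s for s. Since c and s are nonzero the degree is
  exactly N, so reversal sends index m to N - m.\<close>

lemma rot_coeff_reflect:
  fixes c s :: real
  assumes "m \<le> N" "l \<le> N" "c \<noteq> 0" "s \<noteq> 0"
  shows "rot_coeff N (N - m) (N - l) c s = rot_coeff N m l c (- s)"
proof -
  define p where "p = [:c, s:] ^ l * [:- s, c:] ^ (N - l)"
  have deg: "degree p = N"
    using assms by (simp add: p_def degree_mult_eq degree_power_eq)
  have "reflect_poly p = [:s, c:] ^ l * [:c, - s:] ^ (N - l)"
    using assms by (simp add: p_def reflect_poly_mult reflect_poly_power reflect_poly_pCons)
  then have "rot_coeff N m l c (- s) = coeff (reflect_poly p) m"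
    by (simp add: rot_coeff_def mult_ac)
  also have "\<dots> = coeff p (N - m)"
    using assms deg by (simp add: coeff_reflect_poly)
  also have "\<dots> = rot_coeff N (N - m) (N - l) c s"
    using assms by (simp add: rot_coeff_def p_def)
  finally show ?thesis ..
qed

lemma minus_poly_power: "(- p) ^ n = smult ((-1) ^ n) (p ^ n)" for p :: "'a::comm_ring_1 poly"
  by (metis smult_power smult_minus_left smult_1_left)

lemma rot_coeff_minus:
  fixes c s :: real
  shows "rot_coeff N m l c (- s) = (-1) ^ (m + l) * rot_coeff N m l c s"
proof -
  have "pcompose ([:c, s:] ^ (N - l) * [:- s, c:] ^ l) [:0, -1:] = [:c, - s:] ^ (N - l) * (- [:s, c:]) ^ l"
    by (simp add: pcompose_mult pcompose_power pcompose_pCons)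
  also have "\<dots> = smult ((-1) ^ l) ([:c, - s:] ^ (N - l) * [:s, c:] ^ l)"
    by (simp only: minus_poly_power mult_smult_right)
  finally have "(-1) ^ m * rot_coeff N m l c s = (-1) ^ l * rot_coeff N m l c (- s)"
    unfolding rot_coeff_def by (metis coeff_pcompose_scale coeff_smult minus_minus)
  then have "(-1) ^ l * ((-1) ^ m * rot_coeff N m l c s) = ((-1) ^ l * (-1) ^ l) * rot_coeff N m l c (- s)"
    by simp
  then show ?thesis
    by (simp add: power_add mult_ac flip: power_mult_distrib)
qed

text \<open>The normalisation absorbs the binomial coefficients: the matrix of the opposite angle is
  the plain transpose.\<close>

lemma wnorm_rot_coeff_swap:
  assumes "m \<le> N" "l \<le> N"
  shows "wnorm N m l * rot_coeff N m l c s = wnorm N l m * rot_coeff N l m c (- s)"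
proof -
  have "rot_coeff N m l c s * (fact m * fact (N - m)) = rot_coeff N l m c (- s) * (fact l * fact (N - l))"
    using rot_coeff_swap[OF assms, of c s] assms by (simp add: binomial_fact field_simps)
  moreover have "sqrt (A / B) * x = sqrt (B / A) * y" if "x * A = y * B" "A > 0" "B > 0" for A B x y :: real
  proof -
    define a b where "a = sqrt A" and "b = sqrt B"
    have "A = a * a" "B = b * b" "a > 0" "b > 0" using that by (auto simp: a_def b_def)
    with that show ?thesis by (simp add: real_sqrt_divide field_simps)
  qed
  ultimately show ?thesis
    unfolding wnorm_def by simp
qed

lemma nat_index_of_int:
  assumes "\<bar>k\<bar> \<le> int n"
  obtains m where "m \<le> 2 * n" "k = int n - int m" "- k = int n - int (2 * n - m)"
  using assms by (intro that[of "nat (int n - k)"]) auto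

text \<open>Reversal and transposition both change the sign of the sine, so their composition keeps
  the angle.\<close>

lemma wigner_d_reflect:
  assumes b: "0 < b" "b < pi" and kj: "\<bar>k\<bar> \<le> int n" "\<bar>j\<bar> \<le> int n"
  shows "wigner_d n k j (cos b) = wigner_d n (- j) (- k) (cos b)"
proof -
  obtain m where m: "m \<le> 2 * n" "k = int n - int m" "- k = int n - int (2 * n - m)"
    using kj by (elim nat_index_of_int)
  obtain l where l: "l \<le> 2 * n" "j = int n - int l" "- j = int n - int (2 * n - l)"
    using kj by (elim nat_index_of_int)
  have "cos (b / 2) > 0" "sin (b / 2) > 0"
    using b by (auto intro!: cos_gt_zero sin_gt_zero)
  then have "rot_coeff (2 * n) (2 * n - l) (2 * n - m) (cos (b / 2)) (sin (b / 2))
    = rot_coeff (2 * n) l m (cos (b / 2)) (- sin (b / 2))"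
    using m(1) l(1) by (intro rot_coeff_reflect) auto
  moreover have "wnorm (2 * n) (2 * n - l) (2 * n - m) = wnorm (2 * n) l m"
    using m(1) l(1) by (simp add: wnorm_def mult_ac)
  moreover have "wigner_d n (- j) (- k) (cos b) = wnorm (2 * n) (2 * n - l) (2 * n - m)
      * rot_coeff (2 * n) (2 * n - l) (2 * n - m) (cos (b / 2)) (sin (b / 2))"
    unfolding l(3) m(3) by (rule wigner_d_eq_rot_coeff[OF b]) auto
  moreover have "wigner_d n k j (cos b) = wnorm (2 * n) m l * rot_coeff (2 * n) m l (cos (b / 2)) (sin (b / 2))"
    unfolding l(2) m(2) by (rule wigner_d_eq_rot_coeff[OF b m(1) l(1)])
  ultimately show ?thesis
    using wnorm_rot_coeff_swap[OF m(1) l(1)] by simp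
qed

text \<open>Transposition gives the opposite angle; the substitution z -> -z restores it at the cost
  of (-1)^(m + l), which has the parity of k - j.\<close>

lemma wigner_d_swap:
  assumes b: "0 < b" "b < pi" and kj: "\<bar>k\<bar> \<le> int n" "\<bar>j\<bar> \<le> int n"
  shows "wigner_d n k j (cos b) = (-1) ^ nat \<bar>k - j\<bar> * wigner_d n j k (cos b)"
proof -
  obtain m where m: "m \<le> 2 * n" "k = int n - int m" "- k = int n - int (2 * n - m)"
    using kj by (elim nat_index_of_int)
  obtain l where l: "l \<le> 2 * n" "j = int n - int l" "- j = int n - int (2 * n - l)"
    using kj by (elim nat_index_of_int)
  have "even (nat \<bar>k - j\<bar> + (m + l))"
    unfolding m(2) l(2) by (auto simp: even_nat_iff)
  then have "(-1::real) ^ nat \<bar>k - j\<bar> * (-1) ^ (m + l) = 1"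
    by (simp flip: power_add)
  then have "(-1::real) ^ (m + l) = (-1) ^ nat \<bar>k - j\<bar>"
    by (metis minus_one_power_iff mult_1 mult_minus_left)
  moreover have "wigner_d n j k (cos b) = wnorm (2 * n) l m * rot_coeff (2 * n) l m (cos (b / 2)) (sin (b / 2))"
    unfolding l(2) m(2) by (rule wigner_d_eq_rot_coeff[OF b l(1) m(1)])
  moreover have "wigner_d n k j (cos b) = wnorm (2 * n) m l * rot_coeff (2 * n) m l (cos (b / 2)) (sin (b / 2))"
    unfolding l(2) m(2) by (rule wigner_d_eq_rot_coeff[OF b m(1) l(1)])
  ultimately show ?thesis
    using wnorm_rot_coeff_swap[OF m(1) l(1)] by (simp add: rot_coeff_minus add.commute)
qed

section \<open>Associated Legendre functions as trinomial coefficients\<close>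

lemma legendre_poly_eq: "(\<lambda>x::real. (x\<^sup>2 - 1) ^ n) = poly ([:-1, 0, 1:] ^ n)"
  by (auto simp: fun_eq_iff poly_power power2_eq_square)

text \<open>For x = t + s z with s^2 = 1 - t^2, the polynomial x^2 - 1 equals 2 s (-s/2 + t z +
  (s/2) z^2). Taylor's formula for (x^2 - 1)^n then gives the claim after division by s^n.\<close>

lemma coeff_trinomial_upper:
  fixes s t :: real
  assumes st: "s\<^sup>2 = 1 - t\<^sup>2"
  shows "coeff ([:- s / 2, t, s / 2:] ^ n) (n + k)
    = s ^ k / (2 ^ n * fact (n + k)) * poly ((pderiv ^^ (n + k)) ([:-1, 0, 1:] ^ n)) t"
proof (cases "s = 0")
  case False
  have "pcompose [:-1, 0, 1:] [:t, s:] = smult (2 * s) [:- s / 2, t, s / 2:]"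
    using st by (simp add: pcompose_pCons power2_eq_square algebra_simps)
  then have "fact (n + k) * ((2 * s) ^ n * coeff ([:- s / 2, t, s / 2:] ^ n) (n + k))
     = s ^ (n + k) * poly ((pderiv ^^ (n + k)) ([:-1, 0, 1:] ^ n)) t"
    using coeff_pcompose_linear[of "n + k" "[:-1, 0, 1:] ^ n" t s]
    by (simp only: pcompose_power smult_power coeff_smult)
  then have "s ^ n * (fact (n + k) * 2 ^ n * coeff ([:- s / 2, t, s / 2:] ^ n) (n + k))
     = s ^ n * (s ^ k * poly ((pderiv ^^ (n + k)) ([:-1, 0, 1:] ^ n)) t)"
    by (simp only: power_mult_distrib power_add mult_ac)
  then have "fact (n + k) * 2 ^ n * coeff ([:- s / 2, t, s / 2:] ^ n) (n + k)
     = s ^ k * poly ((pderiv ^^ (n + k)) ([:-1, 0, 1:] ^ n)) t"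
    using False by (metis mult_left_cancel power_eq_0_iff)
  moreover have "(fact (n + k) * 2 ^ n :: real) \<noteq> 0" by simp
  ultimately show ?thesis
    by (simp add: nonzero_eq_divide_eq mult_ac)
next
  \<comment> \<open>Division by s fails at the poles. For k = 0 the factorisation x^2 - 1 = z (2 t +
    z) at x = t + z gives the derivative directly; for k > 0 both sides vanish.\<close>
  case True
  have sq: "t\<^sup>2 = 1" using st True by simp
  have c: "coeff ([:0, t:] ^ n) (n + k) = (if k = 0 then t ^ n else 0)"
  proof -
    have "[:0, t:] = monom t 1" by (simp add: monom_altdef)
    then show ?thesis by (simp add: monom_power)
  qed
  show ?thesis
  proof (cases "k = 0")
    case k: True
    have "pcompose [:-1, 0, 1:] [:t, 1:] = [:0, 1:] * [:2 * t, 1:]"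
      using sq by (simp add: pcompose_pCons power2_eq_square)
    then have "pcompose ([:-1, 0, 1:] ^ n) [:t, 1:] = [:0, 1:] ^ n * [:2 * t, 1:] ^ n"
      by (simp only: pcompose_power power_mult_distrib)
    also have "[:0, 1:] ^ n = (monom 1 n :: real poly)"
      by (simp add: monom_altdef)
    finally have "fact n * coeff (monom 1 n * [:2 * t, 1:] ^ n) n = poly ((pderiv ^^ n) ([:-1, 0, 1:] ^ n)) t"
      using coeff_pcompose_linear[of n "[:-1, 0, 1:] ^ n" t 1] by simp
    then have "poly ((pderiv ^^ n) ([:-1, 0, 1:] ^ n)) t = fact n * (2 * t) ^ n"
      by (simp add: coeff_monom_mult coeff_linear_poly_power)
    then show ?thesis using True k c by (simp add: power_mult_distrib)
  qed (use True c in simp)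
qed

text \<open>The outer coefficients are opposite, so reversing the trinomial amounts to z -> -z and a
  change of sign. This is the origin of the sign convention for negative orders.\<close>

lemma coeff_trinomial_lower:
  fixes s t :: real
  assumes "k \<le> n" and st: "s\<^sup>2 = 1 - t\<^sup>2"
  shows "coeff ([:- s / 2, t, s / 2:] ^ n) (n - k) = (-1) ^ k * coeff ([:- s / 2, t, s / 2:] ^ n) (n + k)"
proof (cases "s = 0")
  case False
  define A where "A = [:- s / 2, t, s / 2:]"
  have "reflect_poly A = - pcompose A [:0, -1:]"
    using False by (simp add: A_def reflect_poly_pCons pcompose_pCons)
  then have "coeff (reflect_poly (A ^ n)) (n + k) = coeff ((- pcompose A [:0, -1:]) ^ n) (n + k)"
    by (simp add: reflect_poly_power)
  also have "\<dots> = coeff (smult ((-1) ^ n) (pcompose (A ^ n) [:0, -1:])) (n + k)"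
    by (simp only: minus_poly_power pcompose_power)
  also have "\<dots> = (-1) ^ n * (-1) ^ (n + k) * coeff (A ^ n) (n + k)"
    by (simp only: coeff_smult coeff_pcompose_scale mult.assoc)
  also have "(-1::real) ^ n * (-1) ^ (n + k) = (-1) ^ k"
    by (simp add: power_add flip: power_mult_distrib)
  also have "coeff (reflect_poly (A ^ n)) (n + k) = coeff (A ^ n) (n - k)"
    using False assms by (simp add: coeff_reflect_poly degree_power_eq A_def)
  finally show ?thesis by (simp add: A_def)
next
  case True
  have "[:0, t:] = monom t 1" by (simp add: monom_altdef)
  then show ?thesis using True assms(1) by (auto simp add: monom_power)
qed

text \<open>One coefficient covers both signs of the order. For m <= n the lower coefficient carries
  the phase of \<open>assoc_legendre\<close>; for m > n the phases of \<open>norm_legendre\<close>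
  and \<open>assoc_legendre\<close> cancel and the upper coefficient appears.\<close>

lemma norm_legendre_eq_coeff:
  assumes m: "m \<le> 2 * n" and t: "\<bar>t\<bar> \<le> 1"
  shows "norm_legendre n (int n - int m) t = sqrt ((2 * real n + 1) / (4 * pi)) * wnorm (2 * n) m n
    * coeff ([:- sqrt (1 - t\<^sup>2) / 2, t, sqrt (1 - t\<^sup>2) / 2:] ^ n) m"
proof -
  define s where "s = sqrt (1 - t\<^sup>2)"
  have st: "s\<^sup>2 = 1 - t\<^sup>2" using t by (simp add: s_def abs_square_le_1)
  define k where "k = nat \<bar>int n - int m\<bar>"
  have k: "k \<le> n" using m by (auto simp: k_def)
  define P where "P = poly ((pderiv ^^ (n + k)) ([:-1, 0, 1:] ^ n)) t"
  have al: "assoc_legendre n k t = (-1) ^ k / (2 ^ n * fact n) * s ^ k * P"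
    by (simp add: assoc_legendre_def legendre_poly_eq deriv_poly_funpow P_def s_def)
  have up: "coeff ([:- s / 2, t, s / 2:] ^ n) (n + k) = s ^ k / (2 ^ n * fact (n + k)) * P"
    unfolding P_def by (rule coeff_trinomial_upper[OF st])
  have lo: "coeff ([:- s / 2, t, s / 2:] ^ n) (n - k) = (-1) ^ k * (s ^ k / (2 ^ n * fact (n + k)) * P)"
    unfolding up[symmetric] by (rule coeff_trinomial_lower[OF k st])
  have w: "wnorm (2 * n) m n = sqrt (fact (n + k) * fact (n - k)) / fact n"
  proof (cases "m \<le> n")
    case True
    then have "m = n - k" "2 * n - m = n + k" by (auto simp: k_def)
    then show ?thesis by (simp add: wnorm_def real_sqrt_divide mult_ac)
  next
    case False
    then have "m = n + k" "2 * n - m = n - k" using m by (auto simp: k_def)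
    then show ?thesis by (simp add: wnorm_def real_sqrt_divide mult_ac)
  qed
  have sq: "sqrt ((2 * real n + 1) / (4 * pi) * fact (n - k) / fact (n + k))
    = sqrt ((2 * real n + 1) / (4 * pi)) * (sqrt (fact (n + k) * fact (n - k)) / fact (n + k))"
    by (rule real_sqrt_unique) (simp_all add: power_divide power_mult_distrib, simp add: power2_eq_square)
  show ?thesis
  proof (cases "m \<le> n")
    case True
    then have "coeff ([:- s / 2, t, s / 2:] ^ n) m = (-1) ^ k * (s ^ k / (2 ^ n * fact (n + k)) * P)"
      using lo by (metis True diff_diff_cancel k_def nat_int of_nat_diff abs_of_nat)
    then show ?thesis
      using True unfolding norm_legendre_def Let_def k_def[symmetric] sq al w s_def[symmetric]
      by (simp add: mult_ac)
  next
    case False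
    then have "m = n + k" by (auto simp: k_def)
    then have "coeff ([:- s / 2, t, s / 2:] ^ n) m = (s ^ k / (2 ^ n * fact (n + k)) * P)"
      using up by simp
    moreover have "(-1::real) ^ k * ((-1) ^ k * x) = x" for x by (simp flip: mult.assoc power_mult_distrib)
    ultimately show ?thesis
      using False unfolding norm_legendre_def Let_def k_def[symmetric] sq al w s_def[symmetric]
      by (simp add: mult_ac)
  qed
qed

text \<open>At half-angles the trinomial factors as (C + S z) (C z - S), so its n-th power is the
  polynomial with l = n, that is j = 0.\<close>

lemma norm_legendre_eq_wigner_d:
  assumes b: "0 < b" "b < pi" and k: "\<bar>k\<bar> \<le> int n"
  shows "norm_legendre n k (cos b) = sqrt ((2 * real n + 1) / (4 * pi)) * wigner_d n k 0 (cos b)"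
proof -
  obtain m where m: "m \<le> 2 * n" "k = int n - int m"
    using k by (elim nat_index_of_int)
  have s: "sqrt (1 - (cos b)\<^sup>2) = sin b"
    using b by (intro real_sqrt_unique) (auto simp: sin_squared_eq intro!: less_imp_le sin_gt_zero)
  have d: "sin b = 2 * sin (b / 2) * cos (b / 2)" "cos b = (cos (b / 2))\<^sup>2 - (sin (b / 2))\<^sup>2"
    using sin_double[of "b / 2"] cos_double[of "b / 2"] by auto
  have "[:- sin b / 2, cos b, sin b / 2:] = [:cos (b / 2), sin (b / 2):] * [:- sin (b / 2), cos (b / 2):]"
    by (simp add: d power2_eq_square algebra_simps)
  then have "coeff ([:- sin b / 2, cos b, sin b / 2:] ^ n) m = rot_coeff (2 * n) m n (cos (b / 2)) (sin (b / 2))"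
    by (simp only: power_mult_distrib rot_coeff_def) (simp add: mult_2)
  then show ?thesis
    using norm_legendre_eq_coeff[OF m(1), of "cos b"] wigner_d_eq_rot_coeff[OF b m(1), of n]
    by (simp add: m(2) s)
qed

section \<open>Rotation of spherical harmonics\<close>

declare transpose_matrix_vector [simp del]

lemma norm_vec3: "(norm (x :: real^3))\<^sup>2 = (x$1)\<^sup>2 + (x$2)\<^sup>2 + (x$3)\<^sup>2"
  unfolding power2_norm_eq_inner inner_vec_def sum_3 by (simp add: power2_eq_square)

text \<open>The polynomial in z given by the product of x with the isotropic vector q(z).\<close>
definition sph_poly :: "real^3 \<Rightarrow> complex poly" where
  "sph_poly x = [:- Complex (x$1) (x$2) / 2, of_real (x$3), cnj (Complex (x$1) (x$2)) / 2:]"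

text \<open>The substitution z -> z / u followed by multiplication with u. For u on the unit circle
  this is the effect on \<open>sph_poly\<close> of a rotation about the third axis, and it yields
  the phase of order n - m.\<close>

lemma coeff_trinomial_twist:
  fixes u :: complex
  assumes "u \<noteq> 0"
  shows "coeff ([:u * a, b, c / u:] ^ n) m = u ^ n / u ^ m * coeff ([:a, b, c:] ^ n) m"
proof -
  have "[:u * a, b, c / u:] = smult u (pcompose [:a, b, c:] [:0, 1 / u:])"
    using assms by (simp add: pcompose_pCons)
  then show ?thesis
    by (simp add: smult_power coeff_pcompose_scale power_divide flip: pcompose_power)
qed

lemma cis_power_diff: "cis a ^ n / cis a ^ m = cis (of_int (int n - int m) * a)"
  by (simp only: Complex.DeMoivre cis_divide) (simp add: algebra_simps)

text \<open>Pulling out the phase u of x_1 + i x_2 leaves the real Legendre trinomial. No separate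
  case is needed at the poles, where s = 0 and x_1 + i x_2 = s u still holds.\<close>

lemma Ylm_eq_coeff:
  assumes x: "norm x = 1" and m: "m \<le> 2 * n"
  shows "Ylm n (int n - int m) x =
    of_real (sqrt ((2 * real n + 1) / (4 * pi)) * wnorm (2 * n) m n) * coeff (sph_poly x ^ n) m"
proof -
  define t z where "t = x$3" and "z = Complex (x$1) (x$2)"
  define s u where "s = sqrt (1 - t\<^sup>2)" and "u = cis (Arg z)"
  have t: "\<bar>t\<bar> \<le> 1"
    using component_le_norm_cart[of x 3] x by (simp add: t_def)
  have "cmod z = s"
    using norm_vec3[of x] x by (simp add: z_def s_def t_def cmod_def)
  then have z: "z = of_real s * u"
    using rcis_cmod_Arg[of z] by (simp add: rcis_def u_def)
  have u: "u \<noteq> 0" "cnj u = 1 / u"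
    by (simp_all add: u_def cis_cnj cis_inverse divide_inverse)
  have "sph_poly x = [:- z / 2, of_real t, cnj z / 2:]"
    by (simp add: sph_poly_def z_def t_def)
  also have "\<dots> = [:u * of_real (- s / 2), of_real t, of_real (s / 2) / u:]"
    using u by (simp add: z)
  finally have "coeff (sph_poly x ^ n) m
      = u ^ n / u ^ m * coeff ([:of_real (- s / 2), of_real t, of_real (s / 2):] ^ n) m"
    by (simp only: coeff_trinomial_twist[OF u(1)])
  also have "[:of_real (- s / 2), of_real t, of_real (s / 2):] = map_poly complex_of_real [:- s / 2, t, s / 2:]"
    by (simp add: map_poly_pCons)
  also have "coeff (\<dots> ^ n) m = of_real (coeff ([:- s / 2, t, s / 2:] ^ n) m)"
    by (simp only: coeff_map_poly of_real_0 flip: map_poly_of_real_power)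
  also have "u ^ n / u ^ m = cis (of_int (int n - int m) * Arg z)"
    unfolding u_def by (rule cis_power_diff)
  finally have c: "coeff (sph_poly x ^ n) m
     = cis (of_int (int n - int m) * Arg z) * of_real (coeff ([:- s / 2, t, s / 2:] ^ n) m)" .
  show ?thesis
    unfolding Ylm_def z_def[symmetric] t_def[symmetric] norm_legendre_eq_coeff[OF m t] s_def[symmetric] c
    by (simp only: of_real_mult mult_ac)
qed

lemma transpose_R3_mult:
  "(transpose (R3 g) *v x)$1 = cos g * x$1 + sin g * x$2"
  "(transpose (R3 g) *v x)$2 = cos g * x$2 - sin g * x$1"
  "(transpose (R3 g) *v x)$3 = x$3"
  by (simp_all add: R3_def matrix_vector_mult_def transpose_def sum_3)

lemma transpose_R2_mult:
  "(transpose (R2 b) *v x)$1 = cos b * x$1 - sin b * x$3"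
  "(transpose (R2 b) *v x)$2 = x$2"
  "(transpose (R2 b) *v x)$3 = sin b * x$1 + cos b * x$3"
  by (simp_all add: R2_def matrix_vector_mult_def transpose_def sum_3)

lemma norm_transpose_R3 [simp]: "norm (transpose (R3 g) *v x) = norm x"
proof -
  have "(norm (transpose (R3 g) *v x))\<^sup>2 = ((sin g)\<^sup>2 + (cos g)\<^sup>2) * ((x$1)\<^sup>2 + (x$2)\<^sup>2) + (x$3)\<^sup>2"
    unfolding norm_vec3 transpose_R3_mult by algebra
  then have "(norm (transpose (R3 g) *v x))\<^sup>2 = (norm x)\<^sup>2"
    by (simp add: norm_vec3)
  then show ?thesis by simp
qed

lemma norm_transpose_R2 [simp]: "norm (transpose (R2 b) *v x) = norm x"
proof -
  have "(norm (transpose (R2 b) *v x))\<^sup>2 = ((sin b)\<^sup>2 + (cos b)\<^sup>2) * ((x$1)\<^sup>2 + (x$3)\<^sup>2) + (x$2)\<^sup>2"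
    unfolding norm_vec3 transpose_R2_mult by algebra
  then have "(norm (transpose (R2 b) *v x))\<^sup>2 = (norm x)\<^sup>2"
    by (simp add: norm_vec3)
  then show ?thesis by simp
qed

text \<open>The inverse rotation multiplies x_1 + i x_2 by \<open>cis (- g)\<close>. Arguing with
  coefficients avoids the jump of \<open>Arg\<close>.\<close>

lemma Ylm_R3:
  assumes x: "norm x = 1" and k: "\<bar>k\<bar> \<le> int n"
  shows "Ylm n k (transpose (R3 g) *v x) = cis (- of_int k * g) * Ylm n k x"
proof -
  obtain m where m: "m \<le> 2 * n" "k = int n - int m"
    using k by (elim nat_index_of_int)
  have "Complex ((transpose (R3 g) *v x)$1) ((transpose (R3 g) *v x)$2) = cis (- g) * Complex (x$1) (x$2)"
    by (simp add: transpose_R3_mult complex_eq_iff)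
  moreover have "cnj (cis (- g) * z) / 2 = (cnj z / 2) / cis (- g)" for z
  proof -
    have "cnj (cis (- g)) = 1 / cis (- g)"
      by (simp add: cis_cnj cis_inverse divide_inverse)
    then show ?thesis by simp
  qed
  ultimately have "sph_poly (transpose (R3 g) *v x) =
      [:cis (- g) * (- Complex (x$1) (x$2) / 2), of_real (x$3), (cnj (Complex (x$1) (x$2)) / 2) / cis (- g):]"
    by (simp only: sph_poly_def transpose_R3_mult(3)) simp
  then have "coeff (sph_poly (transpose (R3 g) *v x) ^ n) m
     = cis (- g) ^ n / cis (- g) ^ m * coeff (sph_poly x ^ n) m"
    by (simp only: coeff_trinomial_twist[OF cis_neq_zero] sph_poly_def)
  also have "cis (- g) ^ n / cis (- g) ^ m = cis (- of_int k * g)"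
    by (simp only: cis_power_diff m(2)) (simp add: algebra_simps)
  finally show ?thesis
    using x m(1) by (simp add: m(2) Ylm_eq_coeff)
qed

section \<open>Moebius substitution and rotation about the second axis\<close>

text \<open>This is P^N p(Q / P), written without division.\<close>

definition homogenize :: "nat \<Rightarrow> 'a poly \<Rightarrow> 'a::comm_ring_1 poly \<Rightarrow> 'a poly \<Rightarrow> 'a poly" where
  "homogenize N p P Q = (\<Sum>l\<le>N. smult (coeff p l) (P ^ (N - l) * Q ^ l))"

lemma homogenize_add: "homogenize N (p + q) P Q = homogenize N p P Q + homogenize N q P Q"
  by (simp add: homogenize_def smult_add_left sum.distrib)

lemma homogenize_smult: "homogenize N (smult c p) P Q = smult c (homogenize N p P Q)"
proof -
  have "smult c (\<Sum>l\<in>A. f l) = (\<Sum>l\<in>A. smult c (f l))" for A and f :: "nat \<Rightarrow> 'a poly"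
    by (induction A rule: infinite_finite_induct) (auto simp: smult_add_right)
  then show ?thesis by (simp add: homogenize_def)
qed

lemma homogenize_pCons: "homogenize (Suc N) (pCons 0 p) P Q = Q * homogenize N p P Q"
  unfolding homogenize_def by (subst sum.atMost_Suc_shift) (simp add: sum_distrib_left mult_ac)

lemma homogenize_Suc: "degree p \<le> N \<Longrightarrow> homogenize (Suc N) p P Q = P * homogenize N p P Q"
  by (simp add: homogenize_def coeff_eq_0 Suc_diff_le sum_distrib_left mult_ac)

text \<open>P^N p(Q / P) is multiplicative when the formal degrees add up. Each factor of the
  trinomial raises the formal degree by two, so induction on n replaces a convolution of
  coefficients.\<close>

lemma homogenize_trinomial_power:
  "homogenize (2 * n) ([:a, b, c:] ^ n) P Q = (smult a (P\<^sup>2) + smult b (P * Q) + smult c (Q\<^sup>2)) ^ n"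
proof (induction n)
  case 0
  show ?case by (simp add: homogenize_def)
next
  case (Suc n)
  define p where "p = [:a, b, c:] ^ n"
  have "degree p \<le> degree [:a, b, c:] * n"
    unfolding p_def by (rule degree_power_le)
  also have "\<dots> \<le> 2 * n"
    by (intro mult_right_mono) auto
  finally have d: "degree p \<le> 2 * n" .
  have "[:a, b, c:] * p = smult a p + pCons 0 (smult b p + pCons 0 (smult c p))"
    by simp
  then have "homogenize (Suc (Suc (2 * n))) ([:a, b, c:] * p) P Q
    = smult a (P * (P * homogenize (2 * n) p P Q)) + Q * smult b (P * homogenize (2 * n) p P Q)
      + Q * (Q * smult c (homogenize (2 * n) p P Q))"
    using d by (simp only: homogenize_add homogenize_pCons homogenize_smult homogenize_Suc le_SucI algebra_simps)
  also have "\<dots> = (smult a (P\<^sup>2) + smult b (P * Q) + smult c (Q\<^sup>2)) * homogenize (2 * n) p P Q"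
    by (simp add: algebra_simps power2_eq_square)
  finally show ?case
    using Suc by (simp add: p_def)
qed

text \<open>The Moebius map is z -> (S + C z) / (C - S z); the right-hand side is its substitution
  into the quadratic \<open>sph_poly x\<close>, cleared of the denominator (C - S z)^2.\<close>

lemma sph_poly_R2:
  "sph_poly (transpose (R2 b) *v x) = smult (coeff (sph_poly x) 0) ([:of_real (cos (b/2)), - of_real (sin (b/2)):]\<^sup>2)
     + smult (coeff (sph_poly x) 1) ([:of_real (cos (b/2)), - of_real (sin (b/2)):] * [:of_real (sin (b/2)), of_real (cos (b/2)):])
     + smult (coeff (sph_poly x) 2) ([:of_real (sin (b/2)), of_real (cos (b/2)):]\<^sup>2)"
proof -
  define C S where "C = cos (b / 2)" and "S = sin (b / 2)"
  have d: "sin b = 2 * S * C" "cos b = C\<^sup>2 - S\<^sup>2"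
    using sin_double[of "b / 2"] cos_double[of "b / 2"] by (auto simp: C_def S_def)
  have "C\<^sup>2 + S\<^sup>2 = 1" by (simp add: C_def S_def)
  \<comment> \<open>The factor C^2 + S^2 makes the fixed coordinate quadratic in C and S like the
    other entries, so that both sides can be compared term by term.\<close>
  then have x2: "x$2 = (C\<^sup>2 + S\<^sup>2) * x$2" by simp
  have z: "Complex a b = of_real a + \<i> * of_real b" for a b
    by (simp add: complex_eq_iff)
  have e: "sph_poly (transpose (R2 b) *v x) =
     [:- Complex (cos b * x$1 - sin b * x$3) ((C\<^sup>2 + S\<^sup>2) * x$2) / 2, of_real (sin b * x$1 + cos b * x$3),
       cnj (Complex (cos b * x$1 - sin b * x$3) ((C\<^sup>2 + S\<^sup>2) * x$2)) / 2:]"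
    unfolding sph_poly_def transpose_R2_mult x2[symmetric] ..
  show ?thesis
    unfolding e C_def[symmetric] S_def[symmetric]
    by (simp add: sph_poly_def d z power2_eq_square numeral_2_eq_2 field_simps)
qed

lemma sum_int_symmetric: "(\<Sum>j\<in>{- int n..int n}. f j) = (\<Sum>l\<le>2 * n. f (int n - int l))"
  by (rule sum.reindex_bij_witness[where i = "\<lambda>l. int n - int l" and j = "\<lambda>j. nat (int n - j)"]) auto

text \<open>Homogenisation expands the rotated polynomial in the columns for the sine -S.
  Transposition restores S and exchanges the indices, which is why the summation index comes first
  in \<open>wigner_d n j k\<close>.\<close>

lemma Ylm_R2:
  assumes x: "norm x = 1" and k: "\<bar>k\<bar> \<le> int n" and b: "0 < b" "b < pi"
  shows "Ylm n k (transpose (R2 b) *v x) = (\<Sum>j\<in>{- int n..int n}. of_real (wigner_d n j k (cos b)) * Ylm n j x)"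
proof -
  obtain m where m: "m \<le> 2 * n" "k = int n - int m"
    using k by (elim nat_index_of_int)
  define \<kappa> where "\<kappa> = sqrt ((2 * real n + 1) / (4 * pi))"
  define C S where "C = cos (b / 2)" and "S = sin (b / 2)"
  have "sph_poly (transpose (R2 b) *v x) ^ n = homogenize (2 * n)
     ([:coeff (sph_poly x) 0, coeff (sph_poly x) 1, coeff (sph_poly x) 2:] ^ n)
     [:of_real C, - of_real S:] [:of_real S, of_real C:]"
    by (simp only: sph_poly_R2 homogenize_trinomial_power C_def S_def)
  also have "[:coeff (sph_poly x) 0, coeff (sph_poly x) 1, coeff (sph_poly x) 2:] = sph_poly x"
    by (simp add: sph_poly_def numeral_2_eq_2)
  finally have "coeff (sph_poly (transpose (R2 b) *v x) ^ n) m =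
     (\<Sum>l\<le>2 * n. coeff (sph_poly x ^ n) l * rot_coeff (2 * n) m l (of_real C) (of_real (- S)))"
    by (simp add: homogenize_def coeff_sum rot_coeff_def)
  then have "Ylm n k (transpose (R2 b) *v x) = (\<Sum>l\<le>2 * n. of_real (\<kappa> * wnorm (2 * n) m n)
      * (coeff (sph_poly x ^ n) l * of_real (rot_coeff (2 * n) m l C (- S))))"
    using x m(1) by (simp only: m(2) Ylm_eq_coeff norm_transpose_R2 \<kappa>_def rot_coeff_of_real sum_distrib_left)
  also have "\<dots> = (\<Sum>l\<le>2 * n. of_real (wigner_d n (int n - int l) k (cos b)) * Ylm n (int n - int l) x)"
  proof (rule sum.cong[OF refl])
    fix l assume "l \<in> {..2 * n}"
    then have l: "l \<le> 2 * n" by simp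
    \<comment> \<open>As a quotient of roots of binomial coefficients, \<open>wnorm\<close>
      telescopes along a chain of indices; this converts the constant of Y_n^k into that of the
      harmonic with index l.\<close>
    have "wnorm (2 * n) m n = wnorm (2 * n) l n * wnorm (2 * n) m l"
      by (simp add: wnorm_def flip: real_sqrt_mult)
    then have "wnorm (2 * n) m n * rot_coeff (2 * n) m l C (- S)
      = wnorm (2 * n) l n * (wnorm (2 * n) m l * rot_coeff (2 * n) m l C (- S))" by simp
    also have "\<dots> = wnorm (2 * n) l n * wigner_d n (int n - int l) k (cos b)"
      using wnorm_rot_coeff_swap[OF m(1) l, of C "- S"] wigner_d_eq_rot_coeff[OF b l m(1)]
      by (simp add: m(2) C_def S_def)
    finally have w: "wnorm (2 * n) m n * rot_coeff (2 * n) m l C (- S)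
      = wnorm (2 * n) l n * wigner_d n (int n - int l) k (cos b)" .
    have "of_real (\<kappa> * wnorm (2 * n) m n) * (coeff (sph_poly x ^ n) l * of_real (rot_coeff (2 * n) m l C (- S)))
       = of_real (\<kappa> * (wnorm (2 * n) m n * rot_coeff (2 * n) m l C (- S))) * coeff (sph_poly x ^ n) l"
      by simp
    also have "\<dots> = of_real (wigner_d n (int n - int l) k (cos b)) * Ylm n (int n - int l) x"
      unfolding w Ylm_eq_coeff[OF x l] \<kappa>_def by simp
    finally show "of_real (\<kappa> * wnorm (2 * n) m n) * (coeff (sph_poly x ^ n) l * of_real (rot_coeff (2 * n) m l C (- S)))
       = of_real (wigner_d n (int n - int l) k (cos b)) * Ylm n (int n - int l) x" .
  qed
  finally show ?thesis
    by (simp add: sum_int_symmetric)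
qed

lemma norm_e_vec [simp]: "norm (e_vec \<phi>) = 1"
proof -
  have "(norm (e_vec \<phi>))\<^sup>2 = 1" by (simp add: norm_vec3 e_vec_def)
  then show ?thesis using norm_ge_zero[of "e_vec \<phi>"] by (auto simp: power2_eq_1_iff)
qed

lemma transpose_R3_e_vec: "transpose (R3 a) *v e_vec \<phi> = e_vec (\<phi> - a)"
  by (simp add: vec_eq_iff forall_3 transpose_R3_mult e_vec_def cos_diff sin_diff algebra_simps)

text \<open>Rotation about the third axis reduces the claim to phi = 0, so \<open>Arg\<close> is
  evaluated at 1 only.\<close>

lemma Ylm_e_vec:
  assumes "\<bar>k\<bar> \<le> int n"
  shows "Ylm n k (e_vec \<phi>) = of_real (norm_legendre n k 0) * cis (of_int k * \<phi>)"
proof -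
  have "Ylm n k (e_vec \<phi>) = cis (of_int k * \<phi>) * Ylm n k (e_vec 0)"
    using Ylm_R3[OF norm_e_vec assms, of "- \<phi>" 0] by (simp add: transpose_R3_e_vec)
  also have "Ylm n k (e_vec 0) = of_real (norm_legendre n k 0)"
    by (simp add: Ylm_def e_vec_def flip: one_complex.code)
  finally show ?thesis by simp
qed

lemma norm_transpose_Qrot [simp]: "norm (transpose (Qrot a b g) *v x) = norm x"
  by (simp add: Qrot_def matrix_transpose_mul flip: matrix_vector_mul_assoc)

text \<open>In the inverse rotation g acts last and contributes a phase, a acts first and only
  shifts the angle of \<open>e_vec\<close>; the mixing of orders comes from b alone.\<close>

lemma Ylm_transpose_Qrot_e_vec:
  assumes k: "\<bar>k\<bar> \<le> int n" and b: "0 < b" "b < pi"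
  shows "Ylm n k (transpose (Qrot a b g) *v e_vec \<phi>) =
    (\<Sum>j\<in>{- int n..int n}. wigner_D n j k a b g * (of_real (norm_legendre n j 0) * cis (of_int j * \<phi>)))"
proof -
  have "Ylm n k (transpose (Qrot a b g) *v e_vec \<phi>)
    = cis (- of_int k * g) * (\<Sum>j\<in>{- int n..int n}. of_real (wigner_d n j k (cos b)) * Ylm n j (e_vec (\<phi> - a)))"
    using k b by (simp add: Qrot_def matrix_transpose_mul transpose_R3_e_vec Ylm_R3 Ylm_R2 flip: matrix_vector_mul_assoc)
  also have "\<dots> = (\<Sum>j\<in>{- int n..int n}. wigner_D n j k a b g * (of_real (norm_legendre n j 0) * cis (of_int j * \<phi>)))"
    unfolding sum_distrib_left
  proof (rule sum.cong[OF refl])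
    fix j assume "j \<in> {- int n..int n}"
    then have j: "\<bar>j\<bar> \<le> int n" by auto
    have "cis (of_int j * (\<phi> - a)) = cis (- of_int j * a) * cis (of_int j * \<phi>)"
      by (simp add: cis_mult algebra_simps)
    then show "cis (- of_int k * g) * (of_real (wigner_d n j k (cos b)) * Ylm n j (e_vec (\<phi> - a))) =
       wigner_D n j k a b g * (of_real (norm_legendre n j 0) * cis (of_int j * \<phi>))"
      unfolding Ylm_e_vec[OF j] wigner_D_def by (simp add: mult_ac)
  qed
  finally show ?thesis .
qed

section \<open>Orthogonality of the Wigner matrix elements\<close>

definition theta_measure :: "real measure" where
  "theta_measure = density lborel (\<lambda>\<theta>. ennreal (indicator {0..pi} \<theta> * sin \<theta>))"

lemma indicator_sin_nonneg: "0 \<le> indicator {0..pi} \<theta> * sin \<theta>"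
  by (auto simp: indicator_def sin_ge_zero)

lemma sets_theta_measure [measurable_cong, simp]: "sets theta_measure = sets borel"
  by (simp add: theta_measure_def)

lemma space_theta_measure [simp]: "space theta_measure = UNIV"
  by (simp add: theta_measure_def)

lemma emeasure_theta_measure: "emeasure theta_measure UNIV = 2"
proof -
  have "has_bochner_integral lborel (\<lambda>x. indicator {0..pi} x *\<^sub>R sin x) (- cos pi - - cos 0)"
    by (rule has_bochner_integral_FTC_Icc)
      (auto intro!: derivative_eq_intros continuous_intros simp flip: has_real_derivative_iff_has_vector_derivative)
  then have "(\<integral>\<^sup>+x. ennreal (indicator {0..pi} x * sin x) \<partial>lborel) = ennreal 2"
    using indicator_sin_nonneg by (subst nn_integral_eq_integral) (auto simp: has_bochner_integral_iff)
  then show ?thesis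
    by (simp add: theta_measure_def emeasure_density)
qed

interpretation theta: finite_measure theta_measure
  by standard (simp add: emeasure_theta_measure)

text \<open>The endpoints are null, so formulas valid for 0 < b < pi may be used under the
  integral.\<close>

lemma AE_theta: "AE \<theta> in theta_measure. 0 < \<theta> \<and> \<theta> < pi"
proof -
  have "AE \<theta> in lborel. \<theta> \<noteq> (0::real)" "AE \<theta> in lborel. \<theta> \<noteq> pi"
    by (rule AE_lborel_singleton)+
  then have "AE \<theta> in lborel. 0 < ennreal (indicator {0..pi} \<theta> * sin \<theta>) \<longrightarrow> 0 < \<theta> \<and> \<theta> < pi"
    by eventually_elim (auto simp: indicator_def split: if_splits)
  then show ?thesis
    unfolding theta_measure_def by (subst AE_density) auto
qed

section \<open>Integration of polynomials in cos theta\<close>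

text \<open>In the variable t = cos theta this is the integral of p over [-1, 1]; the Jacobian sin
  theta is already part of \<open>theta_measure\<close>.\<close>

definition pint :: "real poly \<Rightarrow> real" where
  "pint p = (\<integral>\<theta>. poly p (cos \<theta>) \<partial>theta_measure)"

lemma integrable_poly_cos: "integrable theta_measure (\<lambda>\<theta>. poly p (cos \<theta>))"
proof -
  have "continuous_on {-1..1} (poly p)" by (intro continuous_intros)
  then have "bounded (poly p ` {-1..1})"
    by (intro compact_imp_bounded compact_continuous_image) auto
  then obtain B where "\<And>x. x \<in> {-1..1} \<Longrightarrow> norm (poly p x) \<le> B"
    unfolding bounded_iff by blast
  then have "\<And>\<theta>. norm (poly p (cos \<theta>)) \<le> B" by simp
  moreover have "(\<lambda>\<theta>. poly p (cos \<theta>)) \<in> borel_measurable borel"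
    by (intro borel_measurable_continuous_onI continuous_intros)
  ultimately show ?thesis
    by (intro theta.integrable_const_bound[of _ B]) (auto simp: measurable_cong_sets[OF sets_theta_measure refl])
qed

lemma pint_add: "pint (p + q) = pint p + pint q"
  by (simp add: pint_def integrable_poly_cos)

lemma pint_smult: "pint (smult c p) = c * pint p"
  by (simp add: pint_def)

lemma pint_0 [simp]: "pint 0 = 0"
  by (simp add: pint_def)

lemma pint_pderiv: "pint (pderiv p) = poly p 1 - poly p (-1)"
proof -
  have "has_bochner_integral lborel (\<lambda>x. indicator {0..pi} x *\<^sub>R (sin x * poly (pderiv p) (cos x)))
     (- poly p (cos pi) - - poly p (cos 0))"
    by (rule has_bochner_integral_FTC_Icc)
      (auto intro!: derivative_eq_intros poly_DERIV[THEN DERIV_chain2] continuous_intros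
        simp flip: has_real_derivative_iff_has_vector_derivative)
  then have "(\<integral>x. indicator {0..pi} x *\<^sub>R (sin x * poly (pderiv p) (cos x)) \<partial>lborel) = poly p 1 - poly p (-1)"
    by (simp add: has_bochner_integral_iff)
  moreover have "(\<lambda>\<theta>. poly (pderiv p) (cos \<theta>)) \<in> borel_measurable borel"
    by (intro borel_measurable_continuous_onI continuous_intros)
  ultimately show ?thesis
    unfolding pint_def theta_measure_def
    by (subst integral_density) (auto simp: indicator_sin_nonneg mult.assoc)
qed

lemma pint_by_parts:
  "pint (p * pderiv q) = poly (p * q) 1 - poly (p * q) (-1) - pint (pderiv p * q)"
proof -
  have "pint (pderiv (p * q)) = pint (p * pderiv q) + pint (pderiv p * q)"
    by (simp add: pderiv_mult pint_add mult_ac)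
  then show ?thesis by (simp add: pint_pderiv)
qed

lemma pint_by_parts_iterated:
  assumes "\<And>r. r < m \<Longrightarrow> poly ((pderiv ^^ r) W) 1 = 0 \<and> poly ((pderiv ^^ r) W) (-1) = 0"
  shows "pint (q * (pderiv ^^ m) W) = (-1) ^ m * pint ((pderiv ^^ m) q * W)"
  using assms
proof (induction m arbitrary: q)
  case (Suc m)
  have "pint (q * (pderiv ^^ Suc m) W) = - pint (pderiv q * (pderiv ^^ m) W)"
    using Suc.prems[of m] by (simp add: pint_by_parts)
  also have "\<dots> = - ((-1) ^ m * pint ((pderiv ^^ m) (pderiv q) * W))"
    using Suc.prems by (subst Suc.IH) auto
  also have "(pderiv ^^ m) (pderiv q) = (pderiv ^^ Suc m) q"
    by (simp add: funpow_Suc_right del: funpow.simps)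
  finally show ?case by simp
qed simp

abbreviation um :: "real poly" where "um \<equiv> [:1, -1:]"
abbreviation up :: "real poly" where "up \<equiv> [:1, 1:]"

text \<open>A Beta integral. Integration by parts trades a factor 1 - t for a factor 1 + t; the
  boundary terms vanish because the integrated product contains both factors.\<close>

lemma pint_beta: "pint (um ^ A * up ^ B) = 2 ^ (A + B + 1) * fact A * fact B / fact (A + B + 1)"
proof (induction A arbitrary: B)
  case 0
  have "pderiv (up ^ Suc B) = smult (real (Suc B)) (up ^ B)"
    by (simp add: pderiv_power_Suc pderiv_pCons del: power_Suc of_nat_Suc)
  then have "real (Suc B) * pint (up ^ B) = 2 ^ Suc B"
    using pint_pderiv[of "up ^ Suc B"] by (simp add: pint_smult poly_power del: power_Suc of_nat_Suc)
  then have "pint (up ^ B) = 2 ^ Suc B / real (Suc B)"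
    by (simp only: nonzero_eq_divide_eq of_nat_eq_0_iff nat.distinct mult.commute not_False_eq_True)
  then show ?case by (simp del: of_nat_Suc)
next
  case (Suc A)
  have "pderiv (um ^ Suc A) = smult (- real (Suc A)) (um ^ A)" "pderiv (up ^ Suc B) = smult (real (Suc B)) (up ^ B)"
    by (simp_all add: pderiv_power_Suc pderiv_pCons del: power_Suc of_nat_Suc)
  moreover have "poly (um ^ Suc A * up ^ Suc B) 1 = 0" "poly (um ^ Suc A * up ^ Suc B) (-1) = 0"
    by simp_all
  ultimately have "real (Suc B) * pint (um ^ Suc A * up ^ B) = real (Suc A) * pint (um ^ A * up ^ Suc B)"
    using pint_by_parts[of "um ^ Suc A" "up ^ Suc B"]
    by (simp only: mult_smult_right mult_smult_left pint_smult)
  then have "pint (um ^ Suc A * up ^ B) = real (Suc A) * pint (um ^ A * up ^ Suc B) / real (Suc B)"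
    by (simp only: nonzero_eq_divide_eq of_nat_eq_0_iff nat.distinct mult.commute not_False_eq_True)
  also have "\<dots> = 2 ^ (Suc A + B + 1) * fact (Suc A) * fact B / fact (Suc A + B + 1)"
    unfolding Suc.IH by (simp add: field_simps del: of_nat_Suc)
  finally show ?case .
qed

section \<open>Jacobi polynomials through Rodrigues' formula\<close>

text \<open>Each differentiation costs one power of either factor. The free cofactor
  \<open>K\<close> absorbs the terms of the product rule and lets the induction run.\<close>

lemma higher_pderiv_jacobi:
  "\<exists>J. (pderiv ^^ r) (um ^ (r + a) * up ^ (r + b) * K) = um ^ a * up ^ b * J"
proof (induction r arbitrary: K)
  case (Suc r)
  have "pderiv (um ^ Suc (r + a)) = smult (- real (Suc (r + a))) (um ^ (r + a))"
     "pderiv (up ^ Suc (r + b)) = smult (real (Suc (r + b))) (up ^ (r + b))"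
    by (simp_all add: pderiv_power_Suc pderiv_pCons del: power_Suc of_nat_Suc)
  then have "pderiv (um ^ Suc (r + a) * up ^ Suc (r + b) * K) = um ^ (r + a) * up ^ (r + b) *
     (smult (- real (Suc (r + a))) (up * K) + smult (real (Suc (r + b))) (um * K) + um * up * pderiv K)"
    by (simp only: pderiv_mult)
      (simp only: power_Suc mult_smult_right mult_smult_left distrib_left distrib_right smult_add_right mult_ac add_ac)
  then show ?case
    using Suc.IH by (simp add: funpow_Suc_right del: funpow.simps power_Suc)
qed auto

definition jacobi_weight :: "nat \<Rightarrow> nat \<Rightarrow> nat \<Rightarrow> real poly" where
  "jacobi_weight a b m = um ^ (m + a) * up ^ (m + b)"

text \<open>The cofactor is unique, since the weight is a nonzero polynomial. It is (-2)^m m! times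
  the classical Jacobi polynomial with parameters a and b.\<close>

definition jacobi :: "nat \<Rightarrow> nat \<Rightarrow> nat \<Rightarrow> real poly" where
  "jacobi a b m = (SOME J. (pderiv ^^ m) (jacobi_weight a b m) = um ^ a * up ^ b * J)"

lemma rodrigues: "(pderiv ^^ m) (jacobi_weight a b m) = um ^ a * up ^ b * jacobi a b m"
  unfolding jacobi_def
  by (rule someI_ex) (use higher_pderiv_jacobi[of m a b 1] in \<open>simp add: jacobi_weight_def\<close>)

lemma degree_jacobi_weight: "degree (jacobi_weight a b m) = 2 * m + a + b"
  by (simp add: jacobi_weight_def degree_mult_eq degree_power_eq)

lemma lead_coeff_jacobi_weight: "lead_coeff (jacobi_weight a b m) = (-1) ^ (m + a)"
  by (simp add: jacobi_weight_def lead_coeff_mult lead_coeff_power)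

lemma
  shows degree_jacobi: "degree (jacobi a b m) = m"
    and coeff_jacobi: "coeff (jacobi a b m) m = (-1) ^ m * fact (2 * m + a + b) / fact (m + a + b)"
proof -
  let ?D = "(pderiv ^^ m) (jacobi_weight a b m)"
  have d: "degree ?D = m + a + b"
    by (simp add: degree_higher_pderiv degree_jacobi_weight)
  have "coeff ?D (m + a + b) = pochhammer (real (Suc (m + a + b))) m * coeff (jacobi_weight a b m) (2 * m + a + b)"
    by (simp add: coeff_higher_pderiv add_ac mult_2)
  also have "coeff (jacobi_weight a b m) (2 * m + a + b) = (-1) ^ (m + a)"
    using lead_coeff_jacobi_weight[of a b m] by (simp add: degree_jacobi_weight)
  also have "pochhammer (real (Suc (m + a + b))) m = fact (2 * m + a + b) / fact (m + a + b)"
  proof -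
    have "fact (2 * m + a + b) = fact (m + a + b) * pochhammer (real (Suc (m + a + b))) m"
      using pochhammer_product[of "m + a + b" "2 * m + a + b" "1 :: real"]
      by (simp add: add_ac flip: pochhammer_fact)
    then show ?thesis by (simp del: of_nat_Suc)
  qed
  finally have l: "lead_coeff ?D = fact (2 * m + a + b) / fact (m + a + b) * (-1) ^ (m + a)"
    using d by simp
  then have "jacobi a b m \<noteq> 0"
    by (auto simp: rodrigues)
  then show dJ: "degree (jacobi a b m) = m"
    using d by (simp add: rodrigues degree_mult_eq degree_power_eq)
  have "(-1) ^ a * lead_coeff (jacobi a b m) = (-1) ^ a * ((-1) ^ m * fact (2 * m + a + b) / fact (m + a + b))"
    using l by (simp add: rodrigues lead_coeff_mult lead_coeff_power power_add mult_ac)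
  then have "lead_coeff (jacobi a b m) = (-1) ^ m * fact (2 * m + a + b) / fact (m + a + b)"
    by (subst (asm) mult_left_cancel) auto
  then show "coeff (jacobi a b m) m = (-1) ^ m * fact (2 * m + a + b) / fact (m + a + b)"
    by (simp only: dJ)
qed

text \<open>Rodrigues' formula and m integrations by parts move all derivatives onto a polynomial of
  degree m' <= m. This leaves zero, or m! times a leading coefficient and a Beta integral. Boundary
  terms vanish because fewer than m derivatives leave powers of both 1 - t and 1 + t.\<close>

lemma pint_jacobi_le:
  assumes "m' \<le> m"
  shows "pint (um ^ a * up ^ b * jacobi a b m * jacobi a b m') =
    (if m' = m then fact m * 2 ^ (2 * m + a + b + 1) * fact (m + a) * fact (m + b)
        / ((2 * real m + a + b + 1) * fact (m + a + b)) else 0)"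
proof -
  have v: "poly ((pderiv ^^ r) (jacobi_weight a b m)) 1 = 0 \<and> poly ((pderiv ^^ r) (jacobi_weight a b m)) (-1) = 0"
    if "r < m" for r
  proof -
    obtain J where "(pderiv ^^ r) (um ^ (r + (m - r + a)) * up ^ (r + (m - r + b)) * 1) = um ^ (m - r + a) * up ^ (m - r + b) * J"
      using higher_pderiv_jacobi by blast
    then show ?thesis
      using that by (simp add: jacobi_weight_def poly_power)
  qed
  have "pint (um ^ a * up ^ b * jacobi a b m * jacobi a b m') = pint (jacobi a b m' * (pderiv ^^ m) (jacobi_weight a b m))"
    by (simp add: rodrigues mult_ac)
  also have "\<dots> = (-1) ^ m * pint ((pderiv ^^ m) (jacobi a b m') * jacobi_weight a b m)"
    by (rule pint_by_parts_iterated) (use v in auto)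
  also have "(pderiv ^^ m) (jacobi a b m') = (if m' = m then [:fact m * coeff (jacobi a b m) m:] else 0)"
  proof (rule poly_eqI)
    fix i
    show "coeff ((pderiv ^^ m) (jacobi a b m')) i = coeff (if m' = m then [:fact m * coeff (jacobi a b m) m:] else 0) i"
      using assms
      by (cases i) (auto simp: coeff_higher_pderiv degree_jacobi coeff_eq_0 pochhammer_fact)
  qed
  also have "(-1) ^ m * pint ((if m' = m then [:fact m * coeff (jacobi a b m) m:] else 0) * jacobi_weight a b m)
     = (if m' = m then fact m * (fact (2 * m + a + b) / fact (m + a + b)) * pint (jacobi_weight a b m) else 0)"
    by (simp add: coeff_jacobi pint_smult flip: mult.assoc power_mult_distrib)
  also have "pint (jacobi_weight a b m)
      = 2 ^ (2 * m + a + b + 1) * fact (m + a) * fact (m + b) / ((2 * real m + a + b + 1) * fact (2 * m + a + b))"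
  proof -
    have "(m + a) + (m + b) = 2 * m + a + b" by simp
    then have "pint (jacobi_weight a b m) = 2 ^ (2 * m + a + b + 1) * fact (m + a) * fact (m + b) / fact (2 * m + a + b + 1)"
      unfolding jacobi_weight_def pint_beta by presburger
    also have "(fact (2 * m + a + b + 1) :: real) = (2 * real m + a + b + 1) * fact (2 * m + a + b)"
      by (simp add: algebra_simps)
    finally show ?thesis .
  qed
  finally show ?thesis
    by (simp add: mult_ac)
qed

lemma pint_jacobi:
  "pint (um ^ a * up ^ b * jacobi a b m * jacobi a b m') =
    (if m' = m then fact m * 2 ^ (2 * m + a + b + 1) * fact (m + a) * fact (m + b)
        / ((2 * real m + a + b + 1) * fact (m + a + b)) else 0)"
  using pint_jacobi_le[of m' m a b] pint_jacobi_le[of m m' a b]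
  by (cases "m' \<le> m") (auto simp: mult_ac)

section \<open>Orthogonality for all index pairs\<close>

lemma borel_measurable_power_int [measurable (raw)]:
  fixes f :: "'a \<Rightarrow> 'b::real_normed_field"
  assumes [measurable]: "f \<in> borel_measurable M"
  shows "(\<lambda>x. f x powi k) \<in> borel_measurable M"
  by (cases "k \<ge> 0") (simp_all add: power_int_def)

lemma borel_measurable_wigner_d [measurable]: "wigner_d n k j \<in> borel_measurable borel"
proof -
  define p :: "real poly" where "p = [:1, 1:] ^ nat (int n + j) * [:1, -1:] ^ nat (int n - j)"
  have p: "(\<lambda>x. (1 + x) ^ nat (int n + j) * (1 - x) ^ nat (int n - j)) = poly p"
    by (auto simp: fun_eq_iff poly_power p_def)
  have [measurable]: "poly ((pderiv ^^ nat (int n - k)) p) \<in> borel_measurable borel"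
    by (intro borel_measurable_continuous_onI continuous_intros)
  show ?thesis
    unfolding wigner_d_def[abs_def] p deriv_poly_funpow by measurable
qed

text \<open>For |j| <= k the numbers a and b are true exponents, and each function is a constant
  times the root of the weight times a Jacobi polynomial. In a product with equal indices k, j the
  two roots combine and a polynomial in t remains.\<close>

lemma wigner_d_mult_jacobi:
  assumes t: "\<bar>t\<bar> < 1" and le: "\<bar>j\<bar> \<le> k" "k \<le> int n" "k \<le> int n'"
  defines "a \<equiv> nat (k - j)" and "b \<equiv> nat (k + j)" and "m \<equiv> nat (int n - k)" and "m' \<equiv> nat (int n' - k)"
  defines "c \<equiv> \<lambda>n m. (- 1) ^ (m + a) / 2 ^ n * sqrt (fact (m + a + b) / (fact (m + a) * fact (m + b) * fact m))"
  shows "wigner_d n k j t * wigner_d n' k j t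
     = c n m * c n' m' * poly (um ^ a * up ^ b * jacobi a b m * jacobi a b m') t"
proof -
  \<comment> \<open>The prefactor supplies this reciprocal root of the weight, and Rodrigues'
    formula the full weight.\<close>
  define w where "w = sqrt (inverse ((1 - t) ^ a) * inverse ((1 + t) ^ b))"
  have pos: "1 - t > 0" "1 + t > 0" using t by auto
  have eq: "wigner_d n k j t = c n m * w * ((1 - t) ^ a * (1 + t) ^ b * poly (jacobi a b m) t)"
    if "k \<le> int n" "m = nat (int n - k)" for n m
  proof -
    have i: "nat (int n - j) = m + a" "nat (int n + j) = m + b" "nat (int n - k) = m" "nat (int n + k) = m + a + b"
      "j - k = - int a" "j + k = int b"
      using that le by (auto simp: a_def b_def)
    have f: "(\<lambda>x. (1 + x) ^ (m + b) * (1 - x) ^ (m + a)) = poly (jacobi_weight a b m)"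
      by (auto simp: fun_eq_iff poly_power jacobi_weight_def)
    have "sqrt (fact (m + a + b) * (1 - t) powi (- int a) / (fact (m + a) * fact (m + b) * fact m * (1 + t) powi int b))
      = sqrt (fact (m + a + b) / (fact (m + a) * fact (m + b) * fact m)) * w"
      by (simp add: w_def power_int_minus divide_inverse mult_ac flip: real_sqrt_mult)
    then show ?thesis
      unfolding wigner_d_def i f deriv_poly_funpow rodrigues c_def
      by (simp add: poly_power)
  qed
  have "w * w = inverse ((1 - t) ^ a) * inverse ((1 + t) ^ b)"
    using pos by (simp add: w_def)
  then have V: "w * ((1 - t) ^ a * (1 + t) ^ b) * (w * ((1 - t) ^ a * (1 + t) ^ b)) = (1 - t) ^ a * (1 + t) ^ b"
    using pos by (simp add: field_simps)
  have "c n m * w * ((1 - t) ^ a * (1 + t) ^ b * x) * (c n' m' * w * ((1 - t) ^ a * (1 + t) ^ b * y))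
    = c n m * c n' m' * ((1 - t) ^ a * (1 + t) ^ b * x * y)" for x y
    by (subst (3) V[symmetric]) (simp only: mult_ac)
  then show ?thesis
    using eq[OF le(2) m_def[THEN meta_eq_to_obj_eq]] eq[OF le(3) m'_def[THEN meta_eq_to_obj_eq]]
    by (simp add: poly_power)
qed

lemma cos_open_interval: "0 < \<theta> \<Longrightarrow> \<theta> < pi \<Longrightarrow> \<bar>cos \<theta>\<bar> < 1"
  using cos_monotone_0_pi[of 0 \<theta>] cos_monotone_0_pi[of \<theta> pi] by (simp add: abs_less_iff)

lemma wigner_d_orthogonal_aux:
  assumes le: "\<bar>j\<bar> \<le> k" "k \<le> int n" "k \<le> int n'"
  shows "has_bochner_integral theta_measure (\<lambda>\<theta>. wigner_d n k j (cos \<theta>) * wigner_d n' k j (cos \<theta>))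
     (if n = n' then 2 / (2 * real n + 1) else 0)"
proof -
  define a b m m' where "a = nat (k - j)" and "b = nat (k + j)" and "m = nat (int n - k)" and "m' = nat (int n' - k)"
  define c where "c = (\<lambda>n m. (- 1) ^ (m + a) / 2 ^ n * sqrt (fact (m + a + b) / (fact (m + a) * fact (m + b) * fact m)))"
  define p where "p = um ^ a * up ^ b * jacobi a b m * jacobi a b m'"
  have "c n m * c n' m' * pint p = (if n = n' then 2 / (2 * real n + 1) else 0)"
  proof (cases "n = n'")
    case True
    then have m: "m' = m" by (simp add: m_def m'_def)
    have n: "2 * m + a + b = 2 * n" "2 * real m + real a + real b = 2 * real n"
      using le by (auto simp: a_def b_def m_def)
    have c1: "c n m * c n m = fact (m + a + b) / (fact (m + a) * fact (m + b) * fact m * (2 ^ n * 2 ^ n))"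
      by (simp add: c_def mult_ac)
    have p1: "(2::real) ^ (2 * m + a + b + 1) = 2 * (2 ^ n * 2 ^ n)"
      unfolding n(1) by (simp add: mult_2[of n] power_add)
    have alg: "A / (B * C * D * T) * (D * (2 * T) * B * C / (r * A)) = 2 / r"
      if "A \<noteq> 0" "B \<noteq> 0" "C \<noteq> 0" "D \<noteq> 0" "T \<noteq> 0" "r \<noteq> 0" for A B C D T r :: real
      using that by (simp add: field_simps)
    have "2 * real n + 1 \<noteq> 0" by linarith
    then show ?thesis
      unfolding p_def m pint_jacobi True[symmetric] n(2) c1 p1 by (subst if_P[OF refl], subst alg) simp_all
  next
    case False
    then have "m' \<noteq> m" using le by (auto simp: m_def m'_def)
    then show ?thesis using False by (simp add: p_def pint_jacobi)
  qed
  moreover have "has_bochner_integral theta_measure (\<lambda>\<theta>. c n m * c n' m' * poly p (cos \<theta>)) (c n m * c n' m' * pint p)"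
    by (simp add: has_bochner_integral_iff integrable_poly_cos pint_def)
  moreover have "has_bochner_integral theta_measure (\<lambda>\<theta>. wigner_d n k j (cos \<theta>) * wigner_d n' k j (cos \<theta>)) x
    \<longleftrightarrow> has_bochner_integral theta_measure (\<lambda>\<theta>. c n m * c n' m' * poly p (cos \<theta>)) x" for x
  proof (rule has_bochner_integral_cong_AE)
    show "AE \<theta> in theta_measure. wigner_d n k j (cos \<theta>) * wigner_d n' k j (cos \<theta>) = c n m * c n' m' * poly p (cos \<theta>)"
      using AE_theta
    proof eventually_elim
      case (elim \<theta>)
      then have "\<bar>cos \<theta>\<bar> < 1" by (intro cos_open_interval) auto
      from wigner_d_mult_jacobi[OF this le] show ?case
        by (simp add: a_def b_def m_def m'_def c_def p_def)
    qed
    have "(\<lambda>\<theta>. poly p (cos \<theta>)) \<in> borel_measurable borel"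
      by (intro borel_measurable_continuous_onI continuous_intros)
    then show "(\<lambda>\<theta>. c n m * c n' m' * poly p (cos \<theta>)) \<in> borel_measurable theta_measure"
      by simp
  qed measurable
  ultimately show ?thesis by simp
qed

lemma wigner_d_orthogonal:
  assumes "\<bar>k\<bar> \<le> int n" "\<bar>j\<bar> \<le> int n" "\<bar>k\<bar> \<le> int n'" "\<bar>j\<bar> \<le> int n'"
  shows "has_bochner_integral theta_measure (\<lambda>\<theta>. wigner_d n k j (cos \<theta>) * wigner_d n' k j (cos \<theta>))
     (if n = n' then 2 / (2 * real n + 1) else 0)"
proof -
  have cong: "has_bochner_integral theta_measure (\<lambda>\<theta>. wigner_d n k j (cos \<theta>) * wigner_d n' k j (cos \<theta>)) x
    \<longleftrightarrow> has_bochner_integral theta_measure (\<lambda>\<theta>. wigner_d n k' j' (cos \<theta>) * wigner_d n' k' j' (cos \<theta>)) x"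
    if "\<And>\<theta>. 0 < \<theta> \<Longrightarrow> \<theta> < pi \<Longrightarrow>
      wigner_d n k j (cos \<theta>) * wigner_d n' k j (cos \<theta>) = wigner_d n k' j' (cos \<theta>) * wigner_d n' k' j' (cos \<theta>)"
    for k' j' x
    by (intro has_bochner_integral_cong_AE eventually_mono[OF AE_theta]) (use that in auto)
  \<comment> \<open>The sign depends on k and j but not on the degree, so it squares to one in the
    product.\<close>
  have swap: "wigner_d n k j (cos \<theta>) * wigner_d n' k j (cos \<theta>) = wigner_d n j k (cos \<theta>) * wigner_d n' j k (cos \<theta>)"
    if "0 < \<theta>" "\<theta> < pi" for \<theta>
    using assms by (simp add: wigner_d_swap[OF that, of k _ j])
  have refl: "wigner_d n k j (cos \<theta>) * wigner_d n' k j (cos \<theta>) = wigner_d n (-j) (-k) (cos \<theta>) * wigner_d n' (-j) (-k) (cos \<theta>)"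
    if "0 < \<theta>" "\<theta> < pi" for \<theta>
    using assms by (simp only: wigner_d_reflect[OF that, of k _ j])
  have both: "wigner_d n k j (cos \<theta>) * wigner_d n' k j (cos \<theta>) = wigner_d n (-k) (-j) (cos \<theta>) * wigner_d n' (-k) (-j) (cos \<theta>)"
    if "0 < \<theta>" "\<theta> < pi" for \<theta>
    using assms swap[OF that] by (simp only: wigner_d_reflect[OF that, of j _ k])
  \<comment> \<open>The diagonals j = k and j = -k cut the index square into four cones; swap,
    reflection and their composition carry the last three to the first.\<close>
  consider "\<bar>j\<bar> \<le> k" | "\<bar>k\<bar> \<le> j" | "\<bar>k\<bar> \<le> - j" | "\<bar>j\<bar> \<le> - k" by linarith
  then show ?thesis
  proof cases
    case 1
    then show ?thesis using assms by (intro wigner_d_orthogonal_aux) auto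
  next
    case 2
    then have "has_bochner_integral theta_measure (\<lambda>\<theta>. wigner_d n j k (cos \<theta>) * wigner_d n' j k (cos \<theta>))
       (if n = n' then 2 / (2 * real n + 1) else 0)"
      using assms by (intro wigner_d_orthogonal_aux) auto
    then show ?thesis using cong[OF swap] by blast
  next
    case 3
    then have "has_bochner_integral theta_measure (\<lambda>\<theta>. wigner_d n (- j) (- k) (cos \<theta>) * wigner_d n' (- j) (- k) (cos \<theta>))
       (if n = n' then 2 / (2 * real n + 1) else 0)"
      using assms by (intro wigner_d_orthogonal_aux) auto
    then show ?thesis using cong[OF refl] by blast
  next
    case 4
    then have "has_bochner_integral theta_measure (\<lambda>\<theta>. wigner_d n (- k) (- j) (cos \<theta>) * wigner_d n' (- k) (- j) (cos \<theta>))
       (if n = n' then 2 / (2 * real n + 1) else 0)"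
      using assms by (intro wigner_d_orthogonal_aux) auto
    then show ?thesis using cong[OF both] by blast
  qed
qed

section \<open>Square integrable functions on finite Borel measures\<close>

lemma cmod_diff_square: "(cmod (a - b))\<^sup>2 = (cmod a)\<^sup>2 - 2 * Re (a * cnj b) + (cmod b)\<^sup>2"
  by (simp only: cmod_power2) (simp add: power2_eq_square algebra_simps)

lemma cmod_add_square_le: "(cmod (a + b))\<^sup>2 \<le> 2 * (cmod a)\<^sup>2 + 2 * (cmod b)\<^sup>2"
proof -
  have "(cmod (a + b))\<^sup>2 \<le> (cmod a + cmod b)\<^sup>2"
    by (intro power_mono norm_triangle_ineq) auto
  also have "\<dots> \<le> 2 * (cmod a)\<^sup>2 + 2 * (cmod b)\<^sup>2"
    using sum_squares_bound[of "cmod a" "cmod b"] by (simp add: power2_sum)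
  finally show ?thesis .
qed

lemma L2_measurable: "L2 M f \<Longrightarrow> f \<in> borel_measurable M"
  by (simp add: L2_def)

lemma L2_integrable: "L2 M f \<Longrightarrow> integrable M (\<lambda>x. (cmod (f x))\<^sup>2)"
  by (simp add: L2_def)

lemma L2_add:
  assumes "L2 M f" "L2 M g"
  shows "L2 M (\<lambda>x. f x + g x)"
  unfolding L2_def
proof
  show m: "(\<lambda>x. f x + g x) \<in> borel_measurable M"
    using assms by (intro borel_measurable_add L2_measurable)
  show "integrable M (\<lambda>x. (cmod (f x + g x))\<^sup>2)"
  proof (rule Bochner_Integration.integrable_bound)
    show "integrable M (\<lambda>x. 2 * (cmod (f x))\<^sup>2 + 2 * (cmod (g x))\<^sup>2)"
      using assms by (simp add: L2_integrable)
    show "AE x in M. norm ((cmod (f x + g x))\<^sup>2) \<le> norm (2 * (cmod (f x))\<^sup>2 + 2 * (cmod (g x))\<^sup>2)"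
      by (simp add: cmod_add_square_le)
  qed (use m in measurable)
qed

lemma L2_cmult: "L2 M f \<Longrightarrow> L2 M (\<lambda>x. c * f x)"
  by (auto simp: L2_def norm_mult power_mult_distrib intro: borel_measurable_times)

lemma L2_zero: "L2 M (\<lambda>x. 0)"
  by (simp add: L2_def)

lemma L2_sum: "(\<And>i. i \<in> I \<Longrightarrow> L2 M (f i)) \<Longrightarrow> L2 M (\<lambda>x. \<Sum>i\<in>I. f i x)"
  by (induction I rule: infinite_finite_induct) (auto intro: L2_zero L2_add)

lemma L2_diff: "L2 M f \<Longrightarrow> L2 M g \<Longrightarrow> L2 M (\<lambda>x. f x - g x)"
  using L2_add[of M f "\<lambda>x. (- 1) * g x"] L2_cmult[of M g "- 1"] by simp

lemma (in finite_measure) L2_bounded: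
  assumes "f \<in> borel_measurable M" "AE x in M. cmod (f x) \<le> B"
  shows "L2 M f"
  unfolding L2_def
proof
  show "integrable M (\<lambda>x. (cmod (f x))\<^sup>2)"
  proof (rule integrable_const_bound)
    show "AE x in M. norm ((cmod (f x))\<^sup>2) \<le> B\<^sup>2"
      using assms(2) by eventually_elim (simp add: power_mono)
  qed (use assms(1) in measurable)
qed fact

lemma (in finite_measure) L2_imp_integrable:
  assumes "L2 M f"
  shows "integrable M f"
proof -
  have [measurable]: "f \<in> borel_measurable M" and "integrable M (\<lambda>x. (cmod (f x))\<^sup>2)"
    using assms by (simp_all add: L2_def)
  then have "integrable M (\<lambda>x. cmod (f x))"
    by (intro square_integrable_imp_integrable[where f = "\<lambda>x. cmod (f x)"]) auto
  then show ?thesis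
    by (simp add: integrable_norm_iff)
qed

lemma L2_integrable_inner:
  assumes "L2 M f" "L2 M g"
  shows "integrable M (\<lambda>x. f x * cnj (g x))"
proof (rule Bochner_Integration.integrable_bound)
  show "integrable M (\<lambda>x. (cmod (f x))\<^sup>2 + (cmod (g x))\<^sup>2)"
    using assms by (simp add: L2_integrable)
  have "cmod (f x) * cmod (g x) \<le> (cmod (f x))\<^sup>2 + (cmod (g x))\<^sup>2" for x
  proof -
    have "0 \<le> cmod (f x) * cmod (g x)" by simp
    then show ?thesis
      using sum_squares_bound[of "cmod (f x)" "cmod (g x)"] by linarith
  qed
  then show "AE x in M. norm (f x * cnj (g x)) \<le> norm ((cmod (f x))\<^sup>2 + (cmod (g x))\<^sup>2)"
    by (simp add: norm_mult)
  have [measurable]: "cnj \<in> borel_measurable borel"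
    by (intro borel_measurable_continuous_onI continuous_intros)
  show "(\<lambda>x. f x * cnj (g x)) \<in> borel_measurable M"
    using assms[THEN L2_measurable] by measurable
qed

lemma l2_inner_sum_left:
  assumes "\<And>i. i \<in> I \<Longrightarrow> L2 M (e i)" "L2 M g"
  shows "l2_inner M (\<lambda>x. \<Sum>i\<in>I. c i * e i x) g = (\<Sum>i\<in>I. c i * l2_inner M (e i) g)"
  using assms by (simp add: l2_inner_def sum_distrib_right mult.assoc L2_integrable_inner Bochner_Integration.integral_sum)

lemma l2_inner_sum_right:
  assumes "\<And>i. i \<in> I \<Longrightarrow> L2 M (e i)" "L2 M f"
  shows "l2_inner M f (\<lambda>x. \<Sum>i\<in>I. c i * e i x) = (\<Sum>i\<in>I. cnj (c i) * l2_inner M f (e i))"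
  using assms
  by (simp add: l2_inner_def sum_distrib_left mult.left_commute[of "f _"] L2_integrable_inner Bochner_Integration.integral_sum)

lemma l2_inner_self: "l2_inner M f f = of_real (\<integral>x. (cmod (f x))\<^sup>2 \<partial>M)"
  by (simp add: l2_inner_def flip: complex_norm_square integral_complex_of_real)

text \<open>Pythagoras for arbitrary coefficients. The Fourier coefficients make the last sum
  vanish, which shows that they give the best approximation; taking f = 0 gives the norm of a finite
  combination.\<close>

lemma orthonormal_square_error:
  assumes "finite I" and e: "\<And>i. i \<in> I \<Longrightarrow> L2 M (e i)" and f: "L2 M f"
    and orth: "\<And>i j. i \<in> I \<Longrightarrow> j \<in> I \<Longrightarrow> l2_inner M (e i) (e j) = (if i = j then 1 else 0)"
  shows "(\<integral>x. (cmod (f x - (\<Sum>i\<in>I. c i * e i x)))\<^sup>2 \<partial>M) = (\<integral>x. (cmod (f x))\<^sup>2 \<partial>M)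
     - (\<Sum>i\<in>I. (cmod (l2_inner M f (e i)))\<^sup>2) + (\<Sum>i\<in>I. (cmod (c i - l2_inner M f (e i)))\<^sup>2)"
proof -
  define s where "s = (\<lambda>x. \<Sum>i\<in>I. c i * e i x)"
  have s: "L2 M s"
    unfolding s_def using e by (intro L2_sum L2_cmult)
  have fs: "l2_inner M f s = (\<Sum>i\<in>I. cnj (c i) * l2_inner M f (e i))"
    unfolding s_def by (rule l2_inner_sum_right[OF e f])
  have "l2_inner M s s = (\<Sum>i\<in>I. c i * l2_inner M (e i) s)"
    by (subst (1) s_def) (rule l2_inner_sum_left[OF e s])
  also have "\<dots> = (\<Sum>i\<in>I. c i * cnj (c i))"
  proof (rule sum.cong[OF refl])
    fix i assume i: "i \<in> I"
    have "l2_inner M (e i) s = (\<Sum>j\<in>I. cnj (c j) * (if i = j then 1 else 0))"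
      unfolding s_def using i by (simp add: l2_inner_sum_right[OF e e[OF i]] orth cong: sum.cong)
    then show "c i * l2_inner M (e i) s = c i * cnj (c i)"
      using i \<open>finite I\<close> by (simp add: if_distrib sum.delta cong: if_cong)
  qed
  also have "\<dots> = of_real (\<Sum>i\<in>I. (cmod (c i))\<^sup>2)"
    by (simp only: of_real_sum complex_norm_square)
  finally have ss: "(\<integral>x. (cmod (s x))\<^sup>2 \<partial>M) = (\<Sum>i\<in>I. (cmod (c i))\<^sup>2)"
    unfolding l2_inner_self by (simp only: of_real_eq_iff)
  have "(\<integral>x. (cmod (f x - s x))\<^sup>2 \<partial>M) = (\<integral>x. (cmod (f x))\<^sup>2 - 2 * Re (f x * cnj (s x)) + (cmod (s x))\<^sup>2 \<partial>M)"
    by (simp only: cmod_diff_square)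
  also have "\<dots> = (\<integral>x. (cmod (f x))\<^sup>2 \<partial>M) - 2 * Re (l2_inner M f s) + (\<integral>x. (cmod (s x))\<^sup>2 \<partial>M)"
    using L2_integrable[OF f] L2_integrable[OF s] L2_integrable_inner[OF f s]
    by (simp add: l2_inner_def del: times_complex.sel)
  also have "\<dots> = (\<integral>x. (cmod (f x))\<^sup>2 \<partial>M) + (\<Sum>i\<in>I. (cmod (c i))\<^sup>2 - 2 * Re (c i * cnj (l2_inner M f (e i))))"
    by (simp add: fs ss sum_subtractf sum_distrib_left algebra_simps)
  also have "(\<Sum>i\<in>I. (cmod (c i))\<^sup>2 - 2 * Re (c i * cnj (l2_inner M f (e i))))
     = (\<Sum>i\<in>I. (cmod (c i - l2_inner M f (e i)))\<^sup>2 - (cmod (l2_inner M f (e i)))\<^sup>2)"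
    by (simp only: cmod_diff_square) (simp del: times_complex.sel)
  finally show ?thesis
    by (simp add: s_def sum_subtractf)
qed

section \<open>Continuous functions: determination of measures and density\<close>

lemma closed_indicator_limit:
  fixes K :: "'a::metric_space set"
  assumes "closed K"
  obtains g :: "nat \<Rightarrow> 'a \<Rightarrow> real"
  where "\<And>n. continuous_on UNIV (g n)" "\<And>n x. 0 \<le> g n x" "\<And>n x. g n x \<le> 1"
    "\<And>x. (\<lambda>n. g n x) \<longlonglongrightarrow> indicator K x"
proof (cases "K = {}")
  \<comment> \<open>The distance to the empty set is 0 by convention, so the general formula would
    give the constant 1 here.\<close>
  case True
  then show ?thesis by (intro that[of "\<lambda>_ _. 0"]) auto
next
  case False
  define g where "g n x = max 0 (1 - real n * infdist x K)" for n x
  have lim: "(\<lambda>n. g n x) \<longlonglongrightarrow> indicator K x" for x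
  proof (cases "x \<in> K")
    case True
    then show ?thesis by (simp add: g_def)
  next
    case x: False
    then have d: "infdist x K > 0"
      using assms False in_closed_iff_infdist_zero infdist_nonneg[of x K] by fastforce
    obtain N where N: "real N * infdist x K > 1"
      using reals_Archimedean3[OF d] by blast
    have "g n x = 0" if "n \<ge> N" for n
    proof -
      have "real N * infdist x K \<le> real n * infdist x K"
        using that d by (intro mult_right_mono) auto
      then show ?thesis using N by (simp add: g_def)
    qed
    then have "eventually (\<lambda>n. g n x = 0) sequentially"
      by (auto simp: eventually_sequentially)
    then show ?thesis
      using x by (simp add: tendsto_eventually)
  qed
  show ?thesis
    by (rule that[of g, OF _ _ _ lim]) (auto simp: g_def infdist_nonneg intro!: continuous_intros)
qed

text \<open>Closed sets form an intersection-stable generator, and their indicators are bounded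
  limits of continuous functions with values in [0, 1].\<close>

lemma finite_borel_measure_eqI_continuous:
  fixes M N :: "'a::metric_space measure"
  assumes "finite_measure M" "finite_measure N" and sM: "sets M = sets borel" and sN: "sets N = sets borel"
    and eq: "\<And>g :: 'a \<Rightarrow> real. continuous_on UNIV g \<Longrightarrow> (\<And>x. 0 \<le> g x) \<Longrightarrow> (\<And>x. g x \<le> 1) \<Longrightarrow>
      integral\<^sup>L M g = integral\<^sup>L N g"
  shows "M = N"
proof (rule measure_eqI_generator_eq[where E = "Collect closed" and \<Omega> = UNIV and A = "\<lambda>_. UNIV"])
  interpret M: finite_measure M by fact
  interpret N: finite_measure N by fact
  show "sets M = sigma_sets UNIV (Collect closed)" "sets N = sigma_sets UNIV (Collect closed)"
    by (simp_all add: sM sN borel_eq_closed)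
  fix K :: "'a set" assume "K \<in> Collect closed"
  then have K: "closed K" by simp
  then obtain g :: "nat \<Rightarrow> 'a \<Rightarrow> real" where g: "\<And>n. continuous_on UNIV (g n)" "\<And>n x. 0 \<le> g n x" "\<And>n x. g n x \<le> 1"
    "\<And>x. (\<lambda>n. g n x) \<longlonglongrightarrow> indicator K x"
    using closed_indicator_limit by metis
  have lim: "(\<lambda>n. integral\<^sup>L L (g n)) \<longlonglongrightarrow> measure L K" if "finite_measure L" "sets L = sets borel" for L
  proof -
    interpret L: finite_measure L by fact
    have sp: "space L = UNIV" using that(2) by (metis sets_eq_imp_space_eq space_borel)
    have [measurable]: "g n \<in> borel_measurable L" for n
      using borel_measurable_continuous_onI[OF g(1)[of n]] by (simp add: measurable_cong_sets[OF that(2) refl])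
    have [measurable]: "K \<in> sets L" using K that(2) by simp
    have "(\<lambda>n. integral\<^sup>L L (g n)) \<longlonglongrightarrow> integral\<^sup>L L (indicator K)"
      by (rule integral_dominated_convergence[where w = "\<lambda>_. 1"]) (auto simp: g)
    then show ?thesis by (simp add: sp)
  qed
  have "integral\<^sup>L M (g n) = integral\<^sup>L N (g n)" for n
    by (intro eq g)
  then have "(\<lambda>n. integral\<^sup>L M (g n)) \<longlonglongrightarrow> measure N K"
    using lim[OF assms(2) sN] by simp
  then have "measure M K = measure N K"
    using lim[OF assms(1) sM] LIMSEQ_unique by blast
  then show "emeasure M K = emeasure N K"
    by (simp add: M.emeasure_eq_measure N.emeasure_eq_measure)
qed (auto simp: Int_stable_def finite_measure.emeasure_finite[OF assms(1)])

definition cont_approx :: "'a::metric_space measure \<Rightarrow> ('a \<Rightarrow> complex) \<Rightarrow> bool" where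
  "cont_approx M f \<longleftrightarrow> L2 M f \<and> (\<forall>\<epsilon>>0. \<exists>g. continuous_on UNIV g \<and> L2 M g \<and> (\<integral>x. (cmod (f x - g x))\<^sup>2 \<partial>M) < \<epsilon>)"

lemma integral_cmod_square_add_le:
  assumes "L2 M f" "L2 M g"
  shows "(\<integral>x. (cmod (f x + g x))\<^sup>2 \<partial>M) \<le> 2 * (\<integral>x. (cmod (f x))\<^sup>2 \<partial>M) + 2 * (\<integral>x. (cmod (g x))\<^sup>2 \<partial>M)"
proof -
  have "(\<integral>x. (cmod (f x + g x))\<^sup>2 \<partial>M) \<le> (\<integral>x. 2 * (cmod (f x))\<^sup>2 + 2 * (cmod (g x))\<^sup>2 \<partial>M)"
    using L2_integrable[OF L2_add[OF assms]] assms[THEN L2_integrable]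
    by (intro integral_mono) (auto simp: cmod_add_square_le)
  then show ?thesis using assms[THEN L2_integrable] by simp
qed

lemma cont_approx_limit:
  assumes f: "L2 M f" and *: "\<And>\<epsilon>. \<epsilon> > 0 \<Longrightarrow> \<exists>h. cont_approx M h \<and> (\<integral>x. (cmod (f x - h x))\<^sup>2 \<partial>M) < \<epsilon>"
  shows "cont_approx M f"
  unfolding cont_approx_def
proof (intro conjI allI impI f)
  fix \<epsilon> :: real assume "\<epsilon> > 0"
  then obtain h where h: "cont_approx M h" "(\<integral>x. (cmod (f x - h x))\<^sup>2 \<partial>M) < \<epsilon> / 4"
    \<comment> \<open>Two errors below a quarter suffice, because |u + v|^2 <= 2 |u|^2 + 2
      |v|^2.\<close>
    using *[of "\<epsilon> / 4"] by auto
  then obtain g where g: "continuous_on UNIV g" "L2 M g" "(\<integral>x. (cmod (h x - g x))\<^sup>2 \<partial>M) < \<epsilon> / 4"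
    using \<open>\<epsilon> > 0\<close> unfolding cont_approx_def by (elim conjE allE[of _ "\<epsilon> / 4"]) auto
  have hL: "L2 M h" using h by (simp add: cont_approx_def)
  have "(\<integral>x. (cmod (f x - h x + (h x - g x)))\<^sup>2 \<partial>M) \<le> 2 * (\<integral>x. (cmod (f x - h x))\<^sup>2 \<partial>M) + 2 * (\<integral>x. (cmod (h x - g x))\<^sup>2 \<partial>M)"
    by (intro integral_cmod_square_add_le L2_diff f hL g)
  then have "(\<integral>x. (cmod (f x - g x))\<^sup>2 \<partial>M) < \<epsilon>"
    using h g by simp
  with g show "\<exists>g. continuous_on UNIV g \<and> L2 M g \<and> (\<integral>x. (cmod (f x - g x))\<^sup>2 \<partial>M) < \<epsilon>"
    by blast
qed

lemma cont_approx_add: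
  assumes "cont_approx M f" "cont_approx M g"
  shows "cont_approx M (\<lambda>x. f x + g x)"
  unfolding cont_approx_def
proof (intro conjI allI impI)
  have L: "L2 M f" "L2 M g" using assms by (auto simp: cont_approx_def)
  then show "L2 M (\<lambda>x. f x + g x)" by (rule L2_add)
  fix \<epsilon> :: real assume "\<epsilon> > 0"
  then have e: "\<epsilon> / 4 > 0" by simp
  obtain a where a: "continuous_on UNIV a" "L2 M a" "(\<integral>x. (cmod (f x - a x))\<^sup>2 \<partial>M) < \<epsilon> / 4"
    using assms(1) e unfolding cont_approx_def by blast
  obtain b where b: "continuous_on UNIV b" "L2 M b" "(\<integral>x. (cmod (g x - b x))\<^sup>2 \<partial>M) < \<epsilon> / 4"
    using assms(2) e unfolding cont_approx_def by blast
  have "(\<integral>x. (cmod (f x - a x + (g x - b x)))\<^sup>2 \<partial>M) \<le> 2 * (\<integral>x. (cmod (f x - a x))\<^sup>2 \<partial>M) + 2 * (\<integral>x. (cmod (g x - b x))\<^sup>2 \<partial>M)"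
    by (intro integral_cmod_square_add_le L2_diff L a b)
  moreover have "f x - a x + (g x - b x) = f x + g x - (a x + b x)" for x by simp
  ultimately have "(\<integral>x. (cmod (f x + g x - (a x + b x)))\<^sup>2 \<partial>M) < \<epsilon>"
    using a b by simp
  then show "\<exists>h. continuous_on UNIV h \<and> L2 M h \<and> (\<integral>x. (cmod (f x + g x - h x))\<^sup>2 \<partial>M) < \<epsilon>"
    using a b by (intro exI[of _ "\<lambda>x. a x + b x"]) (auto intro: L2_add continuous_on_add)
qed

lemma cont_approx_cmult:
  assumes "cont_approx M f"
  shows "cont_approx M (\<lambda>x. c * f x)"
  unfolding cont_approx_def
proof (intro conjI allI impI)
  have L: "L2 M f" using assms by (auto simp: cont_approx_def)
  then show "L2 M (\<lambda>x. c * f x)" by (rule L2_cmult)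
  fix \<epsilon> :: real assume "\<epsilon> > 0"
  then have e: "\<epsilon> / ((cmod c)\<^sup>2 + 1) > 0" by (intro divide_pos_pos) (auto intro: add_nonneg_pos)
  obtain a where a: "continuous_on UNIV a" "L2 M a" "(\<integral>x. (cmod (f x - a x))\<^sup>2 \<partial>M) < \<epsilon> / ((cmod c)\<^sup>2 + 1)"
    using assms(1) e unfolding cont_approx_def by blast
  define I where "I = (\<integral>x. (cmod (f x - a x))\<^sup>2 \<partial>M)"
  have "I \<ge> 0" by (simp add: I_def)
  have "(\<integral>x. (cmod (c * f x - c * a x))\<^sup>2 \<partial>M) = (cmod c)\<^sup>2 * I"
    unfolding I_def by (simp add: norm_mult power_mult_distrib flip: right_diff_distrib)
  also have "\<dots> \<le> ((cmod c)\<^sup>2 + 1) * I"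
    using \<open>I \<ge> 0\<close> by (intro mult_right_mono) auto
  also have "\<dots> < \<epsilon>"
    using a(3) by (simp add: I_def pos_less_divide_eq add_nonneg_pos mult.commute)
  finally show "\<exists>h. continuous_on UNIV h \<and> L2 M h \<and> (\<integral>x. (cmod (c * f x - h x))\<^sup>2 \<partial>M) < \<epsilon>"
    using a by (intro exI[of _ "\<lambda>x. c * a x"]) (auto intro: L2_cmult continuous_on_mult continuous_on_const)
qed

lemma cont_approx_zero: "cont_approx M (\<lambda>x. 0)"
  by (auto simp: cont_approx_def L2_zero intro!: exI[of _ "\<lambda>x. 0"])

lemma cont_approx_sum: "(\<And>i. i \<in> I \<Longrightarrow> cont_approx M (f i)) \<Longrightarrow> cont_approx M (\<lambda>x. \<Sum>i\<in>I. f i x)"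
  by (induction I rule: infinite_finite_induct) (auto intro: cont_approx_zero cont_approx_add)

lemma cont_approx_dominated_limit:
  assumes s: "\<And>i. cont_approx M (s i)" and f: "L2 M f"
    and lim: "\<And>x. x \<in> space M \<Longrightarrow> (\<lambda>i. s i x) \<longlonglongrightarrow> f x"
    and bound: "\<And>i x. x \<in> space M \<Longrightarrow> cmod (s i x) \<le> w x" and w: "integrable M (\<lambda>x. (w x)\<^sup>2)"
  shows "cont_approx M f"
proof (rule cont_approx_limit[OF f])
  fix \<epsilon> :: real assume e: "\<epsilon> > 0"
  have sm [measurable]: "s i \<in> borel_measurable M" for i
    using s[of i] by (simp add: cont_approx_def L2_def)
  note [measurable] = L2_measurable[OF f]
  have "(\<lambda>i. \<integral>x. (cmod (f x - s i x))\<^sup>2 \<partial>M) \<longlonglongrightarrow> (\<integral>x. 0 \<partial>M)"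
  proof (rule integral_dominated_convergence)
    show "integrable M (\<lambda>x. 2 * (cmod (f x))\<^sup>2 + 2 * (w x)\<^sup>2)"
      using w L2_integrable[OF f] by simp
    show "AE x in M. (\<lambda>i. (cmod (f x - s i x))\<^sup>2) \<longlonglongrightarrow> 0"
    proof (rule AE_I2)
      fix x assume "x \<in> space M"
      then have "(\<lambda>i. (cmod (f x - s i x))\<^sup>2) \<longlonglongrightarrow> (cmod (f x - f x))\<^sup>2"
        by (intro tendsto_intros lim)
      then show "(\<lambda>i. (cmod (f x - s i x))\<^sup>2) \<longlonglongrightarrow> 0" by simp
    qed
    show "AE x in M. norm ((cmod (f x - s i x))\<^sup>2) \<le> 2 * (cmod (f x))\<^sup>2 + 2 * (w x)\<^sup>2" for i
    proof (rule AE_I2)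
      fix x assume "x \<in> space M"
      then have "(cmod (s i x))\<^sup>2 \<le> (w x)\<^sup>2"
        by (intro power_mono bound) auto
      then show "norm ((cmod (f x - s i x))\<^sup>2) \<le> 2 * (cmod (f x))\<^sup>2 + 2 * (w x)\<^sup>2"
        using cmod_add_square_le[of "f x" "- s i x"] by simp
    qed
  qed measurable
  then have "eventually (\<lambda>i. (\<integral>x. (cmod (f x - s i x))\<^sup>2 \<partial>M) < \<epsilon>) sequentially"
    using e by (auto dest: order_tendstoD)
  then show "\<exists>h. cont_approx M h \<and> (\<integral>x. (cmod (f x - h x))\<^sup>2 \<partial>M) < \<epsilon>"
    using s eventually_happens'[OF sequentially_bot] by blast
qed

text \<open>A Dynkin argument: closed sets are handled by their continuous limits, and complements
  and countable disjoint unions preserve approximability.\<close>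

lemma cont_approx_indicator:
  fixes M :: "'a::metric_space measure"
  assumes "finite_measure M" and sM: "sets M = sets borel" and A: "A \<in> sets borel"
  shows "cont_approx M (\<lambda>x. indicator A x :: complex)"
proof -
  interpret finite_measure M by fact
  have L2ind: "L2 M (\<lambda>x. indicator A x)" if "A \<in> sets borel" for A
    using that by (intro L2_bounded[where B = 1] borel_measurable_indicator) (auto simp: sM indicator_def)
  have cont: "cont_approx M g" if "continuous_on UNIV g" "\<And>x. cmod (g x) \<le> 1" for g
  proof -
    have "L2 M g"
      using borel_measurable_continuous_onI[OF that(1)] that(2)
      by (intro L2_bounded[where B = 1]) (auto simp: measurable_cong_sets[OF sM refl])
    then show ?thesis
      using that(1) by (auto simp: cont_approx_def intro!: exI[of _ g])
  qed
  have "Int_stable (Collect closed :: 'a set set)" "Collect closed \<subseteq> Pow (UNIV :: 'a set)"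
    by (auto simp: Int_stable_def)
  moreover have "A \<in> sigma_sets UNIV (Collect closed)"
    using A by (simp add: borel_eq_closed)
  ultimately show ?thesis
  proof (induction rule: sigma_sets_induct_disjoint)
    case (basic K)
    then have K: "closed K" by simp
    then obtain g :: "nat \<Rightarrow> 'a \<Rightarrow> real" where g: "\<And>n. continuous_on UNIV (g n)" "\<And>n x. 0 \<le> g n x" "\<And>n x. g n x \<le> 1"
      "\<And>x. (\<lambda>n. g n x) \<longlonglongrightarrow> indicator K x"
      using closed_indicator_limit by metis
    show ?case
    proof (rule cont_approx_dominated_limit[where s = "\<lambda>n x. of_real (g n x)" and w = "\<lambda>_. 1"])
      show "cont_approx M (\<lambda>x. complex_of_real (g i x))" for i
        using g by (intro cont continuous_on_of_real) auto
      show "L2 M (\<lambda>x. indicator K x)"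
        using K by (intro L2ind) auto
      show "(\<lambda>i. complex_of_real (g i x)) \<longlonglongrightarrow> indicator K x" for x
        using tendsto_of_real[OF g(4)[of x], where ?'a = complex] by (cases "x \<in> K") auto
    qed (use g in auto)
  next
    case empty
    show ?case by (simp add: cont_approx_zero)
  next
    case (compl A)
    have "cont_approx M (\<lambda>x. 1 + (- 1) * indicator A x)"
      by (intro cont_approx_add cont_approx_cmult compl cont) auto
    moreover have "(\<lambda>x. 1 + (- 1) * indicator A x) = (\<lambda>x. indicator (UNIV - A) x :: complex)"
      by (auto simp: indicator_def)
    ultimately show ?case by simp
  next
    case (union A)
    have Ai: "A i \<in> sets borel" for i
      using union(2) by (auto simp: borel_eq_closed)
    \<comment> \<open>By disjointness the partial sums are again indicators, hence dominated by the
      constant 1.\<close>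
    have eq: "(\<Sum>i<n. indicator (A i) x) = (indicator (\<Union>i<n. A i) x :: complex)" for n x
    proof (induction n)
      case (Suc n)
      have "A n \<inter> A i = {}" if "i < n" for i
        using union(1) that by (auto simp: disjoint_family_on_def)
      then have "indicator (\<Union>i<n. A i) x + indicator (A n) x = (indicator (\<Union>i<Suc n. A i) x :: complex)"
        by (auto simp: indicator_def lessThan_Suc)
      then show ?case by (simp only: sum.lessThan_Suc Suc)
    qed simp
    show ?case
    proof (rule cont_approx_dominated_limit[where s = "\<lambda>n x. \<Sum>i<n. indicator (A i) x" and w = "\<lambda>_. 1"])
      show "cont_approx M (\<lambda>x. \<Sum>i<n. indicator (A i) x)" for n
        by (intro cont_approx_sum union)
      show "L2 M (\<lambda>x. indicator (\<Union>i. A i) x)"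
        using Ai by (intro L2ind) auto
      show "(\<lambda>n. \<Sum>i<n. indicator (A i) x) \<longlonglongrightarrow> (indicator (\<Union>i. A i) x :: complex)" for x
        unfolding eq by (rule LIMSEQ_indicator_UN)
      show "cmod (\<Sum>i<n. indicator (A i) x) \<le> 1" for n x
        unfolding eq by (auto simp: indicator_def)
    qed auto
  qed
qed

text \<open>The approximating simple functions can be chosen with modulus at most 2 |f|, a square
  integrable dominant.\<close>

lemma L2_imp_cont_approx:
  fixes M :: "'a::metric_space measure"
  assumes "finite_measure M" and sM: "sets M = sets borel" and f: "L2 M f"
  shows "cont_approx M f"
proof -
  interpret finite_measure M by fact
  have sp: "space M = UNIV" using sM by (metis sets_eq_imp_space_eq space_borel)
  obtain s where s: "\<And>i. simple_function M (s i)" "\<And>x. x \<in> space M \<Longrightarrow> (\<lambda>i. s i x) \<longlonglongrightarrow> f x"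
    "\<And>i x. x \<in> space M \<Longrightarrow> dist (s i x) 0 \<le> 2 * dist (f x) 0"
    using borel_measurable_implies_sequence_metric[OF L2_measurable[OF f], of 0] by blast
  show ?thesis
  proof (rule cont_approx_dominated_limit[where s = s and w = "\<lambda>x. 2 * cmod (f x)"])
    fix i
    have "s i = (\<lambda>x. \<Sum>y\<in>s i ` space M. y * indicator (s i -` {y} \<inter> space M) x)"
      using simple_functionD(1)[OF s(1)[of i]]
      by (intro ext) (simp add: indicator_def sp if_distrib sum.delta cong: if_cong)
    moreover have "cont_approx M (\<lambda>x. \<Sum>y\<in>s i ` space M. y * indicator (s i -` {y} \<inter> space M) x)"
      using simple_functionD(2)[OF s(1)[of i]]
      by (intro cont_approx_sum cont_approx_cmult cont_approx_indicator assms(1,2)) (simp add: sM)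
    ultimately show "cont_approx M (s i)" by simp
  next
    show "integrable M (\<lambda>x. (2 * cmod (f x))\<^sup>2)"
      using L2_integrable[OF f] by (simp add: power_mult_distrib)
  qed (use s f in auto)
qed

section \<open>Orthonormality of the spherical harmonics\<close>

definition interval_measure :: "real \<Rightarrow> real \<Rightarrow> real measure" where
  "interval_measure u v = density lborel (\<lambda>\<phi>. ennreal (indicator {u..v} \<phi>))"

lemma sets_interval_measure [measurable_cong, simp]: "sets (interval_measure u v) = sets borel"
  by (simp add: interval_measure_def)

lemma space_interval_measure [simp]: "space (interval_measure u v) = UNIV"
  by (simp add: interval_measure_def)

lemma emeasure_interval_measure: "u \<le> v \<Longrightarrow> emeasure (interval_measure u v) UNIV = ennreal (v - u)"
  by (simp add: interval_measure_def emeasure_density ennreal_indicator)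

interpretation interval: finite_measure "interval_measure u v" for u v
proof
  show "emeasure (interval_measure u v) (space (interval_measure u v)) \<noteq> \<infinity>"
    by (simp add: interval_measure_def emeasure_density ennreal_indicator emeasure_lborel_Icc_eq)
qed

abbreviation phi_measure :: "real measure" where
  "phi_measure \<equiv> interval_measure 0 (2 * pi)"

lemma has_bochner_integral_intervalI:
  fixes F f :: "real \<Rightarrow> real"
  assumes "u \<le> v" "\<And>x. (F has_real_derivative f x) (at x)" "continuous_on UNIV f"
  shows "has_bochner_integral (interval_measure u v) f (F v - F u)"
  unfolding interval_measure_def
proof (rule has_bochner_integral_density)
  show "has_bochner_integral lborel (\<lambda>x. indicator {u..v} x *\<^sub>R f x) (F v - F u)"
    by (rule has_bochner_integral_FTC_Icc)
      (auto intro!: assms(1) has_field_derivative_at_within[OF assms(2)] continuous_on_subset[OF assms(3)]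
        simp flip: has_real_derivative_iff_has_vector_derivative)
qed (use borel_measurable_continuous_onI[OF assms(3)] in auto)

text \<open>The endpoints are general because the full circle and the arc from
  \<open>- \<psi>\<close> to \<open>\<psi>\<close> are both needed.\<close>

lemma has_bochner_integral_cis:
  assumes "u \<le> v"
  shows "has_bochner_integral (interval_measure u v) (\<lambda>\<phi>. cis (of_int k * \<phi>))
    (if k = 0 then of_real (v - u)
     else Complex ((sin (of_int k * v) - sin (of_int k * u)) / k) ((cos (of_int k * u) - cos (of_int k * v)) / k))"
proof (cases "k = 0")
  case True
  have "has_bochner_integral (interval_measure u v) (\<lambda>\<phi>. 1 :: real) (v - u)"
    by (rule has_bochner_integral_intervalI[where F = "\<lambda>x. x"]) (use assms in \<open>auto intro!: derivative_eq_intros\<close>)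
  then have "has_bochner_integral (interval_measure u v) (\<lambda>\<phi>. complex_of_real 1) (of_real (v - u))"
    by (rule has_bochner_integral_of_real)
  then show ?thesis using True by simp
next
  case False
  have c: "has_bochner_integral (interval_measure u v) (\<lambda>\<phi>. cos (of_int k * \<phi>)) (sin (of_int k * v) / k - sin (of_int k * u) / k)"
    by (rule has_bochner_integral_intervalI) (use False assms in \<open>auto intro!: derivative_eq_intros continuous_intros\<close>)
  have s: "has_bochner_integral (interval_measure u v) (\<lambda>\<phi>. sin (of_int k * \<phi>)) (- cos (of_int k * v) / k - - cos (of_int k * u) / k)"
    by (rule has_bochner_integral_intervalI) (use False assms in \<open>auto intro!: derivative_eq_intros continuous_intros\<close>)
  have "has_bochner_integral (interval_measure u v) (\<lambda>\<phi>. complex_of_real (cos (of_int k * \<phi>)) + \<i> * complex_of_real (sin (of_int k * \<phi>)))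
     (complex_of_real (sin (of_int k * v) / k - sin (of_int k * u) / k) + \<i> * complex_of_real (- cos (of_int k * v) / k - - cos (of_int k * u) / k))"
    by (intro has_bochner_integral_add has_bochner_integral_mult_right has_bochner_integral_of_real c s)
  moreover have "complex_of_real (cos (of_int k * \<phi>)) + \<i> * complex_of_real (sin (of_int k * \<phi>)) = cis (of_int k * \<phi>)" for \<phi>
    by (simp add: complex_eq_iff)
  moreover have "complex_of_real (sin (of_int k * v) / k - sin (of_int k * u) / k) + \<i> * complex_of_real (- cos (of_int k * v) / k - - cos (of_int k * u) / k)
    = Complex ((sin (of_int k * v) - sin (of_int k * u)) / k) ((cos (of_int k * u) - cos (of_int k * v)) / k)"
    by (simp add: complex_eq_iff diff_divide_distrib)
  ultimately show ?thesis
    using False by simp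
qed

lemma integral_cis:
  "has_bochner_integral phi_measure (\<lambda>\<phi>. cis (of_int k * \<phi>)) (if k = 0 then of_real (2 * pi) else 0)"
proof -
  have "sin (of_int k * (2 * pi)) = 0" "cos (of_int k * (2 * pi)) = 1"
    using sin_int_2pin[of k] cos_int_2pin[of k] by (simp_all add: mult_ac)
  then have "(if k = 0 then of_real (2 * pi - 0) else Complex ((sin (of_int k * (2 * pi)) - sin (of_int k * 0)) / k)
     ((cos (of_int k * 0) - cos (of_int k * (2 * pi))) / k)) = (if k = 0 then of_real (2 * pi) else 0)"
    by (simp add: complex_eq_iff)
  then show ?thesis
    using has_bochner_integral_cis[of 0 "2 * pi" k] by (simp only:) simp
qed

section \<open>Product structure of the surface measure\<close>

lemma has_bochner_integral_pair_mult:
  fixes f :: "'a \<Rightarrow> complex" and g :: "'b \<Rightarrow> complex"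
  assumes "sigma_finite_measure M1" "sigma_finite_measure M2"
    and f: "has_bochner_integral M1 f a" and g: "has_bochner_integral M2 g b"
  shows "has_bochner_integral (M1 \<Otimes>\<^sub>M M2) (\<lambda>p. f (fst p) * g (snd p)) (a * b)"
proof -
  interpret pair_sigma_finite M1 M2
    using assms(1,2) by (simp add: pair_sigma_finite_def)
  have fi: "integrable M1 f" "integral\<^sup>L M1 f = a" and gi: "integrable M2 g" "integral\<^sup>L M2 g = b"
    using f g by (auto simp: has_bochner_integral_iff)
  note [measurable] = borel_measurable_integrable[OF fi(1)] borel_measurable_integrable[OF gi(1)]
  have int: "integrable (M1 \<Otimes>\<^sub>M M2) (\<lambda>p. f (fst p) * g (snd p))"
  proof (rule Fubini_integrable)
    show "integrable M1 (\<lambda>x. \<integral>y. norm (f (fst (x, y)) * g (snd (x, y))) \<partial>M2)"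
      using fi gi by (simp add: norm_mult)
    show "AE x in M1. integrable M2 (\<lambda>y. f (fst (x, y)) * g (snd (x, y)))"
      using gi by simp
  qed measurable
  moreover have "(\<integral>p. f (fst p) * g (snd p) \<partial>(M1 \<Otimes>\<^sub>M M2)) = a * b"
    by (subst integral_fst'[OF int, symmetric]) (use fi gi in simp)
  ultimately show ?thesis
    by (simp add: has_bochner_integral_iff)
qed

interpretation phi_theta: pair_sigma_finite phi_measure theta_measure ..

abbreviation "angle_measure \<equiv> phi_measure \<Otimes>\<^sub>M theta_measure"

interpretation angle: finite_measure angle_measure
  by (intro finite_measure_pair_measure interval.finite_measure_axioms theta.finite_measure_axioms)

lemma sets_angle_measure: "sets angle_measure = sets borel"
proof -
  have "sets angle_measure = sets (borel \<Otimes>\<^sub>M borel)"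
    by (rule sets_pair_measure_cong) simp_all
  then show ?thesis by (simp only: borel_prod)
qed

lemma angle_measure_eq:
  "angle_measure = density lborel (\<lambda>p::real \<times> real. indicator ({0..2*pi} \<times> {0..pi}) p * ennreal (sin (snd p)))"
proof -
  have "angle_measure = density (lborel \<Otimes>\<^sub>M lborel)
      (\<lambda>(\<phi>, \<theta>). ennreal (indicator {0..2 * pi} \<phi>) * ennreal (indicator {0..pi} \<theta> * sin \<theta>))"
    unfolding interval_measure_def theta_measure_def
    by (rule pair_measure_density)
      (auto simp flip: theta_measure_def intro: theta.sigma_finite_measure_axioms lborel.sigma_finite_measure_axioms)
  also have "(\<lambda>(\<phi>, \<theta>). ennreal (indicator {0..2 * pi} \<phi>) * ennreal (indicator {0..pi} \<theta> * sin \<theta>))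
    = (\<lambda>p. indicator ({0..2*pi} \<times> {0..pi}) p * ennreal (sin (snd p)))"
    by (auto simp: fun_eq_iff indicator_def)
  finally show ?thesis by (simp add: lborel_prod)
qed

lemma vector_3_eq: "vector [a, b, c] = (\<chi> i::3. if i = 1 then a else if i = 2 then b else c)"
  by (simp add: vec_eq_iff forall_3)

lemma continuous_on_vector_3 [continuous_intros]:
  fixes a b c :: "'a::topological_space \<Rightarrow> 'b::{zero,topological_space}"
  assumes "continuous_on S a" "continuous_on S b" "continuous_on S c"
  shows "continuous_on S (\<lambda>x. vector [a x, b x, c x] :: 'b^3)"
  unfolding vector_3_eq
proof (rule continuous_on_vec_lambda)
  show "continuous_on S (\<lambda>x. if i = 1 then a x else if i = 2 then b x else c x)" for i :: 3
    using assms by (cases "i = 1"; cases "i = 2") simp_all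
qed

lemma continuous_xi: "continuous_on UNIV (\<lambda>p. xi (fst p) (snd p))"
  unfolding xi_def by (intro continuous_intros)

lemma measurable_xi [measurable]: "(\<lambda>p. xi (fst p) (snd p)) \<in> borel_measurable angle_measure"
  using borel_measurable_continuous_onI[OF continuous_xi]
  by (simp add: measurable_cong_sets[OF sets_angle_measure refl])

lemma sphere_measure_eq: "sphere_measure = distr angle_measure borel (\<lambda>p. xi (fst p) (snd p))"
  by (simp add: sphere_measure_def angle_measure_eq)

lemma sets_sphere_measure [measurable_cong, simp]: "sets sphere_measure = sets borel"
  by (simp add: sphere_measure_eq)

lemma space_sphere_measure [simp]: "space sphere_measure = UNIV"
  by (simp add: sphere_measure_eq)

interpretation sphere: finite_measure sphere_measure
  unfolding sphere_measure_eq by (rule angle.finite_measure_distr) measurable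

lemma AE_angle: "AE p in angle_measure. 0 < snd p \<and> snd p < pi"
proof (rule phi_theta.AE_pair_measure)
  show "{p \<in> space angle_measure. 0 < snd p \<and> snd p < pi} \<in> sets angle_measure"
    by measurable
qed (use AE_theta in simp)

lemma norm_xi [simp]: "norm (xi \<phi> \<theta>) = 1"
proof -
  have "(norm (xi \<phi> \<theta>))\<^sup>2 = ((sin \<phi>)\<^sup>2 + (cos \<phi>)\<^sup>2) * (sin \<theta>)\<^sup>2 + (cos \<theta>)\<^sup>2"
    unfolding norm_vec3 xi_def vector_3 by algebra
  then have "(norm (xi \<phi> \<theta>))\<^sup>2 = 1" by simp
  then show ?thesis using norm_ge_zero[of "xi \<phi> \<theta>"] by (auto simp: power2_eq_1_iff)
qed

text \<open>\<open>sphere_measure\<close> lives on all of R^3 but is concentrated on the unit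
  sphere, so identities proved for \<open>norm x = 1\<close> hold almost everywhere.\<close>

lemma AE_sphere: "AE x in sphere_measure. norm x = 1"
  unfolding sphere_measure_eq by (subst AE_distr_iff) auto

section \<open>Measurability, integrability and inner products of the harmonics\<close>

lemma continuous_norm_legendre: "continuous_on S (norm_legendre n k)"
proof -
  have *: "assoc_legendre n m = (\<lambda>t. (- 1) ^ m / (2 ^ n * fact n) * sqrt (1 - t\<^sup>2) ^ m
      * poly ((pderiv ^^ (n + m)) ([:-1, 0, 1:] ^ n)) t)" for m
    by (simp add: fun_eq_iff assoc_legendre_def legendre_poly_eq deriv_poly_funpow)
  show ?thesis
    unfolding norm_legendre_def[abs_def] Let_def * by (intro continuous_intros)
qed

lemma norm_legendre_bounded:
  "\<exists>B. \<forall>t. \<bar>t\<bar> \<le> 1 \<longrightarrow> \<bar>norm_legendre n k t\<bar> \<le> B"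
proof -
  have "compact (norm_legendre n k ` {-1..1})"
    by (intro compact_continuous_image continuous_norm_legendre) simp
  then have "bounded (norm_legendre n k ` {-1..1})"
    by (rule compact_imp_bounded)
  then obtain B where "\<forall>x\<in>norm_legendre n k ` {-1..1}. norm x \<le> B"
    unfolding bounded_iff ..
  then show ?thesis by (intro exI[of _ B]) (auto simp: abs_le_iff)
qed

text \<open>\<open>Arg\<close> jumps along a half-line. For integer k the phase is an integer power
  of \<open>sgn z\<close>, with value 1 at the origin where \<open>Arg\<close> is 0, and this form
  is visibly measurable.\<close>

lemma measurable_Ylm [measurable]: "Ylm n k \<in> borel_measurable borel"
proof -
  have c [measurable]: "(\<lambda>x::real^3. Complex (x$1) (x$2)) \<in> borel_measurable borel"
    unfolding Complex_eq by (intro borel_measurable_continuous_onI continuous_intros)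
  have l [measurable]: "(\<lambda>x::real^3. norm_legendre n k (x$3)) \<in> borel_measurable borel"
    by (intro borel_measurable_continuous_onI continuous_on_compose2[OF continuous_norm_legendre] continuous_intros) auto
  have "cis (of_int k * Arg z) = (if z = 0 then 1 else sgn z powi k)" for z
    by (simp add: Arg_zero cis_Arg flip: cis_power_int)
  then have "Ylm n k = (\<lambda>x. of_real (norm_legendre n k (x$3)) *
      (if Complex (x$1) (x$2) = 0 then 1 else sgn (Complex (x$1) (x$2)) powi k))"
    by (simp add: fun_eq_iff Ylm_def)
  also have "\<dots> \<in> borel_measurable borel"
    by measurable
  finally show ?thesis .
qed

text \<open>\<open>Arg\<close> recovers the longitude only modulo 2 pi, which an integer order does
  not notice.\<close>

lemma Ylm_xi:
  assumes "0 < \<theta>" "\<theta> < pi"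
  shows "Ylm n k (xi \<phi> \<theta>) = of_real (norm_legendre n k (cos \<theta>)) * cis (of_int k * \<phi>)"
proof -
  have s: "sin \<theta> > 0" using assms by (intro sin_gt_zero)
  define z where "z = Complex (cos \<phi> * sin \<theta>) (sin \<phi> * sin \<theta>)"
  have z: "z = of_real (sin \<theta>) * cis \<phi>"
    by (simp add: z_def complex_eq_iff mult_ac)
  then have "z \<noteq> 0" "sgn z = cis \<phi>"
    using s by (auto simp: sgn_eq norm_mult)
  then have "cis (of_int k * Arg z) = cis (of_int k * \<phi>)"
    by (simp add: cis_Arg flip: cis_power_int)
  then show ?thesis by (simp add: Ylm_def xi_def z_def)
qed

lemma L2_harmoniclm: "L2 sphere_measure (Ylm n k)"
proof -
  obtain B where B: "\<And>t. \<bar>t\<bar> \<le> 1 \<Longrightarrow> \<bar>norm_legendre n k t\<bar> \<le> B"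
    using norm_legendre_bounded[of n k] by blast
  show ?thesis
  proof (rule sphere.L2_bounded)
    show "AE x in sphere_measure. cmod (Ylm n k x) \<le> B"
      using AE_sphere
    proof eventually_elim
      case (elim x)
      then have "\<bar>x $ 3\<bar> \<le> 1" using component_le_norm_cart[of x 3] by simp
      then show ?case by (simp add: Ylm_def norm_mult B)
    qed
  qed measurable
qed

text \<open>The case j = 0 of the orthogonality of d_n^{k,j}; the constant is (2 n + 1) / (4 pi)
  times 2 / (2 n + 1).\<close>

lemma norm_legendre_orthogonal:
  assumes "\<bar>k\<bar> \<le> int n" "\<bar>k\<bar> \<le> int n'"
  shows "(\<integral>\<theta>. norm_legendre n k (cos \<theta>) * norm_legendre n' k (cos \<theta>) \<partial>theta_measure)
    = (if n = n' then 1 / (2 * pi) else 0)"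
proof -
  define \<kappa> where "\<kappa> n = sqrt ((2 * real n + 1) / (4 * pi))" for n
  have [measurable]: "(\<lambda>\<theta>. norm_legendre n k (cos \<theta>)) \<in> borel_measurable borel" for n
    by (intro borel_measurable_continuous_onI continuous_on_compose2[OF continuous_norm_legendre] continuous_intros) auto
  have "(\<integral>\<theta>. norm_legendre n k (cos \<theta>) * norm_legendre n' k (cos \<theta>) \<partial>theta_measure)
     = (\<integral>\<theta>. (\<kappa> n * \<kappa> n') * (wigner_d n k 0 (cos \<theta>) * wigner_d n' k 0 (cos \<theta>)) \<partial>theta_measure)"
    by (rule integral_cong_AE, measurable, rule eventually_mono[OF AE_theta])
      (use assms in \<open>auto simp: norm_legendre_eq_wigner_d \<kappa>_def\<close>)
  also have "\<dots> = (\<kappa> n * \<kappa> n') * (if n = n' then 2 / (2 * real n + 1) else 0)"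
    using wigner_d_orthogonal[of k n 0 n'] assms by (simp add: has_bochner_integral_iff)
  also have "\<dots> = (if n = n' then 1 / (2 * pi) else 0)"
  proof -
    have alg: "r / (4 * pi) * (2 / r) = 1 / (2 * pi)" if "r > 0" for r :: real
      using that by (simp add: field_simps)
    have pos: "2 * real n + 1 > 0" by (simp add: add_nonneg_pos)
    have "\<kappa> n * \<kappa> n = (2 * real n + 1) / (4 * pi)" by (simp add: \<kappa>_def add_nonneg_pos)
    then show ?thesis
      using alg[OF pos] by (cases "n = n'") (simp_all only: if_True if_False mult_zero_right simp_thms)
  qed
  finally show ?thesis .
qed

lemma Ylm_orthonormal:
  assumes k: "\<bar>k\<bar> \<le> int n" "\<bar>k'\<bar> \<le> int n'"
  shows "l2_inner sphere_measure (Ylm n k) (Ylm n' k') = (if n = n' \<and> k = k' then 1 else 0)"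
proof -
  define P where "P \<theta> = norm_legendre n k (cos \<theta>) * norm_legendre n' k' (cos \<theta>)" for \<theta>
  have [measurable]: "(\<lambda>\<theta>. norm_legendre n k (cos \<theta>)) \<in> borel_measurable borel" for n k
    by (intro borel_measurable_continuous_onI continuous_on_compose2[OF continuous_norm_legendre] continuous_intros) auto
  have [measurable]: "P \<in> borel_measurable borel"
    unfolding P_def[abs_def] by measurable
  have [measurable]: "cnj \<in> borel_measurable borel" "cis \<in> borel_measurable borel"
    "complex_of_real \<in> borel_measurable borel"
    by (intro borel_measurable_continuous_onI continuous_intros)+
  \<comment> \<open>Fubini needs integrability also for k different from k', where the Legendre
    orthogonality relation says nothing; boundedness provides it.\<close>
  have P: "integrable theta_measure P"
  proof -
    obtain B where B: "\<And>t. \<bar>t\<bar> \<le> 1 \<Longrightarrow> \<bar>norm_legendre n k t\<bar> \<le> B"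
      using norm_legendre_bounded[of n k] by blast
    obtain B' where B': "\<And>t. \<bar>t\<bar> \<le> 1 \<Longrightarrow> \<bar>norm_legendre n' k' t\<bar> \<le> B'"
      using norm_legendre_bounded[of n' k'] by blast
    have "norm (P \<theta>) \<le> B * B'" for \<theta>
      using mult_mono[OF B[of "cos \<theta>"] B'[of "cos \<theta>"]] B[of 0] by (simp add: P_def abs_mult)
    then show ?thesis by (intro theta.integrable_const_bound[of _ "B * B'"]) auto
  qed
  have "l2_inner sphere_measure (Ylm n k) (Ylm n' k')
      = (\<integral>p. Ylm n k (xi (fst p) (snd p)) * cnj (Ylm n' k' (xi (fst p) (snd p))) \<partial>angle_measure)"
    unfolding l2_inner_def sphere_measure_eq by (rule integral_distr) measurable
  also have "\<dots> = (\<integral>p. cis (of_int (k - k') * fst p) * of_real (P (snd p)) \<partial>angle_measure)"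
  proof (rule integral_cong_AE)
    show "AE p in angle_measure. Ylm n k (xi (fst p) (snd p)) * cnj (Ylm n' k' (xi (fst p) (snd p)))
       = cis (of_int (k - k') * fst p) * of_real (P (snd p))"
      using AE_angle
    proof eventually_elim
      case (elim p)
      have "cis (of_int (k - k') * fst p) = cis (of_int k * fst p) * cnj (cis (of_int k' * fst p))"
        by (simp add: cis_cnj cis_mult algebra_simps)
      with elim show ?case by (simp add: Ylm_xi P_def)
    qed
  qed measurable
  also have "\<dots> = (if k - k' = 0 then of_real (2 * pi) else 0) * of_real (integral\<^sup>L theta_measure P)"
  proof (intro has_bochner_integral_integral_eq has_bochner_integral_pair_mult[where f = "\<lambda>\<phi>. cis (of_int (k - k') * \<phi>)"])
    show "has_bochner_integral theta_measure (\<lambda>\<theta>. complex_of_real (P \<theta>)) (of_real (integral\<^sup>L theta_measure P))"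
      using P by (intro has_bochner_integral_of_real) (simp add: has_bochner_integral_iff)
  qed (rule integral_cis interval.sigma_finite_measure_axioms theta.sigma_finite_measure_axioms)+
  also have "\<dots> = (if n = n' \<and> k = k' then 1 else 0)"
    using norm_legendre_orthogonal[of k n n'] k by (auto simp: P_def[abs_def])
  finally show ?thesis .
qed

section \<open>Completeness of the spherical harmonics\<close>

definition harmonic_index :: "nat \<Rightarrow> (nat \<times> int) set" where
  "harmonic_index N = (SIGMA n:{..N}. {- int n..int n})"

lemma finite_harmonic_index [simp]: "finite (harmonic_index N)"
  by (simp add: harmonic_index_def)

lemma harmonic_index_mono: "N \<le> N' \<Longrightarrow> harmonic_index N \<subseteq> harmonic_index N'"
  by (auto simp: harmonic_index_def)

lemma mem_harmonic_index: "(n, k) \<in> harmonic_index N \<longleftrightarrow> n \<le> N \<and> \<bar>k\<bar> \<le> int n"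
  by (auto simp: harmonic_index_def)

lemma sum_harmonic_index: "(\<Sum>n\<le>N. \<Sum>k\<in>{-int n..int n}. f n k) = (\<Sum>i\<in>harmonic_index N. f (fst i) (snd i))"
  by (simp add: harmonic_index_def sum.Sigma split_def)

definition harmonic :: "nat \<times> int \<Rightarrow> real^3 \<Rightarrow> complex" where
  "harmonic i = Ylm (fst i) (snd i)"

definition harmonic_span :: "(real^3 \<Rightarrow> complex) \<Rightarrow> bool" where
  "harmonic_span f \<longleftrightarrow> (\<exists>N c. \<forall>x. norm x = 1 \<longrightarrow> f x = (\<Sum>i\<in>harmonic_index N. c i * harmonic i x))"

lemma harmonic_span_cong:
  "harmonic_span f \<Longrightarrow> (\<And>x. norm x = 1 \<Longrightarrow> g x = f x) \<Longrightarrow> harmonic_span g"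
  by (simp add: harmonic_span_def)

lemma harmonic_span_zero: "harmonic_span (\<lambda>x. 0)"
  unfolding harmonic_span_def by (intro exI[of _ 0] exI[of _ "\<lambda>_. 0"]) simp

lemma harmonic_span_Ylm:
  assumes "\<bar>k\<bar> \<le> int n"
  shows "harmonic_span (Ylm n k)"
  unfolding harmonic_span_def
proof (intro exI allI impI)
  fix x :: "real^3"
  have "(\<Sum>i\<in>harmonic_index n. (if i = (n, k) then 1 else 0) * harmonic i x) = (\<Sum>i\<in>{(n, k)}. harmonic i x)"
    using assms by (intro sum.mono_neutral_cong_right) (auto simp: mem_harmonic_index)
  then show "Ylm n k x = (\<Sum>i\<in>harmonic_index n. (if i = (n, k) then 1 else 0) * harmonic i x)"
    by (simp add: harmonic_def)
qed

lemma harmonic_span_cmult: "harmonic_span f \<Longrightarrow> harmonic_span (\<lambda>x. a * f x)"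
  unfolding harmonic_span_def
proof (elim exE)
  fix N c assume *: "\<forall>x. norm x = 1 \<longrightarrow> f x = (\<Sum>i\<in>harmonic_index N. c i * harmonic i x)"
  show "\<exists>N c. \<forall>x. norm x = 1 \<longrightarrow> a * f x = (\<Sum>i\<in>harmonic_index N. c i * harmonic i x)"
    by (intro exI[of _ N] exI[of _ "\<lambda>i. a * c i"]) (use * in \<open>simp add: sum_distrib_left mult.assoc\<close>)
qed

lemma harmonic_span_add:
  assumes "harmonic_span f" "harmonic_span g"
  shows "harmonic_span (\<lambda>x. f x + g x)"
proof -
  obtain N c where f: "\<And>x. norm x = 1 \<Longrightarrow> f x = (\<Sum>i\<in>harmonic_index N. c i * harmonic i x)"
    using assms(1) by (auto simp: harmonic_span_def)
  obtain N' c' where g: "\<And>x. norm x = 1 \<Longrightarrow> g x = (\<Sum>i\<in>harmonic_index N'. c' i * harmonic i x)"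
    using assms(2) by (auto simp: harmonic_span_def)
  have ext: "(\<Sum>i\<in>harmonic_index N. c i * harmonic i x)
     = (\<Sum>i\<in>harmonic_index (max M N). (if i \<in> harmonic_index N then c i else 0) * harmonic i x)" for N c x M
    using harmonic_index_mono[of N "max M N"]
    by (intro sum.mono_neutral_cong_left) auto
  have "f x + g x = (\<Sum>i\<in>harmonic_index (max N N').
      ((if i \<in> harmonic_index N then c i else 0) + (if i \<in> harmonic_index N' then c' i else 0)) * harmonic i x)"
    if "norm x = 1" for x
    unfolding f[OF that] g[OF that] distrib_right sum.distrib
    using ext[where N = N and c = c and x = x and M = N'] ext[where N = N' and c = c' and x = x and M = N] by (simp only: max.commute[of N' N])
  then show ?thesis
    unfolding harmonic_span_def
    by (intro exI[of _ "max N N'"] exI[of _ "\<lambda>i. (if i \<in> harmonic_index N then c i else 0) + (if i \<in> harmonic_index N' then c' i else 0)"]) simp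
qed

section \<open>Polynomials on the sphere lie in the harmonic span\<close>

text \<open>The exact degree matters: for fixed k the polynomials q for n = |k|, |k| + 1, ... have
  degrees 0, 1, 2, ... and so form a triangular basis.\<close>

lemma legendre_polynomial_part:
  assumes "\<bar>k\<bar> \<le> int n"
  obtains q where "degree q = n - nat \<bar>k\<bar>" "q \<noteq> 0" "\<And>t. norm_legendre n k t = sqrt (1 - t\<^sup>2) ^ nat \<bar>k\<bar> * poly q t"
proof -
  define m where "m = nat \<bar>k\<bar>"
  define r where "r = (pderiv ^^ (n + m)) ([:-1, 0, 1:] ^ n :: real poly)"
  define a where "a = (if k < 0 then (-1) ^ m else 1) * sqrt ((2 * real n + 1) / (4 * pi) * fact (n - m) / fact (n + m))
     * ((- 1) ^ m / (2 ^ n * fact n))"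
  have "a \<noteq> 0"
    by (auto simp: a_def add_nonneg_eq_0_iff)
  have m: "m \<le> n" using assms by (simp add: m_def)
  have "degree ([:-1, 0, 1:] ^ n :: real poly) = 2 * n"
    by (simp add: degree_power_eq)
  moreover have "lead_coeff ([:-1, 0, 1:] ^ n :: real poly) = 1"
    by (simp add: lead_coeff_power)
  ultimately have c: "coeff ([:-1, 0, 1:] ^ n :: real poly) (2 * n) = 1" and d: "degree r = n - m"
    using m by (simp_all add: r_def degree_higher_pderiv)
  have e: "n - m + (n + m) = 2 * n" using m by simp
  have "coeff r (n - m) \<noteq> 0"
    unfolding r_def coeff_higher_pderiv e c using pochhammer_pos[of "real (Suc (n - m))" "n + m"] by linarith
  then have "r \<noteq> 0" by auto
  have "norm_legendre n k t = sqrt (1 - t\<^sup>2) ^ m * poly (smult a r) t" for t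
    by (simp add: norm_legendre_def assoc_legendre_def legendre_poly_eq deriv_poly_funpow m_def[symmetric] a_def r_def[symmetric])
  then show ?thesis
    using \<open>a \<noteq> 0\<close> \<open>r \<noteq> 0\<close> d by (intro that[of "smult a r"]) (auto simp: m_def)
qed

definition planar :: "real^3 \<Rightarrow> complex" where
  "planar x = Complex (x$1) (x$2)"

text \<open>On the unit sphere this is sin(theta)^|k| e^(i k phi), written as a polynomial in the
  coordinates so that no choice of argument is involved.\<close>

definition angular :: "int \<Rightarrow> real^3 \<Rightarrow> complex" where
  "angular k x = (if k \<ge> 0 then planar x ^ nat k else cnj (planar x) ^ nat (- k))"

lemma angular_eq:
  assumes "norm x = 1"
  shows "angular k x = of_real (sqrt (1 - (x$3)\<^sup>2) ^ nat \<bar>k\<bar>) * cis (of_int k * Arg (planar x))"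
proof -
  have "cmod (planar x) = sqrt (1 - (x$3)\<^sup>2)"
    using norm_vec3[of x] assms by (simp add: planar_def cmod_def)
  then have z: "planar x = of_real (sqrt (1 - (x$3)\<^sup>2)) * cis (Arg (planar x))"
    using rcis_cmod_Arg[of "planar x"] by (simp add: rcis_def)
  show ?thesis
  proof (cases "k \<ge> 0")
    case True
    then have "angular k x = planar x ^ nat k" by (simp add: angular_def)
    also have "\<dots> = of_real (sqrt (1 - (x$3)\<^sup>2)) ^ nat k * cis (Arg (planar x)) ^ nat k"
      by (subst z) (simp add: power_mult_distrib)
    finally show ?thesis using True by (simp add: Complex.DeMoivre)
  next
    case False
    then have "angular k x = cnj (planar x) ^ nat (- k)" by (simp add: angular_def)
    also have "\<dots> = of_real (sqrt (1 - (x$3)\<^sup>2)) ^ nat (- k) * cis (- Arg (planar x)) ^ nat (- k)"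
      by (subst z) (simp add: power_mult_distrib cis_cnj)
    finally show ?thesis using False by (simp add: Complex.DeMoivre)
  qed
qed

text \<open>Gaussian elimination from the top degree: the harmonic of order k whose polynomial part
  has degree d removes the coefficient of t^d from p.\<close>

lemma harmonic_span_angular:
  "harmonic_span (\<lambda>x. angular k x * of_real (poly p (x$3)))"
proof -
  have "harmonic_span (\<lambda>x. angular k x * of_real (poly p (x$3)))" if "\<And>i. i \<ge> d \<Longrightarrow> coeff p i = 0" for d
    using that
  proof (induction d arbitrary: p)
    case 0
    then have "p = 0" by (intro poly_eqI) simp
    then show ?case by (simp add: harmonic_span_zero)
  next
    case (Suc d)
    \<comment> \<open>The degree is chosen so that the polynomial part of Y_n^k has degree exactly
      \<open>d\<close>.\<close>
    define n where "n = nat \<bar>k\<bar> + d"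
    have k: "\<bar>k\<bar> \<le> int n" by (simp add: n_def)
    obtain q where q: "degree q = n - nat \<bar>k\<bar>" "q \<noteq> 0"
      "\<And>t. norm_legendre n k t = sqrt (1 - t\<^sup>2) ^ nat \<bar>k\<bar> * poly q t"
      using legendre_polynomial_part[OF k] by metis
    have dq: "degree q = d" using q(1) by (simp add: n_def)
    define b where "b = coeff p d / lead_coeff q"
    have "coeff (p - smult b q) i = 0" if "i \<ge> d" for i
    proof (cases "i = d")
      case True
      then show ?thesis using leading_coeff_neq_0[OF q(2)] by (simp add: b_def dq)
    next
      case False
      then show ?thesis using that Suc.prems[of i] dq by (simp add: coeff_eq_0)
    qed
    then have "harmonic_span (\<lambda>x. angular k x * of_real (poly (p - smult b q) (x$3)))"
      by (rule Suc.IH)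
    then have "harmonic_span (\<lambda>x. angular k x * of_real (poly (p - smult b q) (x$3)) + of_real b * Ylm n k x)"
      by (intro harmonic_span_add harmonic_span_cmult harmonic_span_Ylm k)
    then show ?case
    proof (rule harmonic_span_cong)
      fix x :: "real^3" assume "norm x = 1"
      then have "Ylm n k x = angular k x * of_real (poly q (x$3))"
        by (simp add: angular_eq Ylm_def q(3) planar_def)
      then show "angular k x * of_real (poly p (x$3))
        = angular k x * of_real (poly (p - smult b q) (x$3)) + of_real b * Ylm n k x"
        by (simp add: algebra_simps)
    qed
  qed
  from this[of "Suc (degree p)"] show ?thesis by (simp add: coeff_eq_0)
qed

text \<open>Multipliers of the span are trivially closed under products, so only the coordinate functions
  have to be checked.\<close>
definition harmonic_multiplier :: "(real^3 \<Rightarrow> complex) \<Rightarrow> bool" where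
  "harmonic_multiplier f \<longleftrightarrow> (\<forall>g. harmonic_span g \<longrightarrow> harmonic_span (\<lambda>x. f x * g x))"

lemma harmonic_multiplier_add:
  "harmonic_multiplier f \<Longrightarrow> harmonic_multiplier g \<Longrightarrow> harmonic_multiplier (\<lambda>x. f x + g x)"
  by (simp add: harmonic_multiplier_def distrib_right harmonic_span_add)

lemma harmonic_multiplier_cmult:
  "harmonic_multiplier f \<Longrightarrow> harmonic_multiplier (\<lambda>x. c * f x)"
  by (simp add: harmonic_multiplier_def mult.assoc harmonic_span_cmult)

lemma harmonic_multiplier_mult:
  "harmonic_multiplier f \<Longrightarrow> harmonic_multiplier g \<Longrightarrow> harmonic_multiplier (\<lambda>x. f x * g x)"
  by (simp add: harmonic_multiplier_def mult.assoc)

text \<open>Every harmonic is an angular factor times a polynomial in the third coordinate, so by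
  linearity these products are the only test functions required.\<close>

lemma harmonic_multiplierI:
  assumes "\<And>k p. harmonic_span (\<lambda>x. f x * (angular k x * of_real (poly p (x$3))))"
  shows "harmonic_multiplier f"
  unfolding harmonic_multiplier_def
proof (intro allI impI)
  fix g assume "harmonic_span g"
  then obtain N c where g: "\<And>x. norm x = 1 \<Longrightarrow> g x = (\<Sum>i\<in>harmonic_index N. c i * harmonic i x)"
    by (auto simp: harmonic_span_def)
  have "harmonic_span (\<lambda>x. f x * harmonic i x)" if "i \<in> harmonic_index N" for i
  proof -
    obtain n k where i: "i = (n, k)" by (cases i)
    then have k: "\<bar>k\<bar> \<le> int n" using that by (simp add: mem_harmonic_index)
    obtain q where q: "\<And>t. norm_legendre n k t = sqrt (1 - t\<^sup>2) ^ nat \<bar>k\<bar> * poly q t"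
      using legendre_polynomial_part[OF k] by metis
    show ?thesis
      by (rule harmonic_span_cong[OF assms[of k q]]) (simp add: i harmonic_def Ylm_def angular_eq planar_def q)
  qed
  then have "harmonic_span (\<lambda>x. \<Sum>i\<in>I. c i * (f x * harmonic i x))" if "I \<subseteq> harmonic_index N" for I
    using that finite_subset[OF that finite_harmonic_index]
    by (induction I rule: infinite_finite_induct)
      (auto intro!: harmonic_span_zero harmonic_span_add harmonic_span_cmult)
  from harmonic_span_cong[OF this[OF order_refl]] show "harmonic_span (\<lambda>x. f x * g x)"
    by (simp add: g sum_distrib_left mult_ac)
qed

lemma planar_mult_cnj:
  assumes "norm x = 1"
  shows "planar x * cnj (planar x) = of_real (1 - (x$3)\<^sup>2)"
  using norm_vec3[of x] assms
  by (simp add: planar_def complex_eq_iff power2_eq_square algebra_simps)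

text \<open>Multiplication raises the angular order by one. For negative order it cancels a
  conjugate factor instead, and the modulus squared 1 - x_3^2 moves into the polynomial.\<close>

lemma harmonic_multiplier_planar: "harmonic_multiplier planar"
proof (rule harmonic_multiplierI)
  fix k p
  have "harmonic_span (\<lambda>x. angular (k + 1) x * of_real (poly (if k \<ge> 0 then p else [:1, 0, -1:] * p) (x$3)))"
    by (rule harmonic_span_angular)
  then show "harmonic_span (\<lambda>x. planar x * (angular k x * of_real (poly p (x$3))))"
  proof (rule harmonic_span_cong)
    fix x :: "real^3" assume x: "norm x = 1"
    show "planar x * (angular k x * of_real (poly p (x$3)))
      = angular (k + 1) x * of_real (poly (if k \<ge> 0 then p else [:1, 0, -1:] * p) (x$3))"
    proof (cases "k \<ge> 0")
      case True
      then show ?thesis by (simp add: angular_def nat_add_distrib)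
    next
      case False
      define m where "m = nat (- k - 1)"
      then have k: "k = - int m - 1" using False by simp
      have "planar x * angular k x = of_real (1 - (x$3)\<^sup>2) * angular (k + 1) x"
        using planar_mult_cnj[OF x] by (simp add: k angular_def nat_add_distrib flip: mult.assoc)
      then have "planar x * (angular k x * of_real (poly p (x$3)))
         = of_real (1 - (x$3)\<^sup>2) * angular (k + 1) x * of_real (poly p (x$3))"
        by (simp only: mult.assoc[symmetric])
      then show ?thesis using False by (simp add: power2_eq_square algebra_simps)
    qed
  qed
qed

lemma harmonic_multiplier_cnj_planar: "harmonic_multiplier (\<lambda>x. cnj (planar x))"
proof (rule harmonic_multiplierI)
  fix k p
  have "harmonic_span (\<lambda>x. angular (k - 1) x * of_real (poly (if k \<le> 0 then p else [:1, 0, -1:] * p) (x$3)))"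
    by (rule harmonic_span_angular)
  then show "harmonic_span (\<lambda>x. cnj (planar x) * (angular k x * of_real (poly p (x$3))))"
  proof (rule harmonic_span_cong)
    fix x :: "real^3" assume x: "norm x = 1"
    show "cnj (planar x) * (angular k x * of_real (poly p (x$3)))
      = angular (k - 1) x * of_real (poly (if k \<le> 0 then p else [:1, 0, -1:] * p) (x$3))"
    proof (cases "k \<le> 0")
      case True
      define m where "m = nat (- k)"
      then have "k = - int m" using True by simp
      then show ?thesis by (simp add: angular_def nat_add_distrib)
    next
      case False
      define m where "m = nat (k - 1)"
      then have k: "k = int m + 1" using False by simp
      have "cnj (planar x) * angular k x = of_real (1 - (x$3)\<^sup>2) * angular (k - 1) x"
        using planar_mult_cnj[OF x] by (simp add: k angular_def nat_add_distrib mult.commute flip: mult.assoc)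
      then have "cnj (planar x) * (angular k x * of_real (poly p (x$3)))
         = of_real (1 - (x$3)\<^sup>2) * angular (k - 1) x * of_real (poly p (x$3))"
        by (simp only: mult.assoc[symmetric])
      then show ?thesis using False by (simp add: power2_eq_square algebra_simps)
    qed
  qed
qed

lemma harmonic_multiplier_coordinate: "harmonic_multiplier (\<lambda>x. of_real (x $ i))"
proof -
  have "harmonic_multiplier (\<lambda>x. of_real (x $ 3))"
  proof (rule harmonic_multiplierI)
    fix k p
    show "harmonic_span (\<lambda>x. of_real (x$3) * (angular k x * of_real (poly p (x$3))))"
      by (rule harmonic_span_cong[OF harmonic_span_angular[of k "[:0, 1:] * p"]]) simp
  qed
  moreover have "harmonic_multiplier (\<lambda>x. (1 / 2) * (planar x + cnj (planar x)))"
    by (intro harmonic_multiplier_cmult harmonic_multiplier_add harmonic_multiplier_planar harmonic_multiplier_cnj_planar)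
  moreover have "harmonic_multiplier (\<lambda>x. (- \<i> / 2) * (planar x + (- 1) * cnj (planar x)))"
    by (intro harmonic_multiplier_cmult harmonic_multiplier_add harmonic_multiplier_planar harmonic_multiplier_cnj_planar)
  moreover have "(1 / 2) * (planar x + cnj (planar x)) = of_real (x $ 1)"
    "(- \<i> / 2) * (planar x + (- 1) * cnj (planar x)) = of_real (x $ 2)" for x
    by (simp_all add: planar_def complex_eq_iff)
  ultimately show ?thesis
    using exhaust_3[of i] by auto
qed

lemma harmonic_multiplier_polynomial:
  "real_polynomial_function f \<Longrightarrow> harmonic_multiplier (\<lambda>x. of_real (f x))"
proof (induction rule: real_polynomial_function.induct)
  case (linear f)
  then interpret bounded_linear f .
  have "x = (x $ 1) *\<^sub>R axis 1 1 + (x $ 2) *\<^sub>R axis 2 1 + (x $ 3) *\<^sub>R axis 3 1" for x :: "real^3"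
    by (simp add: vec_eq_iff forall_3 axis_def)
  then have "f x = f (axis 1 1) * x $ 1 + f (axis 2 1) * x $ 2 + f (axis 3 1) * x $ 3" for x
    by (metis add scaleR real_scaleR_def mult.commute)
  then have "(\<lambda>x. complex_of_real (f x)) = (\<lambda>x. of_real (f (axis 1 1)) * of_real (x $ 1)
      + of_real (f (axis 2 1)) * of_real (x $ 2) + of_real (f (axis 3 1)) * of_real (x $ 3))"
    by (intro ext) (metis of_real_add of_real_mult)
  then show ?case
    by (simp only: harmonic_multiplier_add harmonic_multiplier_cmult harmonic_multiplier_coordinate)
next
  case (const c)
  show ?case
    by (simp add: harmonic_multiplier_def harmonic_span_cmult)
next
  case (add f g)
  then show ?case by (simp add: harmonic_multiplier_add)
next
  case (mult f g)
  then show ?case by (simp add: harmonic_multiplier_mult)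
qed

lemma Ylm_0_0: "Ylm 0 0 x = of_real (1 / sqrt (4 * pi))"
  by (simp add: Ylm_def norm_legendre_def assoc_legendre_def real_sqrt_divide)

text \<open>The constant function 1 is sqrt(4 pi) Y_0^0; a multiplier of the span applied to it
  stays in the span.\<close>

lemma harmonic_span_polynomial:
  fixes p :: "real^3 \<Rightarrow> complex"
  assumes "polynomial_function p"
  shows "harmonic_span p"
proof -
  have "real_polynomial_function (Re \<circ> p)" "real_polynomial_function (Im \<circ> p)"
    using assms bounded_linear_Re bounded_linear_Im unfolding polynomial_function_def by blast+
  then have "harmonic_multiplier (\<lambda>x. of_real ((Re \<circ> p) x) + \<i> * of_real ((Im \<circ> p) x))"
    by (intro harmonic_multiplier_add harmonic_multiplier_cmult harmonic_multiplier_polynomial)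
  moreover have "harmonic_span (\<lambda>x. of_real (sqrt (4 * pi)) * Ylm 0 0 x)"
    by (intro harmonic_span_cmult harmonic_span_Ylm) simp
  ultimately have "harmonic_span (\<lambda>x. (of_real ((Re \<circ> p) x) + \<i> * of_real ((Im \<circ> p) x)) * (of_real (sqrt (4 * pi)) * Ylm 0 0 x))"
    unfolding harmonic_multiplier_def by blast
  then show ?thesis
    by (rule harmonic_span_cong) (simp add: Ylm_0_0 complex_eq_iff)
qed

section \<open>Fourier expansion of square integrable functions\<close>

lemma continuous_approx_harmonic:
  fixes g :: "real^3 \<Rightarrow> complex"
  assumes "continuous_on (sphere 0 1) g" "\<delta> > 0"
  obtains N c where "\<And>x. norm x = 1 \<Longrightarrow> cmod (g x - (\<Sum>i\<in>harmonic_index N. c i * harmonic i x)) < \<delta>"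
proof -
  obtain p where p: "polynomial_function p" "\<forall>x\<in>sphere 0 1. cmod (g x - p x) < \<delta>"
    using Stone_Weierstrass_polynomial_function[OF compact_sphere assms] by blast
  from harmonic_span_polynomial[OF p(1)] obtain N c
    where "\<And>x. norm x = 1 \<Longrightarrow> p x = (\<Sum>i\<in>harmonic_index N. c i * harmonic i x)"
    by (auto simp: harmonic_span_def)
  then show ?thesis using p(2) by (intro that[of c N]) auto
qed

lemma L2_harmonic: "L2 sphere_measure (harmonic i)"
  by (simp add: harmonic_def L2_harmoniclm)

lemma harmonic_orthonormal:
  "i \<in> harmonic_index N \<Longrightarrow> j \<in> harmonic_index N \<Longrightarrow> l2_inner sphere_measure (harmonic i) (harmonic j) = (if i = j then 1 else 0)"
  unfolding harmonic_def using Ylm_orthonormal[of "snd i" "fst i" "snd j" "fst j"]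
  by (auto simp: harmonic_index_def prod_eq_iff abs_le_iff)

lemma harmonic_square_error:
  assumes "L2 sphere_measure f"
  shows "(\<integral>x. (cmod (f x - (\<Sum>i\<in>harmonic_index N. c i * harmonic i x)))\<^sup>2 \<partial>sphere_measure) =
     (\<integral>x. (cmod (f x))\<^sup>2 \<partial>sphere_measure)
     - (\<Sum>i\<in>harmonic_index N. (cmod (l2_inner sphere_measure f (harmonic i)))\<^sup>2)
     + (\<Sum>i\<in>harmonic_index N. (cmod (c i - l2_inner sphere_measure f (harmonic i)))\<^sup>2)"
  by (rule orthonormal_square_error) (rule finite_harmonic_index L2_harmonic assms harmonic_orthonormal | assumption)+

text \<open>Continuous approximation in L2 and uniform approximation by harmonics give some good
  finite combination; by the best-approximation property the Fourier sums of at least that degree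
  are no worse.\<close>

lemma harmonic_expansion:
  assumes f: "L2 sphere_measure f"
  shows "(\<lambda>N. \<integral>x. (cmod (f x - (\<Sum>i\<in>harmonic_index N. l2_inner sphere_measure f (harmonic i) * harmonic i x)))\<^sup>2 \<partial>sphere_measure)
    \<longlonglongrightarrow> 0"
proof (rule LIMSEQ_I)
  fix \<epsilon> :: real assume "\<epsilon> > 0"
  define V where "V = measure sphere_measure UNIV"
  \<comment> \<open>A uniform error \<open>\<delta>\<close> has squared L2 norm at most
    \<open>\<delta>\<^sup>2 * V\<close>, hence at most a quarter of the target. The summand 1 keeps
    the denominator positive.\<close>
  define \<delta> where "\<delta> = sqrt (\<epsilon> / (4 * (V + 1)))"
  have V: "V \<ge> 0" by (simp add: V_def)
  have \<delta>: "\<delta> > 0" "\<delta>\<^sup>2 = \<epsilon> / (4 * (V + 1))"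
    using \<open>\<epsilon> > 0\<close> V by (auto simp: \<delta>_def)
  have "cont_approx sphere_measure f"
    by (rule L2_imp_cont_approx) (auto intro: f sphere.finite_measure_axioms)
  then obtain g where g: "continuous_on UNIV g" "L2 sphere_measure g"
    "(\<integral>x. (cmod (f x - g x))\<^sup>2 \<partial>sphere_measure) < \<epsilon> / 4"
    using \<open>\<epsilon> > 0\<close> unfolding cont_approx_def by (elim conjE allE[of _ "\<epsilon> / 4"]) auto
  obtain N c where c: "\<And>x. norm x = 1 \<Longrightarrow> cmod (g x - (\<Sum>i\<in>harmonic_index N. c i * harmonic i x)) < \<delta>"
    using continuous_approx_harmonic[OF continuous_on_subset[OF g(1) subset_UNIV] \<delta>(1)] by metis
  define h where "h x = (\<Sum>i\<in>harmonic_index N. c i * harmonic i x)" for x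
  have h: "L2 sphere_measure h"
    unfolding h_def[abs_def] by (intro L2_sum L2_cmult L2_harmonic)
  have "(\<integral>x. (cmod (g x - h x))\<^sup>2 \<partial>sphere_measure) \<le> (\<integral>x. \<delta>\<^sup>2 \<partial>sphere_measure)"
  proof (rule integral_mono_AE)
    show "integrable sphere_measure (\<lambda>x. (cmod (g x - h x))\<^sup>2)"
      by (intro L2_integrable L2_diff g h)
    show "AE x in sphere_measure. (cmod (g x - h x))\<^sup>2 \<le> \<delta>\<^sup>2"
      using AE_sphere
    proof eventually_elim
      case (elim x)
      then show ?case unfolding h_def by (intro power_mono less_imp_le[OF c]) auto
    qed
  qed auto
  also have "\<dots> = \<epsilon> / 4 * (V / (V + 1))"
    by (simp add: V_def \<delta>(2))
  also have "\<dots> \<le> \<epsilon> / 4 * 1"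
    using V \<open>\<epsilon> > 0\<close> by (intro mult_left_mono) auto
  finally have gh: "(\<integral>x. (cmod (g x - h x))\<^sup>2 \<partial>sphere_measure) \<le> \<epsilon> / 4" by simp
  have "(\<integral>x. (cmod (f x - g x + (g x - h x)))\<^sup>2 \<partial>sphere_measure)
      \<le> 2 * (\<integral>x. (cmod (f x - g x))\<^sup>2 \<partial>sphere_measure) + 2 * (\<integral>x. (cmod (g x - h x))\<^sup>2 \<partial>sphere_measure)"
    by (intro integral_cmod_square_add_le L2_diff f g h)
  then have fh: "(\<integral>x. (cmod (f x - h x))\<^sup>2 \<partial>sphere_measure) < \<epsilon>"
    using g(3) gh by simp
  show "\<exists>N0. \<forall>N\<ge>N0. norm ((\<integral>x. (cmod (f x - (\<Sum>i\<in>harmonic_index N. l2_inner sphere_measure f (harmonic i) * harmonic i x)))\<^sup>2 \<partial>sphere_measure) - 0) < \<epsilon>"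
  proof (intro exI[of _ N] allI impI)
    fix M assume "N \<le> M"
    let ?a = "\<lambda>i. (cmod (l2_inner sphere_measure f (harmonic i)))\<^sup>2"
    have "(\<integral>x. (cmod (f x - (\<Sum>i\<in>harmonic_index M. l2_inner sphere_measure f (harmonic i) * harmonic i x)))\<^sup>2 \<partial>sphere_measure)
      = (\<integral>x. (cmod (f x))\<^sup>2 \<partial>sphere_measure) - sum ?a (harmonic_index M)"
      by (simp add: harmonic_square_error[OF f])
    also have "\<dots> \<le> (\<integral>x. (cmod (f x))\<^sup>2 \<partial>sphere_measure) - sum ?a (harmonic_index N)"
      using harmonic_index_mono[OF \<open>N \<le> M\<close>] by (intro diff_left_mono sum_mono2) auto
    \<comment> \<open>Any other coefficients only add the nonnegative last sum of the error
      formula.\<close>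
    also have "\<dots> \<le> (\<integral>x. (cmod (f x - h x))\<^sup>2 \<partial>sphere_measure)"
      unfolding h_def harmonic_square_error[OF f] by (simp add: sum_nonneg)
    also note fh
    finally show "norm ((\<integral>x. (cmod (f x - (\<Sum>i\<in>harmonic_index M. l2_inner sphere_measure f (harmonic i) * harmonic i x)))\<^sup>2 \<partial>sphere_measure) - 0) < \<epsilon>"
      by simp
  qed
qed

section \<open>Measure and Wigner functions on the rotation group\<close>

abbreviation "euler_measure \<equiv> phi_measure \<Otimes>\<^sub>M (theta_measure \<Otimes>\<^sub>M phi_measure)"

interpretation theta_phi: pair_sigma_finite theta_measure phi_measure ..

interpretation theta_phi: finite_measure "theta_measure \<Otimes>\<^sub>M phi_measure"
  by (intro finite_measure_pair_measure interval.finite_measure_axioms theta.finite_measure_axioms)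

interpretation euler: pair_sigma_finite phi_measure "theta_measure \<Otimes>\<^sub>M phi_measure" ..

interpretation euler: finite_measure euler_measure
  by (intro finite_measure_pair_measure interval.finite_measure_axioms theta_phi.finite_measure_axioms)

lemma sets_euler_measure: "sets euler_measure = sets borel"
proof -
  have "sets euler_measure = sets (borel \<Otimes>\<^sub>M (borel \<Otimes>\<^sub>M borel))"
    by (intro sets_pair_measure_cong) simp_all
  then show ?thesis by (simp only: borel_prod)
qed

lemma euler_measure_eq:
  "euler_measure = density lborel (\<lambda>p::real \<times> real \<times> real.
     indicator ({0..2*pi} \<times> {0..pi} \<times> {0..2*pi}) p * ennreal (sin (fst (snd p))))"
proof -
  have 1: "theta_measure \<Otimes>\<^sub>M phi_measure = density (lborel \<Otimes>\<^sub>M lborel)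
      (\<lambda>(\<theta>, \<phi>). ennreal (indicator {0..pi} \<theta> * sin \<theta>) * ennreal (indicator {0..2 * pi} \<phi>))"
    unfolding interval_measure_def theta_measure_def
    by (rule pair_measure_density)
      (auto simp flip: interval_measure_def intro: interval.sigma_finite_measure_axioms lborel.sigma_finite_measure_axioms)
  have 2: "sigma_finite_measure (density (lborel \<Otimes>\<^sub>M lborel)
      (\<lambda>(\<theta>, \<phi>). ennreal (indicator {0..pi} \<theta> * sin \<theta>) * ennreal (indicator {0..2 * pi} \<phi>)))"
    unfolding 1[symmetric] by (rule theta_phi.sigma_finite_measure_axioms)
  have "euler_measure = density (lborel \<Otimes>\<^sub>M (lborel \<Otimes>\<^sub>M lborel)) (\<lambda>(\<alpha>, p). ennreal (indicator {0..2 * pi} \<alpha>) *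
      (case p of (\<theta>, \<phi>) \<Rightarrow> ennreal (indicator {0..pi} \<theta> * sin \<theta>) * ennreal (indicator {0..2 * pi} \<phi>)))"
    unfolding 1 unfolding interval_measure_def
    by (rule pair_measure_density) (auto intro: 2 lborel_pair.sigma_finite_measure_axioms)
  also have "(\<lambda>(\<alpha>, p). ennreal (indicator {0..2 * pi} \<alpha>) *
      (case p of (\<theta>, \<phi>) \<Rightarrow> ennreal (indicator {0..pi} \<theta> * sin \<theta>) * ennreal (indicator {0..2 * pi} \<phi>)))
    = (\<lambda>p. indicator ({0..2*pi} \<times> {0..pi} \<times> {0..2*pi}) p * ennreal (sin (fst (snd p))))"
    by (auto simp: fun_eq_iff indicator_def)
  finally show ?thesis by (simp add: lborel_prod)
qed

lemma continuous_on_matrix_mult [continuous_intros]: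
  fixes A :: "'a::topological_space \<Rightarrow> real^'n^'m" and B :: "'a \<Rightarrow> real^'k^'n"
  assumes "continuous_on S A" "continuous_on S B"
  shows "continuous_on S (\<lambda>x. A x ** B x)"
  unfolding matrix_matrix_mult_def by (intro continuous_intros assms)

lemma continuous_on_matrix_vector_mult [continuous_intros]:
  fixes A :: "'a::topological_space \<Rightarrow> real^'n^'m" and v :: "'a \<Rightarrow> real^'n"
  assumes "continuous_on S A" "continuous_on S v"
  shows "continuous_on S (\<lambda>x. A x *v v x)"
  unfolding matrix_vector_mult_def by (intro continuous_intros assms)

lemma continuous_on_transpose [continuous_intros]:
  fixes A :: "'a::topological_space \<Rightarrow> real^'n^'m"
  assumes "continuous_on S A"
  shows "continuous_on S (\<lambda>x. transpose (A x))"
  unfolding transpose_def by (intro continuous_intros assms)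

lemma continuous_Qrot: "continuous_on UNIV (\<lambda>p. Qrot (fst p) (fst (snd p)) (snd (snd p)))"
  unfolding Qrot_def R3_def R2_def by (intro continuous_intros)

lemma measurable_Qrot [measurable]: "(\<lambda>p. Qrot (fst p) (fst (snd p)) (snd (snd p))) \<in> borel_measurable euler_measure"
  using borel_measurable_continuous_onI[OF continuous_Qrot]
  by (simp add: measurable_cong_sets[OF sets_euler_measure refl])

lemma so3_measure_eq: "so3_measure = distr euler_measure borel (\<lambda>p. Qrot (fst p) (fst (snd p)) (snd (snd p)))"
  by (simp add: so3_measure_def euler_measure_eq)

lemma sets_so3_measure [measurable_cong, simp]: "sets so3_measure = sets borel"
  by (simp add: so3_measure_eq)

lemma space_so3_measure [simp]: "space so3_measure = UNIV"
  by (simp add: so3_measure_eq)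

interpretation so3: finite_measure so3_measure
  unfolding so3_measure_eq by (rule euler.finite_measure_distr) measurable

lemma AE_theta_phi: "AE p in theta_measure \<Otimes>\<^sub>M phi_measure. 0 < fst p \<and> fst p < pi"
proof (rule theta_phi.AE_pair_measure)
  show "{p \<in> space (theta_measure \<Otimes>\<^sub>M phi_measure). 0 < fst p \<and> fst p < pi} \<in> sets (theta_measure \<Otimes>\<^sub>M phi_measure)"
    by measurable
  show "AE x in theta_measure. AE y in phi_measure. 0 < fst (x, y) \<and> fst (x, y) < pi"
    using AE_theta by eventually_elim simp
qed

lemma AE_euler: "AE p in euler_measure. 0 < fst (snd p) \<and> fst (snd p) < pi"
proof (rule euler.AE_pair_measure)
  show "{p \<in> space euler_measure. 0 < fst (snd p) \<and> fst (snd p) < pi} \<in> sets euler_measure"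
    by measurable
  show "AE x in phi_measure. AE y in theta_measure \<Otimes>\<^sub>M phi_measure. 0 < fst (snd (x, y)) \<and> fst (snd (x, y)) < pi"
    using AE_theta_phi by simp
qed

section \<open>Orthogonality of the Wigner D-functions\<close>

lemma wigner_D_orthogonal:
  assumes "\<bar>j\<bar> \<le> int n" "\<bar>k\<bar> \<le> int n" "\<bar>j'\<bar> \<le> int n'" "\<bar>k'\<bar> \<le> int n'"
  shows "has_bochner_integral euler_measure
    (\<lambda>p. wigner_D n j k (fst p) (fst (snd p)) (snd (snd p)) * cnj (wigner_D n' j' k' (fst p) (fst (snd p)) (snd (snd p))))
    (if n = n' \<and> j = j' \<and> k = k' then of_real (8 * pi\<^sup>2 / (2 * real n + 1)) else 0)"
proof -
  define d where "d n j k \<theta> = complex_of_real (wigner_d n j k (cos \<theta>))" for n j k \<theta>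
  have [measurable]: "complex_of_real \<in> borel_measurable borel"
    by (intro borel_measurable_continuous_onI continuous_intros)
  have "L2 theta_measure (d n j k)" if "\<bar>j\<bar> \<le> int n" "\<bar>k\<bar> \<le> int n" for n j k
    using wigner_d_orthogonal[of j n k n] that
    by (simp add: L2_def d_def[abs_def] has_bochner_integral_iff power2_eq_square)
  then have "integrable theta_measure (\<lambda>\<theta>. d n j k \<theta> * cnj (d n' j' k' \<theta>))"
    using assms by (intro L2_integrable_inner)
  \<comment> \<open>The value of \<open>X\<close> is known only when j = j' and k = k'; otherwise
    one of the two angular integrals is zero and existence of the integral is enough.\<close>
  then obtain X where X: "has_bochner_integral theta_measure (\<lambda>\<theta>. d n j k \<theta> * d n' j' k' \<theta>) X"
    by (auto simp: d_def has_bochner_integral_iff)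
  have hb: "has_bochner_integral euler_measure
     (\<lambda>p. cis (of_int (j' - j) * fst p) * ((d n j k (fst (snd p)) * d n' j' k' (fst (snd p))) * cis (of_int (k' - k) * snd (snd p))))
     ((if j' - j = 0 then of_real (2 * pi) else 0) * (X * (if k' - k = 0 then of_real (2 * pi) else 0)))"
    by (intro has_bochner_integral_pair_mult[where f = "\<lambda>\<phi>. cis (of_int (j' - j) * \<phi>)"
          and g = "\<lambda>q. (d n j k (fst q) * d n' j' k' (fst q)) * cis (of_int (k' - k) * snd q)"]
        has_bochner_integral_pair_mult[where f = "\<lambda>\<theta>. d n j k \<theta> * d n' j' k' \<theta>" and g = "\<lambda>\<phi>. cis (of_int (k' - k) * \<phi>)"]
        integral_cis X interval.sigma_finite_measure_axioms theta.sigma_finite_measure_axioms theta_phi.sigma_finite_measure_axioms)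
  have f: "wigner_D n j k \<alpha> \<beta> \<gamma> * cnj (wigner_D n' j' k' \<alpha> \<beta> \<gamma>)
     = cis (of_int (j' - j) * \<alpha>) * ((d n j k \<beta> * d n' j' k' \<beta>) * cis (of_int (k' - k) * \<gamma>))" for \<alpha> \<beta> \<gamma>
  proof -
    have "cis (of_int (j' - j) * \<alpha>) = cis (- of_int j * \<alpha>) * cnj (cis (- of_int j' * \<alpha>))"
      "cis (of_int (k' - k) * \<gamma>) = cis (- of_int k * \<gamma>) * cnj (cis (- of_int k' * \<gamma>))"
      by (simp_all add: cis_cnj cis_mult algebra_simps)
    then show ?thesis
      unfolding wigner_D_def d_def by simp
  qed
  have "(if j' - j = 0 then of_real (2 * pi) else 0) * (X * (if k' - k = 0 then of_real (2 * pi) else 0))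
    = (if n = n' \<and> j = j' \<and> k = k' then of_real (8 * pi\<^sup>2 / (2 * real n + 1)) else 0)"
  proof (cases "j = j' \<and> k = k'")
    case True
    then have "has_bochner_integral theta_measure (\<lambda>\<theta>. complex_of_real (wigner_d n j k (cos \<theta>) * wigner_d n' j k (cos \<theta>)))
       (of_real (if n = n' then 2 / (2 * real n + 1) else 0))"
      using assms by (intro has_bochner_integral_of_real wigner_d_orthogonal) auto
    then have "X = of_real (if n = n' then 2 / (2 * real n + 1) else 0)"
      using X True by (auto simp: d_def has_bochner_integral_iff)
    then show ?thesis using True by (auto simp: power2_eq_square)
  qed auto
  then show ?thesis using hb by (simp add: f)
qed

text \<open>Orthogonality to the constant function D_0^{0,0} = 1.\<close>

lemma integral_wigner_D:
  assumes "\<bar>j\<bar> \<le> int n" "\<bar>k\<bar> \<le> int n"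
  shows "has_bochner_integral euler_measure (\<lambda>p. wigner_D n j k (fst p) (fst (snd p)) (snd (snd p)))
    (if n = 0 \<and> j = 0 \<and> k = 0 then of_real (8 * pi\<^sup>2) else 0)"
proof -
  have "wigner_D 0 0 0 a b g = 1" for a b g
    by (simp add: wigner_D_def wigner_d_def)
  then show ?thesis
    using wigner_D_orthogonal[OF assms, of 0 0 0] by (auto cong: if_cong)
qed

lemma measurable_wigner_D [measurable]:
  "(\<lambda>p. wigner_D n j k (fst p) (fst (snd p)) (snd (snd p))) \<in> borel_measurable euler_measure"
proof -
  have [measurable]: "cis \<in> borel_measurable borel" "complex_of_real \<in> borel_measurable borel"
    by (intro borel_measurable_continuous_onI continuous_intros)+
  show ?thesis unfolding wigner_D_def by measurable
qed

section \<open>Transport of the measure from SO(3) to the sphere\<close>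

definition arc_average :: "real \<Rightarrow> (real^3) measure" where
  "arc_average \<phi> = distr so3_measure borel (\<lambda>Q. transpose Q *v e_vec \<phi>)"

lemma continuous_action: "continuous_on UNIV (\<lambda>p::(real^3^3) \<times> real. transpose (fst p) *v e_vec (snd p))"
  unfolding e_vec_def by (intro continuous_intros)

lemma measurable_action [measurable]:
  "(\<lambda>p. transpose (fst p) *v e_vec (snd p)) \<in> (borel :: (real^3^3) measure) \<Otimes>\<^sub>M borel \<rightarrow>\<^sub>M borel"
  unfolding borel_prod by (intro borel_measurable_continuous_onI continuous_action)

lemma measurable_action_fst [measurable]: "(\<lambda>Q. transpose Q *v e_vec \<phi>) \<in> borel_measurable borel"
  by (intro borel_measurable_continuous_onI continuous_intros)

lemma integral_Ylm_sphere:
  assumes "\<bar>k\<bar> \<le> int n"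
  shows "has_bochner_integral sphere_measure (Ylm n k) (if n = 0 \<and> k = 0 then of_real (sqrt (4 * pi)) else 0)"
proof -
  have "l2_inner sphere_measure (Ylm n k) (Ylm 0 0) = of_real (1 / sqrt (4 * pi)) * integral\<^sup>L sphere_measure (Ylm n k)"
    by (simp add: l2_inner_def Ylm_0_0)
  then have "integral\<^sup>L sphere_measure (Ylm n k) = of_real (sqrt (4 * pi)) * l2_inner sphere_measure (Ylm n k) (Ylm 0 0)"
    by (simp flip: of_real_mult)
  then show ?thesis
    using Ylm_orthonormal[OF assms, of 0 0] sphere.L2_imp_integrable[OF L2_harmoniclm]
    by (simp add: has_bochner_integral_iff)
qed

text \<open>In the rotation formula only D_0^{0,0} has a nonzero integral. The value 8 pi^2 / sqrt(4
  pi) is written as 2 pi sqrt(4 pi) to match the surface integral of Y_0^0.\<close>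

lemma integral_Ylm_average:
  assumes k: "\<bar>k\<bar> \<le> int n"
  shows "has_bochner_integral (arc_average \<phi>) (Ylm n k) (complex_of_real (if n = 0 \<and> k = 0 then 2 * pi * sqrt (4 * pi) else 0))"
proof -
  have "has_bochner_integral euler_measure (\<lambda>p. \<Sum>j\<in>{- int n..int n}.
      wigner_D n j k (fst p) (fst (snd p)) (snd (snd p)) * (of_real (norm_legendre n j 0) * cis (of_int j * \<phi>)))
     (\<Sum>j\<in>{- int n..int n}. (if n = 0 \<and> j = 0 \<and> k = 0 then of_real (8 * pi\<^sup>2) else 0) * (of_real (norm_legendre n j 0) * cis (of_int j * \<phi>)))"
    using k by (intro has_bochner_integral_sum has_bochner_integral_mult_left integral_wigner_D) auto
  also have "(\<Sum>j\<in>{- int n..int n}. (if n = 0 \<and> j = 0 \<and> k = 0 then of_real (8 * pi\<^sup>2) else 0) * (of_real (norm_legendre n j 0) * cis (of_int j * \<phi>)))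
    = complex_of_real (if n = 0 \<and> k = 0 then 2 * pi * sqrt (4 * pi) else 0)"
  proof (cases "n = 0 \<and> k = 0")
    case True
    have "4 * pi / sqrt (4 * pi) = sqrt (4 * pi)"
      by (simp add: real_div_sqrt del: real_sqrt_mult)
    moreover have "8 * pi\<^sup>2 * norm_legendre 0 0 0 = 2 * pi * (4 * pi / sqrt (4 * pi))"
      by (simp add: norm_legendre_def assoc_legendre_def real_sqrt_divide power2_eq_square)
    ultimately have "8 * pi\<^sup>2 * norm_legendre 0 0 0 = 2 * pi * sqrt (4 * pi)"
      by simp
    then have "complex_of_real (8 * pi\<^sup>2) * of_real (norm_legendre 0 0 0) = of_real (2 * pi * sqrt (4 * pi))"
      by (simp only: of_real_mult[symmetric])
    then show ?thesis using True by simp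
  qed auto
  finally have hb: "has_bochner_integral euler_measure (\<lambda>p. \<Sum>j\<in>{- int n..int n}.
      wigner_D n j k (fst p) (fst (snd p)) (snd (snd p)) * (of_real (norm_legendre n j 0) * cis (of_int j * \<phi>)))
     (complex_of_real (if n = 0 \<and> k = 0 then 2 * pi * sqrt (4 * pi) else 0))" .
  have "has_bochner_integral euler_measure (\<lambda>p. Ylm n k (transpose (Qrot (fst p) (fst (snd p)) (snd (snd p))) *v e_vec \<phi>))
     (complex_of_real (if n = 0 \<and> k = 0 then 2 * pi * sqrt (4 * pi) else 0))"
  proof (rule has_bochner_integral_cong_AE[THEN iffD1, OF _ _ _ hb])
    show "AE p in euler_measure. (\<Sum>j\<in>{- int n..int n}.
      wigner_D n j k (fst p) (fst (snd p)) (snd (snd p)) * (of_real (norm_legendre n j 0) * cis (of_int j * \<phi>)))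
      = Ylm n k (transpose (Qrot (fst p) (fst (snd p)) (snd (snd p))) *v e_vec \<phi>)"
      using AE_euler by eventually_elim (simp add: Ylm_transpose_Qrot_e_vec k)
  qed measurable
  then show ?thesis
    unfolding arc_average_def so3_measure_eq by (intro has_bochner_integral_distr) measurable
qed

lemma sets_arc_average [measurable_cong, simp]: "sets (arc_average \<phi>) = sets borel"
  by (simp add: arc_average_def)

interpretation average: finite_measure "arc_average \<phi>" for \<phi>
  unfolding arc_average_def by (rule so3.finite_measure_distr) measurable

lemma AE_average: "AE x in arc_average \<phi>. norm x = 1"
proof -
  have "AE Q in so3_measure. norm (transpose Q *v e_vec \<phi>) = 1"
    unfolding so3_measure_eq by (subst AE_distr_iff) auto
  then show ?thesis
    unfolding arc_average_def by (subst AE_distr_iff) auto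
qed

lemma finite_sphere_scaled: "finite_measure (density sphere_measure (\<lambda>_. ennreal (2 * pi)))"
  by standard (simp add: emeasure_density_const sphere.emeasure_eq_measure ennreal_mult_eq_top_iff)

text \<open>Agreement on harmonics passes to continuous functions, since both measures are finite
  and concentrated on the sphere, where harmonics approximate uniformly: an error
  \<open>\<delta>\<close> changes the integrals by at most \<open>\<delta>\<close> times the total
  masses.\<close>

lemma arc_average_eq: "arc_average \<phi> = density sphere_measure (\<lambda>_. ennreal (2 * pi))"
proof (rule finite_borel_measure_eqI_continuous)
  let ?M = "arc_average \<phi>" and ?N = "density sphere_measure (\<lambda>_. ennreal (2 * pi))"
  interpret N: finite_measure ?N by (rule finite_sphere_scaled)
  show "finite_measure ?M" "finite_measure ?N" by (rule average.finite_measure_axioms N.finite_measure_axioms)+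
  show "sets ?M = sets borel" "sets ?N = sets borel" by simp_all
  have N1: "AE x in ?N. norm x = 1"
    using AE_sphere by (subst AE_density) auto
  fix g :: "real^3 \<Rightarrow> real" assume g: "continuous_on UNIV g" "\<And>x. 0 \<le> g x" "\<And>x. g x \<le> 1"
  define G where "G x = complex_of_real (g x)" for x
  have Gc: "continuous_on S G" for S
    unfolding G_def[abs_def] by (intro continuous_on_of_real continuous_on_subset[OF g(1)]) simp
  have [measurable]: "G \<in> borel_measurable borel"
    by (intro borel_measurable_continuous_onI Gc)
  have GM: "integrable ?M G"
    by (rule average.integrable_const_bound[where B = 1]) (auto simp: G_def g)
  have GN: "integrable ?N G"
    by (rule N.integrable_const_bound[where B = 1]) (auto simp: G_def g)
  have hN: "has_bochner_integral ?N (Ylm n k) (complex_of_real (if n = 0 \<and> k = 0 then 2 * pi * sqrt (4 * pi) else 0))"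
    if "\<bar>k\<bar> \<le> int n" for n k
  proof (rule has_bochner_integral_density)
    have "has_bochner_integral sphere_measure (\<lambda>x. complex_of_real (2 * pi) * Ylm n k x)
        (complex_of_real (2 * pi) * (if n = 0 \<and> k = 0 then of_real (sqrt (4 * pi)) else 0))"
      by (intro has_bochner_integral_mult_right integral_Ylm_sphere that)
    also have "complex_of_real (2 * pi) * (if n = 0 \<and> k = 0 then of_real (sqrt (4 * pi)) else 0)
        = complex_of_real (if n = 0 \<and> k = 0 then 2 * pi * sqrt (4 * pi) else 0)"
      by simp
    finally show "has_bochner_integral sphere_measure (\<lambda>x. (2 * pi) *\<^sub>R Ylm n k x)
        (complex_of_real (if n = 0 \<and> k = 0 then 2 * pi * sqrt (4 * pi) else 0))"
      by (simp only: scaleR_conv_of_real)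
  qed auto
  define V where "V = measure ?M (space ?M) + measure ?N (space ?N)"
  have V: "V \<ge> 0" by (simp add: V_def)
  have diff_le: "cmod (integral\<^sup>L ?M G - integral\<^sup>L ?N G) \<le> \<delta> * V" if \<delta>: "\<delta> > 0" for \<delta>
  proof -
    obtain N c where c: "\<And>x. norm x = 1 \<Longrightarrow> cmod (G x - (\<Sum>i\<in>harmonic_index N. c i * harmonic i x)) < \<delta>"
      using continuous_approx_harmonic[OF Gc \<delta>] by metis
    define h where "h x = (\<Sum>i\<in>harmonic_index N. c i * harmonic i x)" for x
    define I where "I = (\<Sum>i\<in>harmonic_index N. c i * (complex_of_real (if fst i = 0 \<and> snd i = 0 then 2 * pi * sqrt (4 * pi) else 0)))"
    have hM: "has_bochner_integral ?M h I"
      unfolding h_def[abs_def] I_def harmonic_def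
      by (intro has_bochner_integral_sum has_bochner_integral_mult_right integral_Ylm_average) (auto simp: harmonic_index_def)
    have hN: "has_bochner_integral ?N h I"
      unfolding h_def[abs_def] I_def harmonic_def
      by (intro has_bochner_integral_sum has_bochner_integral_mult_right hN) (auto simp: harmonic_index_def)
    have bound: "cmod (integral\<^sup>L L G - integral\<^sup>L L h) \<le> \<delta> * measure L (space L)"
      if "finite_measure L" "AE x in L. norm x = 1" "integrable L G" "integrable L h" for L
    proof -
      interpret L: finite_measure L by fact
      have "cmod (integral\<^sup>L L G - integral\<^sup>L L h) = cmod (\<integral>x. G x - h x \<partial>L)"
        using that by simp
      also have "\<dots> \<le> (\<integral>x. cmod (G x - h x) \<partial>L)"
        by (rule integral_norm_bound)
      also have "\<dots> \<le> (\<integral>x. \<delta> \<partial>L)"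
      proof (rule integral_mono_AE)
        show "AE x in L. cmod (G x - h x) \<le> \<delta>"
          using that(2)
        proof eventually_elim
          case (elim x)
          from c[OF elim] show ?case by (simp add: h_def)
        qed
      qed (use that in auto)
      finally show ?thesis by (simp add: mult.commute)
    qed
    have "cmod (integral\<^sup>L ?M G - I) \<le> \<delta> * measure ?M (space ?M)"
      using bound[OF average.finite_measure_axioms AE_average GM] hM by (simp add: has_bochner_integral_iff)
    moreover have "cmod (integral\<^sup>L ?N G - I) \<le> \<delta> * measure ?N (space ?N)"
      using bound[OF N.finite_measure_axioms N1 GN] hN by (simp add: has_bochner_integral_iff)
    moreover have "cmod (integral\<^sup>L ?M G - integral\<^sup>L ?N G) \<le> cmod (integral\<^sup>L ?M G - I) + cmod (integral\<^sup>L ?N G - I)"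
      using norm_triangle_ineq4[of "integral\<^sup>L ?M G - I" "integral\<^sup>L ?N G - I"] by simp
    ultimately show ?thesis
      by (simp add: V_def distrib_left)
  qed
  have *: "cmod (integral\<^sup>L ?M G - integral\<^sup>L ?N G) \<le> \<epsilon>" if "\<epsilon> > 0" for \<epsilon>
  proof -
    have "cmod (integral\<^sup>L ?M G - integral\<^sup>L ?N G) \<le> \<epsilon> / (V + 1) * V"
      using that V by (intro diff_le) auto
    also have "\<dots> \<le> \<epsilon>"
      using that V by (simp add: divide_simps)
    finally show ?thesis .
  qed
  have "cmod (integral\<^sup>L ?M G - integral\<^sup>L ?N G) \<le> 0"
    by (rule field_le_epsilon) (use * in simp)
  then show "integral\<^sup>L ?M g = integral\<^sup>L ?N g"
    by (simp add: G_def[abs_def])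
qed

section \<open>Singular value decomposition of the arc transform\<close>

lemma coeff_even_trinomial:
  assumes "i \<le> n"
  shows "coeff ([:a, 0, b:] ^ n) (2 * i) = of_nat (n choose i) * b ^ i * (a :: real) ^ (n - i)"
proof -
  have "[:a, 0, b:] = monom b 2 + [:a:]"
    by (simp add: monom_altdef numeral_2_eq_2)
  also have "coeff (\<dots> ^ n) (2 * i) = (\<Sum>k\<le>n. a ^ (n - k) * of_nat (n choose k) * (if k = i then b ^ k else 0))"
    by (subst binomial_ring) (simp add: coeff_sum of_nat_poly monom_power poly_const_pow mult_ac)
  also have "\<dots> = (\<Sum>k\<in>{i}. a ^ (n - i) * b ^ i * of_nat (n choose k))"
    using assms by (intro sum.mono_neutral_cong_right) (auto simp: mult_ac)
  finally show ?thesis by (simp add: mult_ac)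
qed

text \<open>On the equator the trinomial is (z^2 - 1) / 2, whose n-th power has nonzero coefficients
  at the even exponents up to 2 n.\<close>

lemma norm_legendre_0_nonzero:
  assumes "\<bar>k\<bar> \<le> int n" "even (int n - k)"
  shows "norm_legendre n k 0 \<noteq> 0"
proof -
  obtain m where m: "m \<le> 2 * n" "k = int n - int m"
    using assms(1) by (elim nat_index_of_int)
  then have "even m" using assms(2) by simp
  then obtain i where i: "m = 2 * i" by (elim evenE)
  have "coeff ([:- sqrt (1 - 0\<^sup>2) / 2, 0, sqrt (1 - 0\<^sup>2) / 2:] ^ n) m \<noteq> 0"
    using m(1) coeff_even_trinomial[of i n "- 1 / 2" "1 / 2"] by (simp add: i)
  moreover have "wnorm (2 * n) m n \<noteq> 0" by (simp add: wnorm_def)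
  moreover have "sqrt ((2 * real n + 1) / (4 * pi)) \<noteq> 0"
    using add_nonneg_pos[of "2 * real n" 1] by simp
  ultimately show ?thesis
    unfolding m(2) by (subst norm_legendre_eq_coeff[OF m(1)]) simp_all
qed

lemma mu_square: "(mu n \<psi>)\<^sup>2 = (\<Sum>j\<in>{-int n..int n}. 8 * pi\<^sup>2 / (2 * real n + 1) * \<bar>norm_legendre n j 0\<bar>\<^sup>2 * (s_fun j \<psi>)\<^sup>2)"
  unfolding mu_def by (intro real_sqrt_pow2 sum_nonneg) auto

lemma mu_pos:
  assumes "0 < \<psi>" "\<psi> < pi"
  shows "mu n \<psi> > 0"
proof -
  \<comment> \<open>The smallest nonnegative order of the same parity as n. One positive summand
    suffices, and the remaining factor 2 psi or 2 sin psi is positive on (0, pi).\<close>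
  define j :: int where "j = (if even n then 0 else 1)"
  have j: "\<bar>j\<bar> \<le> int n" "even (int n - j)"
    by (auto simp: j_def elim: oddE)
  have "sin \<psi> > 0" using assms by (intro sin_gt_zero)
  then have s: "s_fun j \<psi> \<noteq> 0" using assms by (auto simp: j_def s_fun_def)
  have "0 < (\<Sum>j\<in>{-int n..int n}. 8 * pi\<^sup>2 / (2 * real n + 1) * \<bar>norm_legendre n j 0\<bar>\<^sup>2 * (s_fun j \<psi>)\<^sup>2)"
  proof (rule sum_pos2[of _ j])
    have "(0::real) < 2 * real n + 1" by (simp add: add_nonneg_pos)
    then show "0 < 8 * pi\<^sup>2 / (2 * real n + 1) * \<bar>norm_legendre n j 0\<bar>\<^sup>2 * (s_fun j \<psi>)\<^sup>2"
      using norm_legendre_0_nonzero[OF j] s by (intro mult_pos_pos divide_pos_pos) auto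
  qed (use j in auto)
  then show ?thesis by (simp add: mu_def)
qed

section \<open>The arc transform on square integrable functions\<close>

lemma measurable_action_arc [measurable]:
  "(\<lambda>\<phi>. transpose Q *v e_vec \<phi>) \<in> borel_measurable borel"
  unfolding e_vec_def by (intro borel_measurable_continuous_onI continuous_intros)

lemma arc_transform_eq:
  assumes "0 < \<psi>" and [measurable]: "f \<in> borel_measurable borel"
  shows "arc_transform f Q \<psi> = (\<integral>\<phi>. f (transpose Q *v e_vec \<phi>) \<partial>interval_measure (- \<psi>) \<psi>)"
proof -
  have "arc_transform f Q \<psi> = (\<integral>\<phi>. indicator {- \<psi>..\<psi>} \<phi> *\<^sub>R f (transpose Q *v e_vec \<phi>) \<partial>lborel)"
    using assms(1) unfolding arc_transform_def by (subst interval_integral_Icc) (auto simp: set_lebesgue_integral_def)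
  then show ?thesis
    unfolding interval_measure_def by (subst integral_density) auto
qed

lemma measurable_arc_transform:
  assumes "0 < \<psi>" and [measurable]: "f \<in> borel_measurable borel"
  shows "(\<lambda>Q. arc_transform f Q \<psi>) \<in> borel_measurable borel"
proof -
  have [measurable]: "(\<lambda>p. transpose (fst p) *v e_vec (snd p)) \<in> (borel :: (real^3^3) measure) \<Otimes>\<^sub>M interval_measure (- \<psi>) \<psi> \<rightarrow>\<^sub>M borel"
    using measurable_action by (simp cong: measurable_cong_sets sets_pair_measure_cong)
  have "(\<lambda>Q. \<integral>\<phi>. f (transpose Q *v e_vec \<phi>) \<partial>interval_measure (- \<psi>) \<psi>) \<in> borel_measurable borel"
    by (rule interval.borel_measurable_lebesgue_integral)
      (use measurable_compose[OF _ assms(2)] in \<open>simp add: split_def\<close>)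
  then show ?thesis
    using assms by (simp add: arc_transform_eq)
qed

lemma integral_cis_arc:
  assumes "0 < \<psi>"
  shows "has_bochner_integral (interval_measure (- \<psi>) \<psi>) (\<lambda>\<phi>. cis (of_int j * \<phi>)) (of_real (s_fun j \<psi>))"
  using has_bochner_integral_cis[of "- \<psi>" \<psi> j] assms
  by (cases "j = 0") (simp_all add: s_fun_def complex_of_real_def)

lemma arc_transform_Ylm:
  assumes \<psi>: "0 < \<psi>" and k: "\<bar>k\<bar> \<le> int n" and b: "0 < b" "b < pi"
  shows "arc_transform (Ylm n k) (Qrot a b g) \<psi> =
    (\<Sum>j\<in>{-int n..int n}. complex_of_real (norm_legendre n j 0 * s_fun j \<psi>) * wigner_D n j k a b g)"
proof -
  have "has_bochner_integral (interval_measure (- \<psi>) \<psi>)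
    (\<lambda>\<phi>. \<Sum>j\<in>{- int n..int n}. wigner_D n j k a b g * (of_real (norm_legendre n j 0) * cis (of_int j * \<phi>)))
    (\<Sum>j\<in>{- int n..int n}. wigner_D n j k a b g * (of_real (norm_legendre n j 0) * of_real (s_fun j \<psi>)))"
    by (intro has_bochner_integral_sum has_bochner_integral_mult_right integral_cis_arc \<psi>)
  then show ?thesis
    using \<psi> by (simp add: arc_transform_eq Ylm_transpose_Qrot_e_vec[OF k b] has_bochner_integral_iff mult_ac)
qed

text \<open>Tonelli puts the SO(3) integral inside; for every fixed angle it is 2 pi times the
  surface integral, and the arc has length 2 psi.\<close>

lemma nn_integral_arc:
  assumes "0 < \<psi>" and [measurable]: "F \<in> borel_measurable borel"
  shows "(\<integral>\<^sup>+Q. (\<integral>\<^sup>+\<phi>. F (transpose Q *v e_vec \<phi>) \<partial>interval_measure (- \<psi>) \<psi>) \<partial>so3_measure)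
    = ennreal (4 * pi * \<psi>) * (\<integral>\<^sup>+x. F x \<partial>sphere_measure)"
proof -
  interpret pair_sigma_finite so3_measure "interval_measure (- \<psi>) \<psi>" ..
  have [measurable]: "(\<lambda>p. transpose (fst p) *v e_vec (snd p)) \<in> so3_measure \<Otimes>\<^sub>M interval_measure (- \<psi>) \<psi> \<rightarrow>\<^sub>M borel"
    using measurable_action by (simp cong: measurable_cong_sets sets_pair_measure_cong)
  have "(\<integral>\<^sup>+Q. (\<integral>\<^sup>+\<phi>. F (transpose Q *v e_vec \<phi>) \<partial>interval_measure (- \<psi>) \<psi>) \<partial>so3_measure)
     = (\<integral>\<^sup>+\<phi>. (\<integral>\<^sup>+Q. F (transpose Q *v e_vec \<phi>) \<partial>so3_measure) \<partial>interval_measure (- \<psi>) \<psi>)"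
    by (rule Fubini'[symmetric]) (use measurable_compose[OF _ assms(2)] in \<open>simp add: split_def\<close>)
  also have "\<dots> = (\<integral>\<^sup>+\<phi>. (\<integral>\<^sup>+x. F x \<partial>arc_average \<phi>) \<partial>interval_measure (- \<psi>) \<psi>)"
    unfolding arc_average_def by (simp add: nn_integral_distr)
  also have "\<dots> = ennreal (2 * pi) * (\<integral>\<^sup>+x. F x \<partial>sphere_measure) * ennreal (2 * \<psi>)"
    unfolding arc_average_eq using assms(1)
    by (simp add: nn_integral_density nn_integral_cmult emeasure_interval_measure)
  also have "\<dots> = ennreal (4 * pi * \<psi>) * (\<integral>\<^sup>+x. F x \<partial>sphere_measure)"
  proof -
    have "ennreal (2 * pi) * ennreal (2 * \<psi>) = ennreal (4 * pi * \<psi>)"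
      using assms(1) by (subst ennreal_mult[symmetric]) (auto simp: mult_ac)
    then show ?thesis by (metis mult.assoc mult.commute)
  qed
  finally show ?thesis .
qed

lemma L2_borel: "L2 sphere_measure f \<Longrightarrow> f \<in> borel_measurable borel"
  by (simp add: L2_def cong: measurable_cong_sets)

lemma nn_integral_cmod_square:
  "L2 M f \<Longrightarrow> (\<integral>\<^sup>+x. ennreal ((cmod (f x))\<^sup>2) \<partial>M) = ennreal (\<integral>x. (cmod (f x))\<^sup>2 \<partial>M)"
  by (intro nn_integral_eq_integral L2_integrable) auto

text \<open>A finite double integral has finite inner integrals almost everywhere. Hence the arc
  integral of an L2 function is meaningful, and later linear, for almost every rotation.\<close>

lemma AE_arc_L2:
  assumes \<psi>: "0 < \<psi>" and f: "L2 sphere_measure f"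
  shows "AE Q in so3_measure. L2 (interval_measure (- \<psi>) \<psi>) (\<lambda>\<phi>. f (transpose Q *v e_vec \<phi>))"
proof -
  note [measurable] = L2_borel[OF f]
  have [measurable]: "(\<lambda>p. transpose (fst p) *v e_vec (snd p)) \<in> so3_measure \<Otimes>\<^sub>M interval_measure (- \<psi>) \<psi> \<rightarrow>\<^sub>M borel"
    using measurable_action by (simp cong: measurable_cong_sets sets_pair_measure_cong)
  have m: "(\<lambda>x. ennreal ((cmod (f x))\<^sup>2)) \<in> borel_measurable borel" by measurable
  have "AE Q in so3_measure. (\<integral>\<^sup>+\<phi>. ennreal ((cmod (f (transpose Q *v e_vec \<phi>)))\<^sup>2) \<partial>interval_measure (- \<psi>) \<psi>) \<noteq> \<infinity>"
  proof (rule nn_integral_PInf_AE)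
    show "(\<lambda>Q. \<integral>\<^sup>+\<phi>. ennreal ((cmod (f (transpose Q *v e_vec \<phi>)))\<^sup>2) \<partial>interval_measure (- \<psi>) \<psi>) \<in> borel_measurable so3_measure"
      by (rule interval.borel_measurable_nn_integral) (use measurable_compose[OF _ m] in \<open>simp add: split_def\<close>)
    show "(\<integral>\<^sup>+Q. (\<integral>\<^sup>+\<phi>. ennreal ((cmod (f (transpose Q *v e_vec \<phi>)))\<^sup>2) \<partial>interval_measure (- \<psi>) \<psi>) \<partial>so3_measure) \<noteq> \<infinity>"
      by (subst nn_integral_arc[OF \<psi> m]) (simp add: nn_integral_cmod_square[OF f] ennreal_mult_eq_top_iff)
  qed
  then show ?thesis
  proof eventually_elim
    case (elim Q)
    then show ?case
      by (auto simp: L2_def integrable_iff_bounded less_top)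
  qed
qed

text \<open>Cauchy-Schwarz against the constant 1. A non-integrable function has integral 0 by
  convention, so measurability suffices and no exceptional set is carried along.\<close>

lemma (in finite_measure) norm_integral_square_le:
  fixes h :: "'a \<Rightarrow> complex"
  assumes [measurable]: "h \<in> borel_measurable M"
  shows "ennreal ((cmod (integral\<^sup>L M h))\<^sup>2) \<le> (\<integral>\<^sup>+x. ennreal ((cmod (h x))\<^sup>2) \<partial>M) * emeasure M (space M)"
proof (cases "integrable M h")
  case True
  have "ennreal ((cmod (integral\<^sup>L M h))\<^sup>2) = (ennreal (cmod (integral\<^sup>L M h)))\<^sup>2"
    by (simp add: ennreal_power)
  also have "\<dots> \<le> (\<integral>\<^sup>+x. ennreal (cmod (h x)) * 1 \<partial>M)\<^sup>2"
    using integral_norm_bound_ennreal[OF True] by (intro power_mono) auto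
  also have "\<dots> \<le> (\<integral>\<^sup>+x. (ennreal (cmod (h x)))\<^sup>2 \<partial>M) * (\<integral>\<^sup>+x. 1\<^sup>2 \<partial>M)"
    by (rule Cauchy_Schwarz_nn_integral) auto
  finally show ?thesis by (simp add: ennreal_power)
qed (simp add: not_integrable_integral_eq)

text \<open>Cauchy-Schwarz on each arc costs its length 2 psi, and averaging over rotations
  contributes 4 pi psi; together they give 8 pi psi^2.\<close>

lemma
  assumes \<psi>: "0 < \<psi>" and f: "L2 sphere_measure f"
  shows L2_arc_transform: "L2 so3_measure (\<lambda>Q. arc_transform f Q \<psi>)"
    and arc_transform_bounded: "(\<integral>Q. (cmod (arc_transform f Q \<psi>))\<^sup>2 \<partial>so3_measure)
      \<le> 8 * pi * \<psi>\<^sup>2 * (\<integral>x. (cmod (f x))\<^sup>2 \<partial>sphere_measure)"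
proof -
  note [measurable] = L2_borel[OF f] measurable_arc_transform[OF \<psi> L2_borel[OF f]]
  define S where "S = (\<integral>x. (cmod (f x))\<^sup>2 \<partial>sphere_measure)"
  have S: "S \<ge> 0" by (simp add: S_def)
  have [measurable]: "(\<lambda>p. transpose (fst p) *v e_vec (snd p)) \<in> so3_measure \<Otimes>\<^sub>M interval_measure (- \<psi>) \<psi> \<rightarrow>\<^sub>M borel"
    using measurable_action by (simp cong: measurable_cong_sets sets_pair_measure_cong)
  have m: "(\<lambda>x. ennreal ((cmod (f x))\<^sup>2)) \<in> borel_measurable borel" by measurable
  have m2 [measurable]: "(\<lambda>Q. \<integral>\<^sup>+\<phi>. ennreal ((cmod (f (transpose Q *v e_vec \<phi>)))\<^sup>2) \<partial>interval_measure (- \<psi>) \<psi>) \<in> borel_measurable so3_measure"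
    by (rule interval.borel_measurable_nn_integral) (use measurable_compose[OF _ m] in \<open>simp add: split_def\<close>)
  have "(\<integral>\<^sup>+Q. ennreal ((cmod (arc_transform f Q \<psi>))\<^sup>2) \<partial>so3_measure)
    \<le> (\<integral>\<^sup>+Q. (\<integral>\<^sup>+\<phi>. ennreal ((cmod (f (transpose Q *v e_vec \<phi>)))\<^sup>2) \<partial>interval_measure (- \<psi>) \<psi>) * ennreal (2 * \<psi>) \<partial>so3_measure)"
  proof (rule nn_integral_mono)
    fix Q :: "real^3^3"
    show "ennreal ((cmod (arc_transform f Q \<psi>))\<^sup>2)
      \<le> (\<integral>\<^sup>+\<phi>. ennreal ((cmod (f (transpose Q *v e_vec \<phi>)))\<^sup>2) \<partial>interval_measure (- \<psi>) \<psi>) * ennreal (2 * \<psi>)"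
      using interval.norm_integral_square_le[of "\<lambda>\<phi>. f (transpose Q *v e_vec \<phi>)" "- \<psi>" \<psi>] \<psi>
      by (simp add: arc_transform_eq emeasure_interval_measure)
  qed
  also have "\<dots> = ennreal (4 * pi * \<psi>) * ennreal S * ennreal (2 * \<psi>)"
    by (subst nn_integral_multc[OF m2], subst nn_integral_arc[OF \<psi> m])
      (simp add: nn_integral_cmod_square[OF f] S_def)
  also have "\<dots> = ennreal (8 * pi * \<psi>\<^sup>2 * S)"
    using \<psi> S by (simp add: power2_eq_square mult_ac flip: ennreal_mult)
  finally have le: "(\<integral>\<^sup>+Q. ennreal ((cmod (arc_transform f Q \<psi>))\<^sup>2) \<partial>so3_measure) \<le> ennreal (8 * pi * \<psi>\<^sup>2 * S)" .
  then have "(\<integral>\<^sup>+Q. ennreal ((cmod (arc_transform f Q \<psi>))\<^sup>2) \<partial>so3_measure) < \<infinity>"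
    by (rule le_less_trans) simp
  then show L: "L2 so3_measure (\<lambda>Q. arc_transform f Q \<psi>)"
    by (auto simp: L2_def integrable_iff_bounded cong: measurable_cong_sets)
  have "0 \<le> 8 * pi * \<psi>\<^sup>2 * S" using S by simp
  then show "(\<integral>Q. (cmod (arc_transform f Q \<psi>))\<^sup>2 \<partial>so3_measure) \<le> 8 * pi * \<psi>\<^sup>2 * S"
    using le unfolding nn_integral_cmod_square[OF L] by (subst (asm) ennreal_le_iff)
qed

section \<open>Singular functions, expansion and injectivity\<close>

text \<open>Orthogonality of the D-functions collapses the double sum over orders to its diagonal,
  which is the sum defining \<open>mu\<close> squared.\<close>

lemma arc_transform_Ylm_inner:
  assumes \<psi>: "0 < \<psi>" and k: "\<bar>k\<bar> \<le> int n" and k': "\<bar>k'\<bar> \<le> int n'"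
  shows "l2_inner so3_measure (\<lambda>Q. arc_transform (Ylm n k) Q \<psi>) (\<lambda>Q. arc_transform (Ylm n' k') Q \<psi>)
    = (if n = n' \<and> k = k' then of_real ((mu n \<psi>)\<^sup>2) else 0)"
proof -
  note [measurable] = measurable_arc_transform[OF \<psi> measurable_Ylm]
  have [measurable]: "cnj \<in> borel_measurable borel"
    by (intro borel_measurable_continuous_onI continuous_intros)
  define c where "c n j = norm_legendre n j 0 * s_fun j \<psi>" for n j
  define D where "D n j k p = wigner_D n j k (fst p) (fst (snd p)) (snd (snd p))" for n j k and p :: "real \<times> real \<times> real"
  let ?I = "\<lambda>n. {- int n..int n}"
  have hb: "has_bochner_integral euler_measure
    (\<lambda>p. \<Sum>j\<in>?I n. \<Sum>j'\<in>?I n'. of_real (c n j * c n' j') * (D n j k p * cnj (D n' j' k' p)))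
    (\<Sum>j\<in>?I n. \<Sum>j'\<in>?I n'. of_real (c n j * c n' j') *
      (if n = n' \<and> j = j' \<and> k = k' then of_real (8 * pi\<^sup>2 / (2 * real n + 1)) else 0))"
    unfolding D_def using k k'
    by (intro has_bochner_integral_sum has_bochner_integral_mult_right wigner_D_orthogonal) auto
  have "l2_inner so3_measure (\<lambda>Q. arc_transform (Ylm n k) Q \<psi>) (\<lambda>Q. arc_transform (Ylm n' k') Q \<psi>)
    = (\<integral>p. arc_transform (Ylm n k) (Qrot (fst p) (fst (snd p)) (snd (snd p))) \<psi> *
        cnj (arc_transform (Ylm n' k') (Qrot (fst p) (fst (snd p)) (snd (snd p))) \<psi>) \<partial>euler_measure)"
    unfolding l2_inner_def so3_measure_eq by (rule integral_distr) measurable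
  also have "\<dots> = (\<integral>p. (\<Sum>j\<in>?I n. \<Sum>j'\<in>?I n'. of_real (c n j * c n' j') * (D n j k p * cnj (D n' j' k' p))) \<partial>euler_measure)"
  proof (rule integral_cong_AE)
    show "AE p in euler_measure. arc_transform (Ylm n k) (Qrot (fst p) (fst (snd p)) (snd (snd p))) \<psi> *
        cnj (arc_transform (Ylm n' k') (Qrot (fst p) (fst (snd p)) (snd (snd p))) \<psi>)
      = (\<Sum>j\<in>?I n. \<Sum>j'\<in>?I n'. of_real (c n j * c n' j') * (D n j k p * cnj (D n' j' k' p)))"
      using AE_euler
      by eventually_elim
        (simp add: arc_transform_Ylm \<psi> k k' sum_product c_def D_def mult_ac)
  qed (use borel_measurable_has_bochner_integral[OF hb] in measurable)
  also have "\<dots> = (\<Sum>j\<in>?I n. \<Sum>j'\<in>?I n'. of_real (c n j * c n' j') *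
      (if n = n' \<and> j = j' \<and> k = k' then of_real (8 * pi\<^sup>2 / (2 * real n + 1)) else 0))"
    using hb by (rule has_bochner_integral_integral_eq)
  also have "\<dots> = (if n = n' \<and> k = k' then of_real ((mu n \<psi>)\<^sup>2) else 0)"
  proof (cases "n = n' \<and> k = k'")
    case True
    have "(\<Sum>j'\<in>?I n. of_real (c n j * c n j') * (if j = j' then of_real (8 * pi\<^sup>2 / (2 * real n + 1)) else 0))
       = complex_of_real (8 * pi\<^sup>2 / (2 * real n + 1) * \<bar>norm_legendre n j 0\<bar>\<^sup>2 * (s_fun j \<psi>)\<^sup>2)"
      if "j \<in> ?I n" for j
    proof -
      have "(\<Sum>j'\<in>?I n. of_real (c n j * c n j') * (if j = j' then of_real (8 * pi\<^sup>2 / (2 * real n + 1)) else 0))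
        = (\<Sum>j'\<in>{j}. complex_of_real (c n j * c n j' * (8 * pi\<^sup>2 / (2 * real n + 1))))"
        using that by (intro sum.mono_neutral_cong_right) auto
      then show ?thesis by (simp add: c_def power2_eq_square mult_ac)
    qed
    then show ?thesis
      using True by (simp only: mu_square of_real_sum simp_thms if_True cong: sum.cong)
  qed (auto intro!: sum.neutral)
  finally show ?thesis .
qed

text \<open>Linearity can fail for rotations along whose arc some function is not integrable; for
  finitely many functions these form a null set.\<close>

lemma AE_arc_transform_diff_sum:
  assumes \<psi>: "0 < \<psi>" and f: "L2 sphere_measure f" and I: "finite I" and e: "\<And>i. i \<in> I \<Longrightarrow> L2 sphere_measure (e i)"
  shows "AE Q in so3_measure. arc_transform (\<lambda>x. f x - (\<Sum>i\<in>I. c i * e i x)) Q \<psi>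
    = arc_transform f Q \<psi> - (\<Sum>i\<in>I. c i * arc_transform (e i) Q \<psi>)"
proof -
  have "AE Q in so3_measure. \<forall>i\<in>I. L2 (interval_measure (- \<psi>) \<psi>) (\<lambda>\<phi>. e i (transpose Q *v e_vec \<phi>))"
    using I e by (intro AE_finite_allI AE_arc_L2[OF \<psi>])
  with AE_arc_L2[OF \<psi> f] show ?thesis
  proof eventually_elim
    case (elim Q)
    have L: "L2 sphere_measure (\<lambda>x. f x - (\<Sum>i\<in>I. c i * e i x))"
      by (intro L2_diff f L2_sum L2_cmult e)
    have "integrable (interval_measure (- \<psi>) \<psi>) (\<lambda>\<phi>. f (transpose Q *v e_vec \<phi>))"
      using elim(1) by (rule interval.L2_imp_integrable)
    moreover have "integrable (interval_measure (- \<psi>) \<psi>) (\<lambda>\<phi>. e i (transpose Q *v e_vec \<phi>))" if "i \<in> I" for i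
      using elim(2) that by (auto intro: interval.L2_imp_integrable)
    ultimately show ?case
      using \<psi> e[THEN L2_borel] by (simp add: arc_transform_eq L2_borel[OF L] L2_borel[OF f] Bochner_Integration.integral_sum)
  qed
qed

lemma arc_transform_svd_error:
  assumes \<psi>: "0 < \<psi>" "\<psi> < pi" and f: "L2 sphere_measure f"
  shows "(\<integral>Q. (cmod (arc_transform f Q \<psi> - (\<Sum>i\<in>harmonic_index N. of_real (mu (fst i) \<psi>)
      * l2_inner sphere_measure f (harmonic i) * Zsing (fst i) (snd i) \<psi> Q)))\<^sup>2 \<partial>so3_measure)
    \<le> 8 * pi * \<psi>\<^sup>2 * (\<integral>x. (cmod (f x - (\<Sum>i\<in>harmonic_index N. l2_inner sphere_measure f (harmonic i) * harmonic i x)))\<^sup>2 \<partial>sphere_measure)"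
proof -
  let ?r = "\<lambda>x. f x - (\<Sum>i\<in>harmonic_index N. l2_inner sphere_measure f (harmonic i) * harmonic i x)"
  have r: "L2 sphere_measure ?r"
    by (intro L2_diff f L2_sum L2_cmult L2_harmonic)
  \<comment> \<open>The positive singular value cancels, so the truncated singular value sum is the
    transform of the truncated Fourier sum and the error is the transform of its remainder.\<close>
  have Z: "of_real (mu n \<psi>) * a * Zsing n k \<psi> Q = a * arc_transform (Ylm n k) Q \<psi>" for n k a Q
    using mu_pos[OF \<psi>, of n] by (simp add: Zsing_def)
  note [measurable] = measurable_arc_transform[OF \<psi>(1) L2_borel[OF f]] measurable_arc_transform[OF \<psi>(1) L2_borel[OF r]]
    measurable_arc_transform[OF \<psi>(1) measurable_Ylm]
  have "(\<integral>Q. (cmod (arc_transform f Q \<psi> - (\<Sum>i\<in>harmonic_index N. of_real (mu (fst i) \<psi>)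
      * l2_inner sphere_measure f (harmonic i) * Zsing (fst i) (snd i) \<psi> Q)))\<^sup>2 \<partial>so3_measure)
    = (\<integral>Q. (cmod (arc_transform ?r Q \<psi>))\<^sup>2 \<partial>so3_measure)"
  proof (rule integral_cong_AE)
    show "AE Q in so3_measure. (cmod (arc_transform f Q \<psi> - (\<Sum>i\<in>harmonic_index N. of_real (mu (fst i) \<psi>)
      * l2_inner sphere_measure f (harmonic i) * Zsing (fst i) (snd i) \<psi> Q)))\<^sup>2 = (cmod (arc_transform ?r Q \<psi>))\<^sup>2"
      using AE_arc_transform_diff_sum[where e = harmonic and
          c = "\<lambda>i. l2_inner sphere_measure f (harmonic i)", OF \<psi>(1) f finite_harmonic_index[of N] L2_harmonic]
      unfolding Z by eventually_elim (simp add: harmonic_def)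
  qed (unfold Z, measurable)
  also have "\<dots> \<le> 8 * pi * \<psi>\<^sup>2 * (\<integral>x. (cmod (?r x))\<^sup>2 \<partial>sphere_measure)"
    by (rule arc_transform_bounded[OF \<psi>(1) r])
  finally show ?thesis .
qed

lemma arc_transform_svd:
  assumes \<psi>: "0 < \<psi>" "\<psi> < pi" and f: "L2 sphere_measure f"
  shows "(\<lambda>N. \<integral>Q. (cmod (arc_transform f Q \<psi> - (\<Sum>i\<in>harmonic_index N. of_real (mu (fst i) \<psi>)
      * l2_inner sphere_measure f (harmonic i) * Zsing (fst i) (snd i) \<psi> Q)))\<^sup>2 \<partial>so3_measure) \<longlonglongrightarrow> 0"
proof (rule tendsto_sandwich[OF _ _ tendsto_const])
  show "(\<lambda>N. 8 * pi * \<psi>\<^sup>2 * (\<integral>x. (cmod (f x - (\<Sum>i\<in>harmonic_index N. l2_inner sphere_measure f (harmonic i) * harmonic i x)))\<^sup>2 \<partial>sphere_measure))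
     \<longlonglongrightarrow> 0"
    by (rule tendsto_mult_right_zero[OF harmonic_expansion[OF f]])
qed (use arc_transform_svd_error[OF \<psi> f] in auto)

lemma L2_Zsing: "0 < \<psi> \<Longrightarrow> L2 so3_measure (Zsing n k \<psi>)"
  using L2_cmult[OF L2_arc_transform[OF _ L2_harmoniclm], of \<psi> "1 / of_real (mu n \<psi>)" n k]
  by (simp add: Zsing_def[abs_def])

lemma Zsing_orthonormal:
  assumes \<psi>: "0 < \<psi>" "\<psi> < pi" and k: "\<bar>k\<bar> \<le> int n" "\<bar>k'\<bar> \<le> int n'"
  shows "l2_inner so3_measure (Zsing n k \<psi>) (Zsing n' k' \<psi>) = (if n = n' \<and> k = k' then 1 else 0)"
proof -
  have "l2_inner so3_measure (Zsing n k \<psi>) (Zsing n' k' \<psi>) = (1 / of_real (mu n \<psi> * mu n' \<psi>)) *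
     l2_inner so3_measure (\<lambda>Q. arc_transform (Ylm n k) Q \<psi>) (\<lambda>Q. arc_transform (Ylm n' k') Q \<psi>)"
    unfolding l2_inner_def integral_mult_right_zero[symmetric] by (simp add: Zsing_def)
  then show ?thesis
    using mu_pos[OF \<psi>, of n] mu_pos[OF \<psi>, of n'] by (auto simp: arc_transform_Ylm_inner[OF \<psi>(1) k] power2_eq_square)
qed

text \<open>If the transform vanishes, the expansion error equals the sum of the squared moduli of
  \<open>a\<close>. These partial sums increase and tend to 0, so every \<open>a i\<close> is 0;
  positivity of the singular values kills the Fourier coefficients, and completeness kills
  f.\<close>

lemma arc_transform_injective:
  assumes \<psi>: "0 < \<psi>" "\<psi> < pi" and f: "L2 sphere_measure f"
    and null: "AE Q in so3_measure. arc_transform f Q \<psi> = 0"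
  shows "AE x in sphere_measure. f x = 0"
proof -
  define a where "a i = of_real (mu (fst i) \<psi>) * l2_inner sphere_measure f (harmonic i)" for i
  define Z where "Z i = Zsing (fst i) (snd i) \<psi>" for i
  have Zo: "l2_inner so3_measure (Z i) (Z j) = (if i = j then 1 else 0)"
    if "i \<in> harmonic_index N" "j \<in> harmonic_index N" for i j N
    unfolding Z_def using that Zsing_orthonormal[OF \<psi>, of "snd i" "fst i" "snd j" "fst j"]
    by (auto simp: harmonic_index_def prod_eq_iff abs_le_iff)
  have LZ: "L2 so3_measure (Z i)" for i
    unfolding Z_def by (rule L2_Zsing[OF \<psi>(1)])
  note [measurable] = L2_measurable[OF LZ] measurable_arc_transform[OF \<psi>(1) L2_borel[OF f]]
  have "(\<integral>Q. (cmod (arc_transform f Q \<psi> - (\<Sum>i\<in>harmonic_index N. a i * Z i Q)))\<^sup>2 \<partial>so3_measure)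
    = (\<Sum>i\<in>harmonic_index N. (cmod (a i))\<^sup>2)" for N
  proof -
    have "(\<integral>Q. (cmod (arc_transform f Q \<psi> - (\<Sum>i\<in>harmonic_index N. a i * Z i Q)))\<^sup>2 \<partial>so3_measure)
      = (\<integral>Q. (cmod (0 - (\<Sum>i\<in>harmonic_index N. a i * Z i Q)))\<^sup>2 \<partial>so3_measure)"
    proof (rule integral_cong_AE)
      show "AE Q in so3_measure. (cmod (arc_transform f Q \<psi> - (\<Sum>i\<in>harmonic_index N. a i * Z i Q)))\<^sup>2
         = (cmod (0 - (\<Sum>i\<in>harmonic_index N. a i * Z i Q)))\<^sup>2"
        using null by eventually_elim simp
    qed measurable
    also have "\<dots> = (\<integral>Q. (cmod 0)\<^sup>2 \<partial>so3_measure) - (\<Sum>i\<in>harmonic_index N. (cmod (l2_inner so3_measure (\<lambda>_. 0) (Z i)))\<^sup>2)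
       + (\<Sum>i\<in>harmonic_index N. (cmod (a i - l2_inner so3_measure (\<lambda>_. 0) (Z i)))\<^sup>2)"
      \<comment> \<open>Applied to the zero function, the error formula is Parseval's identity for
        the finite combination.\<close>
      by (rule orthonormal_square_error) (rule finite_harmonic_index LZ L2_zero Zo | assumption)+
    finally show ?thesis by (simp add: l2_inner_def)
  qed
  then have lim: "(\<lambda>N. \<Sum>i\<in>harmonic_index N. (cmod (a i))\<^sup>2) \<longlonglongrightarrow> 0"
    using arc_transform_svd[OF \<psi> f] by (simp add: a_def Z_def)
  have a0: "a i = 0" if "i \<in> harmonic_index M" for i M
  proof -
    have "(cmod (a i))\<^sup>2 \<le> (\<Sum>i\<in>harmonic_index N. (cmod (a i))\<^sup>2)" if "M \<le> N" for N
      using \<open>i \<in> harmonic_index M\<close> harmonic_index_mono[OF that] by (intro member_le_sum) auto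
    then have "(cmod (a i))\<^sup>2 \<le> 0"
      by (intro tendsto_lowerbound[OF lim]) (auto simp: eventually_sequentially)
    then show ?thesis by simp
  qed
  have "l2_inner sphere_measure f (harmonic i) = 0" if "i \<in> harmonic_index M" for i M
    using a0[OF that] mu_pos[OF \<psi>, of "fst i"] by (simp add: a_def)
  then have "(\<lambda>N. \<integral>x. (cmod (f x))\<^sup>2 \<partial>sphere_measure) \<longlonglongrightarrow> 0"
    using harmonic_expansion[OF f] by simp
  then have "(\<integral>x. (cmod (f x))\<^sup>2 \<partial>sphere_measure) = 0"
    by (simp add: LIMSEQ_const_iff)
  then have "AE x in sphere_measure. (cmod (f x))\<^sup>2 = 0"
    by (subst (asm) integral_nonneg_eq_0_iff_AE) (auto intro: L2_integrable f)
  then show ?thesis by simp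
qed

theorem theorem4:
  fixes \<psi> :: real
  assumes "0 < \<psi>" and "\<psi> < pi"
  shows
    \<comment> \<open>positive singular values\<close>
    "(\<forall>n k. \<bar>k\<bar> \<le> int n \<longrightarrow> mu n \<psi> > 0)
     \<comment> \<open>Y_n^k: orthonormal system in L^2(S^2) ...\<close>
   \<and> (\<forall>n k. \<bar>k\<bar> \<le> int n \<longrightarrow> L2 sphere_measure (Ylm n k))
   \<and> (\<forall>n k n' k'. \<bar>k\<bar> \<le> int n \<longrightarrow> \<bar>k'\<bar> \<le> int n' \<longrightarrow>
        l2_inner sphere_measure (Ylm n k) (Ylm n' k') = (if n = n' \<and> k = k' then 1 else 0))
     \<comment> \<open>... which is complete\<close>
   \<and> (\<forall>f. L2 sphere_measure f \<longrightarrow>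
        (\<lambda>N. LINT x|sphere_measure.
              (cmod (f x - (\<Sum>n\<le>N. \<Sum>k\<in>{-int n..int n}.
                              l2_inner sphere_measure f (Ylm n k) * Ylm n k x)))\<^sup>2)
        \<longlonglongrightarrow> 0)
     \<comment> \<open>Z_{n,psi}^k: orthonormal system in L^2(SO(3))\<close>
   \<and> (\<forall>n k. \<bar>k\<bar> \<le> int n \<longrightarrow> L2 so3_measure (Zsing n k \<psi>))
   \<and> (\<forall>n k n' k'. \<bar>k\<bar> \<le> int n \<longrightarrow> \<bar>k'\<bar> \<le> int n' \<longrightarrow>
        l2_inner so3_measure (Zsing n k \<psi>) (Zsing n' k' \<psi>) = (if n = n' \<and> k = k' then 1 else 0))
     \<comment> \<open>singular value expansion of A_psi on L^2(S^2)\<close>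
   \<and> (\<forall>f. L2 sphere_measure f \<longrightarrow>
        L2 so3_measure (\<lambda>Q. arc_transform f Q \<psi>) \<and>
        (\<lambda>N. LINT Q|so3_measure.
              (cmod (arc_transform f Q \<psi> - (\<Sum>n\<le>N. \<Sum>k\<in>{-int n..int n}.
                   complex_of_real (mu n \<psi>) * l2_inner sphere_measure f (Ylm n k) * Zsing n k \<psi> Q)))\<^sup>2)
        \<longlonglongrightarrow> 0)
     \<comment> \<open>explicit form of the singular functions\<close>
   \<and> (\<forall>n k a b g. \<bar>k\<bar> \<le> int n \<longrightarrow> 0 < b \<longrightarrow> b < pi \<longrightarrow>
        Zsing n k \<psi> (Qrot a b g) =
          complex_of_real (1 / mu n \<psi>) *
          (\<Sum>j\<in>{-int n..int n}. complex_of_real (norm_legendre n j 0 * s_fun j \<psi>) * wigner_D n j k a b g))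
     \<comment> \<open>injectivity\<close>
   \<and> (\<forall>f. L2 sphere_measure f \<longrightarrow> (AE Q in so3_measure. arc_transform f Q \<psi> = 0) \<longrightarrow>
        (AE x in sphere_measure. f x = 0))"
proof (intro conjI allI impI)
  note \<psi> = assms
  fix n n' :: nat and k k' :: int assume k: "\<bar>k\<bar> \<le> int n"
  show "mu n \<psi> > 0" by (rule mu_pos[OF \<psi>])
  show "L2 sphere_measure (Ylm n k)" by (rule L2_harmoniclm)
  show "L2 so3_measure (Zsing n k \<psi>)" by (rule L2_Zsing[OF \<psi>(1)])
  {
    fix a b g :: real assume "0 < b" "b < pi"
    then show "Zsing n k \<psi> (Qrot a b g) = complex_of_real (1 / mu n \<psi>) *
          (\<Sum>j\<in>{-int n..int n}. complex_of_real (norm_legendre n j 0 * s_fun j \<psi>) * wigner_D n j k a b g)"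
      by (simp add: Zsing_def arc_transform_Ylm[OF \<psi>(1) k])
  }
  assume k': "\<bar>k'\<bar> \<le> int n'"
  show "l2_inner sphere_measure (Ylm n k) (Ylm n' k') = (if n = n' \<and> k = k' then 1 else 0)"
    by (rule Ylm_orthonormal[OF k k'])
  show "l2_inner so3_measure (Zsing n k \<psi>) (Zsing n' k' \<psi>) = (if n = n' \<and> k = k' then 1 else 0)"
    by (rule Zsing_orthonormal[OF \<psi> k k'])
next
  note \<psi> = assms
  fix f assume f: "L2 sphere_measure f"
  show "(\<lambda>N. LINT x|sphere_measure. (cmod (f x - (\<Sum>n\<le>N. \<Sum>k\<in>{-int n..int n}.
      l2_inner sphere_measure f (Ylm n k) * Ylm n k x)))\<^sup>2) \<longlonglongrightarrow> 0"
    using harmonic_expansion[OF f] by (simp add: sum_harmonic_index harmonic_def)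
  show "L2 so3_measure (\<lambda>Q. arc_transform f Q \<psi>)"
    by (rule L2_arc_transform[OF \<psi>(1) f])
  show "(\<lambda>N. LINT Q|so3_measure. (cmod (arc_transform f Q \<psi> - (\<Sum>n\<le>N. \<Sum>k\<in>{-int n..int n}.
      complex_of_real (mu n \<psi>) * l2_inner sphere_measure f (Ylm n k) * Zsing n k \<psi> Q)))\<^sup>2) \<longlonglongrightarrow> 0"
    using arc_transform_svd[OF \<psi> f] by (simp add: sum_harmonic_index harmonic_def)
  assume "AE Q in so3_measure. arc_transform f Q \<psi> = 0"
  then show "AE x in sphere_measure. f x = 0"
    by (rule arc_transform_injective[OF \<psi> f])
qed

end
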